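(* There are universal constants $c_3,\epsilon_1>0$ and a randomized polynomial-time rounding algorithm such that the following holds. Let $G=(V,E)$ be an $r$-regular graph on $n$ vertices and $\{\mathbf x_v\}_{v\in V}$ a feasible solution of the ARV relaxation of cost $\mathrm{sdp}$. If there are $2k$ sets $T_1,\dots,T_{2k}\subseteq V$, each of diameter at most $c_3/\sqrt{\log k}$ with respect to $d^2_{\mathbf x}$, covering at least $(1-\epsilon_1)n$ vertices, then the algorithm finds, with high probability, a cut $S$ ($0<|S|\le n/2$) of expansion $\phi(S)\le O(\sqrt{\log k})\cdot\mathrm{sdp}$.
   Context: $\phi(S)=|E(S,\bar S)|/(r|S|)$. $d^2_{\mathbf x}(u,v)=\|\mathbf x_u-\mathbf x_v\|^2$, and the diameter of $T$ w.r.t. $d$ is $\max_{u,v\in T}d(u,v)$. The ARV relaxation: vectors $\{\mathbf x_v\}_{v\in V}$ with $\sum_{u,v\in V}\|\mathbf x_u-\mathbf x_v\|^2=n^2$ and $\|\mathbf x_u-\mathbf x_v\|^2\le\|\mathbf x_u-\mathbf x_w\|^2+\|\mathbf x_w-\mathbf x_v\|^2$ for all $u,v,w\in V$; the cost of a solution is $\frac{1}{2rn}\sum_{(u,v)\in E}\|\mathbf x_u-\mathbf x_v\|^2$. *)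

theory Defs
  imports "HOL-Probability.Probability" "HOL-Computational_Algebra.Polynomial"
begin

text \<open>
  Graphs have vertex set \<open>{..<n}\<close>.  The edge set of an undirected simple graph is a symmetric
  irreflexive relation, so both orientations of an edge belong to \<open>E\<close>.
\<close>

definition regular_graph :: "nat \<Rightarrow> nat \<Rightarrow> (nat \<times> nat) set \<Rightarrow> bool" where
  "regular_graph n r E \<longleftrightarrow>
     E \<subseteq> {..<n} \<times> {..<n} \<and> sym E \<and> irrefl E \<and> (\<forall>u<n. card {v. (u, v) \<in> E} = r)"

text \<open>Each undirected edge between \<open>A\<close> and \<open>B\<close> is counted once if \<open>A\<close> and \<open>B\<close> are disjoint.\<close>

definition edges_between :: "(nat \<times> nat) set \<Rightarrow> nat set \<Rightarrow> nat set \<Rightarrow> (nat \<times> nat) set" where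
  "edges_between E A B = {(u, v) \<in> E. u \<in> A \<and> v \<in> B}"

definition expansion :: "nat \<Rightarrow> nat \<Rightarrow> (nat \<times> nat) set \<Rightarrow> nat set \<Rightarrow> real" where
  "expansion n r E S = real (card (edges_between E S ({..<n} - S))) / (real r * real (card S))"

text \<open>
  A family of vectors in \<open>\<real>\<^sup>m\<close> is given by its coordinates \<open>x v i\<close>, \<open>i < m\<close>, since the dimension
  is part of the input of an algorithm.
\<close>

definition sqdist :: "nat \<Rightarrow> (nat \<Rightarrow> nat \<Rightarrow> real) \<Rightarrow> nat \<Rightarrow> nat \<Rightarrow> real" where
  "sqdist m x u v = (L2_set (\<lambda>i. x u i - x v i) {..<m})\<^sup>2"

definition diam :: "('a \<Rightarrow> 'a \<Rightarrow> real) \<Rightarrow> 'a set \<Rightarrow> real" where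
  "diam d T = (if T = {} then 0 else Max {d u v | u v. u \<in> T \<and> v \<in> T})"

definition arv_feasible :: "nat \<Rightarrow> nat \<Rightarrow> (nat \<Rightarrow> nat \<Rightarrow> real) \<Rightarrow> bool" where
  "arv_feasible n m x \<longleftrightarrow>
     (\<Sum>u<n. \<Sum>v<n. sqdist m x u v) = (real n)\<^sup>2 \<and>
     (\<forall>u<n. \<forall>v<n. \<forall>w<n. sqdist m x u v \<le> sqdist m x u w + sqdist m x w v)"

definition arv_cost ::
  "nat \<Rightarrow> nat \<Rightarrow> (nat \<times> nat) set \<Rightarrow> nat \<Rightarrow> (nat \<Rightarrow> nat \<Rightarrow> real) \<Rightarrow> real" where
  "arv_cost n r E m x = 1 / (2 * real r * real n) * (\<Sum>(u, v)\<in>E. sqdist m x u v)"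

text \<open>
  The model of computation is a real RAM with fair coin tosses.  Memory consists of two-dimensional
  arrays of natural numbers and of real numbers.  Natural numbers are only added and (cut-off)
  subtracted, so that \<open>t\<close> steps increase their binary length by at most \<open>O(t)\<close>; they may be used
  as addresses.  Reals admit exact field operations (with \<open>x / 0 = 0\<close>) and comparisons, but no
  rounding and no conversion to natural numbers.  Every command costs one step: the expressions
  occurring in a fixed program have bounded size.
\<close>

record store =
  nats :: "nat \<Rightarrow> nat \<Rightarrow> nat \<Rightarrow> nat"
  reals :: "nat \<Rightarrow> nat \<Rightarrow> nat \<Rightarrow> real"

datatype nexp =
    NConst nat
  | NRead nat nexp nexp
  | NAdd nexp nexp
  | NSub nexp nexp

datatype rexp =
    ROfNat nexp
  | RRead nat nexp nexp
  | RAdd rexp rexp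
  | RSub rexp rexp
  | RMul rexp rexp
  | RDiv rexp rexp

datatype bexp =
    NLess nexp nexp
  | RLess rexp rexp
  | BNot bexp
  | BAnd bexp bexp

datatype com =
    NWrite nat nexp nexp nexp
  | RWrite nat nexp nexp rexp
  | Coin nat nexp nexp
  | Seq com com
  | Cond bexp com com
  | Loop bexp com

primrec nval :: "nexp \<Rightarrow> store \<Rightarrow> nat" where
  "nval (NConst c) s = c"
| "nval (NRead a i j) s = nats s a (nval i s) (nval j s)"
| "nval (NAdd e f) s = nval e s + nval f s"
| "nval (NSub e f) s = nval e s - nval f s"

primrec rval :: "rexp \<Rightarrow> store \<Rightarrow> real" where
  "rval (ROfNat e) s = real (nval e s)"
| "rval (RRead a i j) s = reals s a (nval i s) (nval j s)"
| "rval (RAdd e f) s = rval e s + rval f s"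
| "rval (RSub e f) s = rval e s - rval f s"
| "rval (RMul e f) s = rval e s * rval f s"
| "rval (RDiv e f) s = rval e s / rval f s"

primrec bval :: "bexp \<Rightarrow> store \<Rightarrow> bool" where
  "bval (NLess e f) s \<longleftrightarrow> nval e s < nval f s"
| "bval (RLess e f) s \<longleftrightarrow> rval e s < rval f s"
| "bval (BNot b) s \<longleftrightarrow> \<not> bval b s"
| "bval (BAnd b c) s \<longleftrightarrow> bval b s \<and> bval c s"

definition upd :: "nat \<Rightarrow> nat \<Rightarrow> nat \<Rightarrow> 'v \<Rightarrow> (nat \<Rightarrow> nat \<Rightarrow> nat \<Rightarrow> 'v) \<Rightarrow> nat \<Rightarrow> nat \<Rightarrow> nat \<Rightarrow> 'v" where
  "upd a i j y M = M(a := (M a)(i := (M a i)(j := y)))"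

text \<open>A configuration is the list of commands still to be executed together with the store.\<close>

type_synonym config = "com list \<times> store"

fun step :: "config \<Rightarrow> config pmf" where
  "step ([], s) = return_pmf ([], s)"
| "step (NWrite a i j e # cs, s) =
     return_pmf (cs, s\<lparr>nats := upd a (nval i s) (nval j s) (nval e s) (nats s)\<rparr>)"
| "step (RWrite a i j e # cs, s) =
     return_pmf (cs, s\<lparr>reals := upd a (nval i s) (nval j s) (rval e s) (reals s)\<rparr>)"
| "step (Coin a i j # cs, s) =
     map_pmf (\<lambda>b. (cs, s\<lparr>nats := upd a (nval i s) (nval j s) (of_bool b) (nats s)\<rparr>))
       (bernoulli_pmf (1 / 2))"
| "step (Seq c d # cs, s) = return_pmf (c # d # cs, s)"
| "step (Cond b c d # cs, s) = return_pmf ((if bval b s then c else d) # cs, s)"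
| "step (Loop b c # cs, s) = return_pmf (if bval b s then c # Loop b c # cs else cs, s)"

primrec run :: "nat \<Rightarrow> config \<Rightarrow> config pmf" where
  "run 0 cfg = return_pmf cfg"
| "run (Suc t) cfg = bind_pmf (step cfg) (run t)"

definition halts_within :: "com \<Rightarrow> store \<Rightarrow> nat \<Rightarrow> bool" where
  "halts_within P s t \<longleftrightarrow> (\<forall>(cs, s') \<in> set_pmf (run t ([P], s)). cs = [])"

text \<open>Distribution of the final store; meaningful if \<open>halts_within P s t\<close> for some \<open>t\<close>.\<close>

definition final_store :: "com \<Rightarrow> store \<Rightarrow> store pmf" where
  "final_store P s = map_pmf snd (run (LEAST t. halts_within P s t) ([P], s))"

text \<open>
  Input: array \<open>0\<close> of naturals holds \<open>n\<close> and \<open>m\<close>, array \<open>1\<close> the adjacency matrix, and array \<open>0\<close> of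
  reals the coordinates of the vectors; everything else is \<open>0\<close>.  Output: the set of vertices marked
  in array \<open>2\<close> of naturals.
\<close>

definition encode :: "nat \<Rightarrow> (nat \<times> nat) set \<Rightarrow> nat \<Rightarrow> (nat \<Rightarrow> nat \<Rightarrow> real) \<Rightarrow> store" where
  "encode n E m x =
     \<lparr>nats = (\<lambda>a i j.
        if a = 0 \<and> i = 0 \<and> j = 0 then n
        else if a = 0 \<and> i = 1 \<and> j = 0 then m
        else if a = 1 \<and> i < n \<and> j < n \<and> (i, j) \<in> E then 1 else 0),
      reals = (\<lambda>a i j. if a = 0 \<and> i < n \<and> j < m then x i j else 0)\<rparr>"

definition marked :: "nat \<Rightarrow> store \<Rightarrow> nat set" where
  "marked n s = {v. v < n \<and> nats s 2 v 0 \<noteq> 0}"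

definition output_cut :: "com \<Rightarrow> nat \<Rightarrow> (nat \<times> nat) set \<Rightarrow> nat \<Rightarrow> (nat \<Rightarrow> nat \<Rightarrow> real) \<Rightarrow> nat set pmf" where
  "output_cut P n E m x = map_pmf (marked n) (final_store P (encode n E m x))"

definition fraction_of_bits :: "nat \<Rightarrow> real \<Rightarrow> bool" where
  "fraction_of_bits b y \<longleftrightarrow>
     (\<exists>p q :: int. y = of_int p / of_int q \<and> 0 < q \<and> \<bar>p\<bar> < 2 ^ b \<and> q < 2 ^ b)"

text \<open>
  Polynomial time is meant in the strong sense of Groetschel, Lovasz and Schrijver: on all (real)
  inputs and for all outcomes of the coin tosses the number of steps is polynomial in the
  dimensions of the input, and on rational inputs all intermediate results are moreover fractions
  of binary length polynomial in the input length.  In particular, on rational inputs the algorithm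
  runs in polynomial time on a randomized Turing machine.
\<close>

definition randomized_poly_time :: "com \<Rightarrow> bool" where
  "randomized_poly_time P \<longleftrightarrow>
     (\<exists>p :: nat poly. \<forall>n E m x. halts_within P (encode n E m x) (poly p (n + m))) \<and>
     (\<exists>q :: nat poly. \<forall>n E m x b.
        (\<forall>v<n. \<forall>i<m. fraction_of_bits b (x v i)) \<longrightarrow>
        (\<forall>t. \<forall>(cs, s) \<in> set_pmf (run t ([P], encode n E m x)).
           \<forall>a i j. fraction_of_bits (poly q (n + m + b)) (reals s a i j)))"

end

theory Submission
  imports Defs
begin

text \<open>
  The rounding follows Rothvoss' potential-function proof of the theorem of Arora, Rao and Vazirani,
  with random signs in place of Gaussians.  If half of the vertices lie in a small ball, a sweep over
  balls succeeds.  Otherwise a random sign vector spreads the projections of the vertices with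
  constant probability, and after removing a small maximal matching of short but stretched pairs,
  two large sets of vertices remain at distance greater than \<open>\<Delta>\<close>, so that a sweep succeeds again.

  The matching is small on average: move the endpoints of its edges to representatives of their
  clusters, which spoils only few edges, and let \<open>Y l v\<close> be the largest projection, relative to \<open>v\<close>,
  of a representative at distance at most \<open>l * D\<close> from \<open>v\<close>.  A matching edge from \<open>u\<close> to \<open>v\<close> gives
  \<open>Y (l + 1) u \<ge> Y l v + s\<close>.  By the Poincare inequality \<open>Y l v\<close> has variance \<open>O(l * D)\<close>, hence is
  almost uncorrelated with the set of matched vertices, and averaging over a sign vector and its
  negative shows that the mean of \<open>\<Sum>v. Y l v\<close> grows linearly in \<open>l\<close> up to \<open>l \<approx> 1 / D\<close>.  It is,
  however, at most \<open>n\<close> times the mean of a maximum over \<open>2 * k\<close> representatives.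

  The algorithm does not know \<open>k\<close>, the clusters or \<open>\<Delta>\<close>: it tries all distances as thresholds and
  keeps the best cut.
\<close>

section \<open>Averages over random signs\<close>

text \<open>One balance fixes the scales. With \<Delta> and \<open>D\<close> of order
  \<open>1 / sqrt (ln k)\<close> the chain has about \<open>sqrt (ln k)\<close> levels, so
  \<open>L * D\<close>, and with it every variance, stays below a small constant. If matchings were
  large, each level would gain a fixed multiple of \<open>n\<close>, in total order
  \<open>n * sqrt (ln k)\<close>. A maximum over at most \<open>2 * k\<close> projections of squared
  length \<open>L * D\<close> has mean at most a small multiple of \<open>sqrt (ln k)\<close>.
  Representatives are there to get \<open>ln k\<close> instead of \<open>ln n\<close>.

  The obstacle is that the matching depends on the same signs as the projections: the gain could be
  eaten up if first endpoints are those with large \<open>Y\<close>. The pairs matched for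
  \<open>- g\<close>, read backwards, are stretched for \<open>g\<close>. Adding both inequalities
  makes the weight of \<open>Y\<close> an odd function of \<open>g\<close>, so that the mean of
  \<open>Y\<close> drops out and only its deviation counts.

  Signs suit the model, which has only fair coins, and turn expectations into the finite recursion
  \<open>avg\<close>, with all coordinates from \<open>m\<close> on equal to 0. The facts used about
  them are the second and fourth moments, a subgaussian bound and the Poincare inequality.\<close>

primrec avg :: "nat \<Rightarrow> ((nat \<Rightarrow> real) \<Rightarrow> real) \<Rightarrow> real" where
  "avg 0 f = f (\<lambda>_. 0)"
| "avg (Suc m) f = (avg m (\<lambda>g. f (g(m := 1))) + avg m (\<lambda>g. f (g(m := - 1)))) / 2"

definition signs :: "nat \<Rightarrow> (nat \<Rightarrow> real) \<Rightarrow> bool" where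
  "signs m g \<longleftrightarrow> (\<forall>i<m. g i = 1 \<or> g i = - 1)"

definition ip :: "nat \<Rightarrow> (nat \<Rightarrow> real) \<Rightarrow> (nat \<Rightarrow> real) \<Rightarrow> real" where
  "ip m g w = (\<Sum>i<m. g i * w i)"

lemma avg_const [simp]: "avg m (\<lambda>_. c) = c"
  by (induction m) auto

lemma avg_add: "avg m (\<lambda>g. f g + h g) = avg m f + avg m h"
  by (induction m arbitrary: f h) (auto simp: field_simps)

lemma avg_cmult: "avg m (\<lambda>g. c * f g) = c * avg m f"
  by (induction m arbitrary: f) (auto simp: field_simps)

lemma avg_divide: "avg m (\<lambda>g. f g / c) = avg m f / c"
  using avg_cmult[of m "1 / c" f] by simp

lemma avg_minus: "avg m (\<lambda>g. - f g) = - avg m f"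
  using avg_cmult[of m "- 1" f] by simp

lemma avg_diff: "avg m (\<lambda>g. f g - h g) = avg m f - avg m h"
  using avg_add[of m f "\<lambda>g. - h g"] by (simp add: avg_minus)

lemma avg_sum: "avg m (\<lambda>g. \<Sum>a\<in>A. f a g) = (\<Sum>a\<in>A. avg m (f a))"
  by (induction A rule: infinite_finite_induct) (auto simp: avg_add)

text \<open>Each branch of the recursion fixes a coordinate to plus or minus 1, so a comparison at
  sign vectors suffices. This is how \<open>\<bar>g i\<bar> = 1\<close> enters
  \<open>avg_var_Max\<close>.\<close>

lemma avg_mono_signs:
  assumes "\<And>g. signs m g \<Longrightarrow> f g \<le> h g"
  shows "avg m f \<le> avg m h"
  using assms
proof (induction m arbitrary: f h)
  case 0
  then show ?case by (simp add: signs_def)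
next
  case (Suc m)
  have "avg m (\<lambda>g. f (g(m := c))) \<le> avg m (\<lambda>g. h (g(m := c)))" if "c = 1 \<or> c = - 1" for c
    using that by (intro Suc.IH Suc.prems) (auto simp: signs_def less_Suc_eq)
  from this[of 1] this[of "- 1"] show ?case by simp
qed

lemma avg_mono: "(\<And>g. f g \<le> h g) \<Longrightarrow> avg m f \<le> avg m h"
  by (rule avg_mono_signs)

lemma avg_neg: "avg m (\<lambda>g. f (\<lambda>i. - g i)) = avg m f"
proof (induction m arbitrary: f)
  case (Suc m)
  have *: "(\<lambda>i. - (g(m := c)) i) = (\<lambda>i. - g i)(m := - c)" for g and c :: real
    by auto
  show ?case
    using Suc[of "\<lambda>g. f (g(m := - 1))"] Suc[of "\<lambda>g. f (g(m := 1))"]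
    unfolding avg.simps * by simp
qed auto

lemma avg_flip: "i < m \<Longrightarrow> avg m (\<lambda>g. f (g(i := - g i))) = avg m f"
proof (induction m arbitrary: f)
  case (Suc m)
  show ?case
  proof (cases "i = m")
    case True
    then have "(g(m := c))(i := - (g(m := c)) i) = g(m := - c)" for g and c :: real
      by auto
    then show ?thesis
      unfolding avg.simps by simp
  next
    case False
    then have up: "(g(m := c))(i := - (g(m := c)) i) = (g(i := - g i))(m := c)" for g and c :: real
      by auto
    have *: "avg m (\<lambda>g. f ((g(i := - g i))(m := c))) = avg m (\<lambda>g. f (g(m := c)))" for c
      by (rule Suc.IH[where f = "\<lambda>g. f (g(m := c))"]) (use False Suc.prems in simp)
    show ?thesis
      unfolding avg.simps up * ..
  qed
qed auto

lemma ip_upd_ge [simp]: "m \<le> i \<Longrightarrow> ip m (g(i := c)) w = ip m g w"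
  by (auto simp: ip_def intro: sum.cong)

lemma ip_Suc: "ip (Suc m) g w = ip m g w + g m * w m"
  by (simp add: ip_def)

lemma ip_minus [simp]: "ip m (\<lambda>i. - g i) w = - ip m g w"
  by (simp add: ip_def sum_negf)

lemma ip_diff: "ip m g (\<lambda>i. v i - w i) = ip m g v - ip m g w"
  by (simp add: ip_def sum_subtractf algebra_simps)

lemma ip_flip:
  assumes "i < m"
  shows "ip m (g(i := - g i)) w = ip m g w - 2 * g i * w i"
proof -
  have "ip m (g(i := - g i)) w = (\<Sum>j<m. g j * w j - (if j = i then 2 * g i * w i else 0))"
    unfolding ip_def by (intro sum.cong) auto
  then show ?thesis
    using assms by (simp add: sum_subtractf ip_def)
qed

text \<open>Averaging out the last coordinate splits the variance of \<open>f\<close> into that of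
  the averaged function \<open>h\<close> and a part due to the last coordinate alone. Convexity of
  the square bounds the coordinate differences of \<open>h\<close> by averages of those of
  \<open>f\<close>.\<close>

lemma avg_poincare:
  "avg m (\<lambda>g. (f g - avg m f)\<^sup>2) \<le> (\<Sum>i<m. avg m (\<lambda>g. ((f g - f (g(i := - g i))) / 2)\<^sup>2))"
proof (induction m arbitrary: f)
  case (Suc m)
  define p where "p = (\<lambda>g. f (g(m := 1)))"
  define q where "q = (\<lambda>g. f (g(m := - 1)))"
  define h where "h = (\<lambda>g. (p g + q g) / 2)"
  have avh: "avg (Suc m) f = avg m h"
    by (simp add: p_def q_def h_def avg_add avg_divide)
  define c where "c = avg m h"
  \<comment> \<open>Parallelogram law: both branches differ from their midpoint by half their
    difference.\<close>
  have sq: "((p g - c)\<^sup>2 + (q g - c)\<^sup>2) / 2 = (h g - c)\<^sup>2 + ((p g - q g) / 2)\<^sup>2" for g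
    by (simp add: h_def power2_eq_square field_simps)
  have "avg (Suc m) (\<lambda>g. (f g - avg (Suc m) f)\<^sup>2)
      = avg m (\<lambda>g. ((p g - c)\<^sup>2 + (q g - c)\<^sup>2) / 2)"
    unfolding avh c_def[symmetric] by (simp add: avg_add avg_divide p_def q_def)
  also have "\<dots> = avg m (\<lambda>g. (h g - avg m h)\<^sup>2) + avg m (\<lambda>g. ((p g - q g) / 2)\<^sup>2)"
    by (simp only: sq avg_add) (simp only: c_def)
  also have "avg m (\<lambda>g. (h g - avg m h)\<^sup>2)
      \<le> (\<Sum>i<m. avg m (\<lambda>g. ((h g - h (g(i := - g i))) / 2)\<^sup>2))"
    by (rule Suc.IH)
  also have "\<dots> \<le> (\<Sum>i<m. avg (Suc m) (\<lambda>g. ((f g - f (g(i := - g i))) / 2)\<^sup>2))"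
  proof (rule sum_mono)
    fix i assume "i \<in> {..<m}"
    then have "i \<noteq> m" by auto
    then have up: "(g(m := c))(i := - (g(m := c)) i) = (g(i := - g i))(m := c)" for g and c :: real
      by auto
    have "((h g - h (g(i := - g i))) / 2)\<^sup>2 \<le>
      (((p g - p (g(i := - g i))) / 2)\<^sup>2 + ((q g - q (g(i := - g i))) / 2)\<^sup>2) / 2" for g
    proof -
      have "((a + b) / 2)\<^sup>2 \<le> (a\<^sup>2 + b\<^sup>2) / 2" for a b :: real
        using zero_le_power2[of "a - b"] by (simp add: power2_eq_square field_simps)
      from this[of "(p g - p (g(i := - g i))) / 2" "(q g - q (g(i := - g i))) / 2"] show ?thesis
        by (simp add: h_def add_divide_distrib diff_divide_distrib algebra_simps)
    qed
    then have "avg m (\<lambda>g. ((h g - h (g(i := - g i))) / 2)\<^sup>2) \<le>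
      avg m (\<lambda>g. (((p g - p (g(i := - g i))) / 2)\<^sup>2 + ((q g - q (g(i := - g i))) / 2)\<^sup>2) / 2)"
      by (rule avg_mono)
    also have "\<dots> = avg (Suc m) (\<lambda>g. ((f g - f (g(i := - g i))) / 2)\<^sup>2)"
      unfolding avg.simps up by (simp add: p_def q_def avg_add avg_divide)
    finally show "avg m (\<lambda>g. ((h g - h (g(i := - g i))) / 2)\<^sup>2) \<le>
      avg (Suc m) (\<lambda>g. ((f g - f (g(i := - g i))) / 2)\<^sup>2)" .
  qed
  also have "avg m (\<lambda>g. ((p g - q g) / 2)\<^sup>2)
      = avg (Suc m) (\<lambda>g. ((f g - f (g(m := - g m))) / 2)\<^sup>2)"
  proof -
    have "((f (g(m := - 1)) - f (g(m := 1))) / 2)\<^sup>2 = ((f (g(m := 1)) - f (g(m := - 1))) / 2)\<^sup>2" for g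
      by (simp add: power2_eq_square field_simps)
    then show ?thesis by (simp add: p_def q_def)
  qed
  finally show ?case by (simp only: sum.lessThan_Suc)
qed auto

text \<open>The maximiser at \<open>g\<close> loses at most \<open>2 * \<bar>w j i\<bar>\<close>
  when sign \<open>i\<close> is flipped, which bounds the decrease of the maximum but not its
  increase. Hence only positive parts \<open>P\<close> are estimated; by symmetry under the flip
  this costs a factor 2. The bound is independent of the size of \<open>J\<close>.\<close>

lemma avg_var_Max:
  fixes w :: "'a \<Rightarrow> nat \<Rightarrow> real"
  assumes J: "finite J" "J \<noteq> {}" and R: "\<And>j. j \<in> J \<Longrightarrow> (\<Sum>i<m. (w j i)\<^sup>2) \<le> R"
  defines "f \<equiv> \<lambda>g. Max ((\<lambda>j. ip m g (w j)) ` J)"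
  shows "avg m (\<lambda>g. (f g - avg m f)\<^sup>2) \<le> 2 * R"
proof -
  define P where "P i g = (max 0 ((f g - f (g(i := - g i))) / 2))\<^sup>2" for i g
  have "avg m (\<lambda>g. (f g - avg m f)\<^sup>2) \<le> (\<Sum>i<m. avg m (\<lambda>g. ((f g - f (g(i := - g i))) / 2)\<^sup>2))"
    by (rule avg_poincare)
  also have "\<dots> = (\<Sum>i<m. 2 * avg m (P i))"
  proof (rule sum.cong)
    fix i assume "i \<in> {..<m}"
    \<comment> \<open>One of the two summands is 0: a change is a decrease seen from exactly one
      side, unless it vanishes.\<close>
    have "((f g - f (g(i := - g i))) / 2)\<^sup>2 = P i g + P i (g(i := - g i))" for g
      by (auto simp: P_def max_def power2_eq_square field_simps)
    then show "avg m (\<lambda>g. ((f g - f (g(i := - g i))) / 2)\<^sup>2) = 2 * avg m (P i)"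
      using \<open>i \<in> {..<m}\<close> avg_flip[of i m "P i"] by (simp add: avg_add)
  qed simp
  also have "\<dots> = 2 * avg m (\<lambda>g. \<Sum>i<m. P i g)"
    by (simp add: avg_sum sum_distrib_left)
  also have "avg m (\<lambda>g. \<Sum>i<m. P i g) \<le> avg m (\<lambda>_. R)"
  proof (rule avg_mono_signs)
    fix g assume g: "signs m g"
    have "f g \<in> (\<lambda>j. ip m g (w j)) ` J"
      unfolding f_def using J by (intro Max_in) auto
    then obtain j where j: "j \<in> J" "f g = ip m g (w j)" by auto
    have "P i g \<le> (w j i)\<^sup>2" if "i < m" for i
    proof -
      have "ip m (g(i := - g i)) (w j) \<le> f (g(i := - g i))"
        unfolding f_def using J j by (intro Max_ge) auto
      then have "(f g - f (g(i := - g i))) / 2 \<le> g i * w j i"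
        using that j by (simp add: ip_flip)
      also have "\<dots> \<le> \<bar>w j i\<bar>"
        using g that by (auto simp: signs_def)
      finally have "max 0 ((f g - f (g(i := - g i))) / 2) \<le> \<bar>w j i\<bar>" by simp
      then show ?thesis
        unfolding P_def using power_mono[of "max 0 ((f g - f (g(i := - g i))) / 2)" "\<bar>w j i\<bar>" 2]
        by simp
    qed
    then have "(\<Sum>i<m. P i g) \<le> (\<Sum>i<m. (w j i)\<^sup>2)"
      by (intro sum_mono) auto
    then show "(\<Sum>i<m. P i g) \<le> R" using R[OF j(1)] by simp
  qed
  finally show ?thesis by simp
qed

lemma cosh_le_exp_square:
  fixes x :: real
  shows "(exp x + exp (- x)) / 2 \<le> exp (x\<^sup>2 / 2)"
proof -
  have pos: "(exp y + exp (- y)) / 2 \<le> exp (y\<^sup>2 / 2)" if "y > 0" for y :: real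
  proof -
    \<comment> \<open>Hoeffding's lemma for a fair coin with gap \<open>2 * y\<close>; its linear
      term becomes the factor \<open>exp y\<close> that cancels below.\<close>
    have "- (2 * y) * (1 / 2) + ln (1 + (1 / 2) * (exp (2 * y) - 1)) \<le> (2 * y)\<^sup>2 / 8"
      using that by (intro Hoeffdings_lemma_aux) auto
    then have "ln ((1 + exp (2 * y)) / 2) \<le> y + y\<^sup>2 / 2"
      by (simp add: field_simps)
    then have "exp (ln ((1 + exp (2 * y)) / 2)) \<le> exp (y + y\<^sup>2 / 2)"
      by simp
    then have "(1 + exp (2 * y)) / 2 \<le> exp y * exp (y\<^sup>2 / 2)"
      by (simp add: exp_add add_pos_pos)
    moreover have "(1 + exp (2 * y)) / 2 = exp y * ((exp y + exp (- y)) / 2)"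
      by (simp add: exp_add[symmetric] field_simps)
    ultimately show ?thesis by simp
  qed
  consider "x > 0" | "x = 0" | "- x > 0" by linarith
  then show ?thesis
    using pos[of x] pos[of "- x"] by cases (auto simp: add.commute)
qed

text \<open>Independence of the signs factorises the exponential moment into one hyperbolic cosine
  per coordinate.\<close>

lemma avg_exp_ip: "avg m (\<lambda>g. exp (t * ip m g w)) \<le> exp (t\<^sup>2 * (\<Sum>i<m. (w i)\<^sup>2) / 2)"
proof (induction m)
  case (Suc m)
  have "avg (Suc m) (\<lambda>g. exp (t * ip (Suc m) g w))
      = avg m (\<lambda>g. ((exp (t * w m) + exp (- (t * w m))) / 2) * exp (t * ip m g w))"
    unfolding avg.simps avg_add[symmetric] avg_divide[symmetric]
    by (intro arg_cong[where f = "avg m"] ext)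
      (simp add: ip_Suc ring_distribs exp_add exp_diff exp_minus field_simps)
  also have "\<dots> = ((exp (t * w m) + exp (- (t * w m))) / 2) * avg m (\<lambda>g. exp (t * ip m g w))"
    by (rule avg_cmult)
  also have "\<dots> \<le> exp ((t * w m)\<^sup>2 / 2) * exp (t\<^sup>2 * (\<Sum>i<m. (w i)\<^sup>2) / 2)"
    using avg_mono[of "\<lambda>_. 0" "\<lambda>g. exp (t * ip m g w)" m]
    by (intro mult_mono Suc.IH cosh_le_exp_square) auto
  also have "\<dots> = exp (t\<^sup>2 * (\<Sum>i<Suc m. (w i)\<^sup>2) / 2)"
    by (simp add: exp_add[symmetric] power_mult_distrib field_simps)
  finally show ?case .
qed (auto simp: ip_def)

text \<open>Jensen's inequality for \<open>exp\<close>, a maximum of exponentials bounded by their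
  sum, and the subgaussian bound for each summand. The parameter \<open>t\<close> is left for the
  caller to balance.\<close>

lemma avg_Max_le:
  fixes w :: "'a \<Rightarrow> nat \<Rightarrow> real"
  assumes J: "finite J" "J \<noteq> {}" and R: "\<And>j. j \<in> J \<Longrightarrow> (\<Sum>i<m. (w j i)\<^sup>2) \<le> R" and t: "t > 0"
  shows "avg m (\<lambda>g. Max ((\<lambda>j. ip m g (w j)) ` J)) \<le> ln (card J) / t + t * R / 2"
proof -
  define f where "f g = Max ((\<lambda>j. ip m g (w j)) ` J)" for g
  define \<mu> where "\<mu> = avg m f"
  \<comment> \<open>Jensen by the tangent of \<open>exp\<close> at \<open>t * \<mu>\<close>, whose
    linear term averages to 0.\<close>
  have "exp (t * \<mu>) = avg m (\<lambda>g. exp (t * \<mu>) + exp (t * \<mu>) * (t * (f g - \<mu>)))"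
    by (simp add: avg_add avg_cmult avg_diff \<mu>_def)
  also have "\<dots> \<le> avg m (\<lambda>g. exp (t * f g))"
  proof (rule avg_mono)
    fix g
    have "exp (t * \<mu>) * (1 + t * (f g - \<mu>)) \<le> exp (t * \<mu>) * exp (t * (f g - \<mu>))"
      by (intro mult_left_mono exp_ge_add_one_self) auto
    then show "exp (t * \<mu>) + exp (t * \<mu>) * (t * (f g - \<mu>)) \<le> exp (t * f g)"
      by (simp add: exp_add[symmetric] algebra_simps)
  qed
  also have "\<dots> \<le> avg m (\<lambda>g. \<Sum>j\<in>J. exp (t * ip m g (w j)))"
  proof (rule avg_mono)
    fix g
    have "f g \<in> (\<lambda>j. ip m g (w j)) ` J"
      unfolding f_def using J by (intro Max_in) auto
    then obtain j where "j \<in> J" "f g = ip m g (w j)" by auto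
    then show "exp (t * f g) \<le> (\<Sum>j\<in>J. exp (t * ip m g (w j)))"
      using J member_le_sum[of j J "\<lambda>j. exp (t * ip m g (w j))"] by auto
  qed
  also have "\<dots> = (\<Sum>j\<in>J. avg m (\<lambda>g. exp (t * ip m g (w j))))"
    by (rule avg_sum)
  also have "\<dots> \<le> (\<Sum>j\<in>J. exp (t\<^sup>2 * R / 2))"
  proof (rule sum_mono)
    fix j assume "j \<in> J"
    have "avg m (\<lambda>g. exp (t * ip m g (w j))) \<le> exp (t\<^sup>2 * (\<Sum>i<m. (w j i)\<^sup>2) / 2)"
      by (rule avg_exp_ip)
    also have "\<dots> \<le> exp (t\<^sup>2 * R / 2)"
      using R[OF \<open>j \<in> J\<close>] by (simp add: mult_left_mono)
    finally show "avg m (\<lambda>g. exp (t * ip m g (w j))) \<le> exp (t\<^sup>2 * R / 2)" .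
  qed
  also have "\<dots> = exp (ln (card J) + t\<^sup>2 * R / 2)"
    using J by (simp add: exp_add card_gt_0_iff)
  finally have "t * \<mu> \<le> ln (card J) + t\<^sup>2 * R / 2" by simp
  then have "\<mu> \<le> (ln (card J) + t\<^sup>2 * R / 2) / t"
    using t by (simp add: field_simps)
  also have "\<dots> = ln (card J) / t + t * R / 2"
    using t by (simp add: field_simps power2_eq_square)
  finally show ?thesis unfolding \<mu>_def f_def .
qed

lemma avg_ip_square: "avg m (\<lambda>g. (ip m g w)\<^sup>2) = (\<Sum>i<m. (w i)\<^sup>2)"
proof (induction m)
  case (Suc m)
  have "avg (Suc m) (\<lambda>g. (ip (Suc m) g w)\<^sup>2) = avg m (\<lambda>g. (ip m g w)\<^sup>2 + (w m)\<^sup>2)"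
    by (simp add: ip_Suc avg_add[symmetric] avg_divide[symmetric])
      (rule arg_cong[where f = "avg m"], rule ext, simp add: power2_eq_square field_simps)
  then show ?case by (simp add: avg_add Suc)
qed (simp add: ip_def)

lemma avg_ip_fourth: "avg m (\<lambda>g. (ip m g w) ^ 4) \<le> 3 * (\<Sum>i<m. (w i)\<^sup>2)\<^sup>2"
proof (induction m)
  case (Suc m)
  have "avg (Suc m) (\<lambda>g. (ip (Suc m) g w) ^ 4)
      = avg m (\<lambda>g. (ip m g w) ^ 4 + (6 * (w m)\<^sup>2) * (ip m g w)\<^sup>2 + (w m) ^ 4)"
    by (simp add: ip_Suc avg_add[symmetric] avg_divide[symmetric])
      (rule arg_cong[where f = "avg m"], rule ext, simp add: power4_eq_xxxx power2_eq_square field_simps)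
  also have "\<dots> = avg m (\<lambda>g. (ip m g w) ^ 4) + 6 * (w m)\<^sup>2 * (\<Sum>i<m. (w i)\<^sup>2) + (w m) ^ 4"
    by (simp only: avg_add avg_cmult avg_ip_square avg_const)
  also have "\<dots> \<le> 3 * (\<Sum>i<m. (w i)\<^sup>2)\<^sup>2 + 6 * (w m)\<^sup>2 * (\<Sum>i<m. (w i)\<^sup>2) + 3 * (w m) ^ 4"
    using Suc zero_le_even_power[of 4 "w m"] by (simp del: zero_le_power_eq_numeral)
  also have "\<dots> = 3 * (\<Sum>i<Suc m. (w i)\<^sup>2)\<^sup>2"
    by (simp add: power2_eq_square power4_eq_xxxx field_simps)
  finally show ?case .
qed (simp add: ip_def)

text \<open>A pointwise bound, linear in the fourth power and in the indicator, replaces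
  Cauchy-Schwarz. On average \<open>q / 4\<close> and \<open>3 / 8 * q\<close> are used up, and
  \<open>3 / 8 * q\<close> is left for \<open>2 * q\<close> times the probability.\<close>

lemma avg_paley_zygmund:
  assumes q: "q = (\<Sum>i<m. (w i)\<^sup>2)" "q > 0"
  shows "3 / 16 \<le> avg m (\<lambda>g. of_bool (q / 4 \<le> (ip m g w)\<^sup>2))"
proof -
  define P where "P = avg m (\<lambda>g. of_bool (q / 4 \<le> (ip m g w)\<^sup>2))"
  have "q = avg m (\<lambda>g. (ip m g w)\<^sup>2)"
    by (simp add: q(1) avg_ip_square)
  also have "\<dots> \<le> avg m (\<lambda>g. q / 4 + (1 / (8 * q)) * (ip m g w) ^ 4 +
      (2 * q) * of_bool (q / 4 \<le> (ip m g w)\<^sup>2))"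
  proof (rule avg_mono)
    fix g
    define Z where "Z = (ip m g w)\<^sup>2"
    \<comment> \<open>Arithmetic-geometric mean inequality, with equality at
      \<open>Z = 4 * q\<close>.\<close>
    have "Z \<le> Z\<^sup>2 / (8 * q) + 2 * q"
      using q(2) zero_le_power2[of "Z - 4 * q"] by (simp add: field_simps power2_eq_square)
    moreover have "0 \<le> Z\<^sup>2 / (8 * q)" using q(2) by simp
    ultimately have "Z \<le> q / 4 + (1 / (8 * q)) * Z\<^sup>2 + (2 * q) * of_bool (q / 4 \<le> Z)"
      using q(2) by (cases "q / 4 \<le> Z") (simp_all add: add_increasing2 add_increasing not_le less_imp_le)
    then show "(ip m g w)\<^sup>2 \<le> q / 4 + (1 / (8 * q)) * (ip m g w) ^ 4 +
      (2 * q) * of_bool (q / 4 \<le> (ip m g w)\<^sup>2)"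
      by (simp add: Z_def power_mult[symmetric])
  qed
  also have "\<dots> = q / 4 + (1 / (8 * q)) * avg m (\<lambda>g. (ip m g w) ^ 4) + 2 * q * P"
    unfolding P_def by (simp only: avg_add avg_cmult avg_const)
  also have "\<dots> \<le> q / 4 + (1 / (8 * q)) * (3 * q\<^sup>2) + 2 * q * P"
    using avg_ip_fourth[of m w] q by (intro add_mono mult_left_mono) auto
  finally have "q * (3 / 8) \<le> q * (2 * P)"
    using q(2) by (simp add: field_simps power2_eq_square)
  then show ?thesis
    using q(2) unfolding P_def by simp
qed

section \<open>Matchings of stretched pairs\<close>

lemma sqdist_eq: "sqdist m x u v = (\<Sum>i<m. (x u i - x v i)\<^sup>2)"
  unfolding sqdist_def L2_set_def by (simp add: sum_nonneg)

lemma sqdist_nonneg [simp]: "0 \<le> sqdist m x u v"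
  by (simp add: sqdist_def)

lemma sqdist_self [simp]: "sqdist m x u u = 0"
  by (simp add: sqdist_eq)

lemma sqdist_commute: "sqdist m x u v = sqdist m x v u"
  by (simp add: sqdist_eq power2_commute)

text \<open>First endpoints take the value of their partner plus \<open>s\<close>, all other
  vertices keep their own. The correction sum is the price: values at first endpoints are dropped
  and those at second endpoints are used once more.\<close>

lemma sum_along_matching:
  fixes A B :: "'a \<Rightarrow> real"
  assumes V: "finite V" and M: "M \<subseteq> V \<times> V" "inj_on fst M" "inj_on snd M"
    and le: "\<And>v. v \<in> V \<Longrightarrow> B v \<le> A v" and edge: "\<And>u v. (u, v) \<in> M \<Longrightarrow> s + B v \<le> A u"
  shows "sum B V + s * card M + (\<Sum>v\<in>V. (of_bool (v \<in> snd ` M) - of_bool (v \<in> fst ` M)) * B v) \<le> sum A V"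
proof -
  have sub: "fst ` M \<subseteq> V" "snd ` M \<subseteq> V" using M(1) by auto
  have *: "(\<Sum>v\<in>V. of_bool (v \<in> X) * B v) = sum B X" if "X \<subseteq> V" for X
  proof -
    have "(\<Sum>v\<in>V. of_bool (v \<in> X) * B v) = (\<Sum>v\<in>V. if v \<in> X then B v else 0)"
      by (intro sum.cong) auto
    also have "\<dots> = sum B (V \<inter> X)"
      by (rule sum.inter_restrict[OF V, symmetric])
    finally show ?thesis using that by (simp add: Int_absorb1)
  qed
  have "sum B V + s * card M + (\<Sum>v\<in>V. (of_bool (v \<in> snd ` M) - of_bool (v \<in> fst ` M)) * B v)
      = sum B (V - fst ` M) + (s * card M + sum B (snd ` M))"
    by (simp add: left_diff_distrib sum_subtractf * sub sum_diff[OF V])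
  also have "s * card M + sum B (snd ` M) = (\<Sum>e\<in>M. s + B (snd e))"
    by (simp add: sum.distrib sum.reindex[OF M(3)])
  also have "\<dots> \<le> (\<Sum>e\<in>M. A (fst e))"
    using edge by (intro sum_mono) auto
  also have "\<dots> = sum A (fst ` M)"
    by (simp add: sum.reindex[OF M(2)])
  also have "sum B (V - fst ` M) \<le> sum A (V - fst ` M)"
    using le by (intro sum_mono) auto
  also have "sum A (V - fst ` M) + sum A (fst ` M) = sum A V"
    using sum.subset_diff[OF sub(1) V, of A] by simp
  finally show ?thesis by simp
qed

text \<open>The chaining argument with all constants left open: the left side is what
  \<open>L\<close> levels gain, the right side bounds the mean of \<open>Y L v\<close> summed over
  \<open>V\<close>. Since distances and projections are taken at images under \<open>\<rho>\<close>,
  all maxima range over subsets of \<open>W\<close>.\<close>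

lemma avg_matching_bound:
  fixes x :: "nat \<Rightarrow> nat \<Rightarrow> real" and M :: "(nat \<Rightarrow> real) \<Rightarrow> ('v \<times> 'v) set" and L :: nat and D s \<tau> t :: real
  assumes V: "finite V" and W: "finite W" and \<rho>: "\<And>v. v \<in> V \<Longrightarrow> \<rho> v \<in> W"
    and tri: "\<And>a b c. a \<in> W \<Longrightarrow> b \<in> W \<Longrightarrow> c \<in> W \<Longrightarrow> sqdist m x a b \<le> sqdist m x a c + sqdist m x c b"
    and M: "\<And>g. M g \<subseteq> V \<times> V" "\<And>g. inj_on fst (M g)" "\<And>g. inj_on snd (M g)"
    and short: "\<And>g u v. (u, v) \<in> M g \<Longrightarrow> sqdist m x (\<rho> u) (\<rho> v) \<le> D"
    and stretch: "\<And>g u v. (u, v) \<in> M g \<Longrightarrow> s \<le> ip m g (x (\<rho> v)) - ip m g (x (\<rho> u))"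
    and D: "0 \<le> D" and \<tau>: "0 < \<tau>" "2 * real L * D \<le> \<tau>\<^sup>2" and t: "0 < t"
  shows "L * (s * avg m (\<lambda>g. card (M g)) - \<tau> * card V) \<le> card V * (ln (card W) / t + t * (L * D) / 2)"
proof -
  define J where "J l v = {w \<in> W. sqdist m x (\<rho> v) w \<le> real l * D}" for l v
  define Y where "Y l v g = Max ((\<lambda>w. ip m g (\<lambda>i. x w i - x (\<rho> v) i)) ` J l v)" for l v g
  have fJ: "finite (J l v)" for l v using W by (simp add: J_def)
  have nJ: "\<rho> v \<in> J l v" if "v \<in> V" for l v
    using \<rho>[OF that] D by (simp add: J_def)
  have Yge: "ip m g (x w) - ip m g (x (\<rho> v)) \<le> Y l v g" if "w \<in> J l v" for w l v g
    unfolding Y_def using that fJ by (subst ip_diff[symmetric]) (intro Max_ge, auto)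
  have Yex: "\<exists>w \<in> J l v. Y l v g = ip m g (x w) - ip m g (x (\<rho> v))" if "v \<in> V" for l v g
  proof -
    have "Y l v g \<in> (\<lambda>w. ip m g (\<lambda>i. x w i - x (\<rho> v) i)) ` J l v"
      unfolding Y_def using fJ nJ[OF that] by (intro Max_in) auto
    then show ?thesis by (auto simp: ip_diff)
  qed
  have Y0: "0 \<le> Y 0 v g" if "v \<in> V" for v g
    using Yge[OF nJ[OF that]] by simp
  have Ymono: "Y l v g \<le> Y (Suc l) v g" if v: "v \<in> V" for l v g
  proof -
    obtain w where w: "w \<in> J l v" "Y l v g = ip m g (x w) - ip m g (x (\<rho> v))"
      using Yex[OF v] by blast
    have "w \<in> J (Suc l) v" using w(1) D by (auto simp: J_def algebra_simps)
    with Yge[OF this] w(2) show ?thesis by simp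
  qed
  \<comment> \<open>A representative within \<open>l * D\<close> of \<open>\<rho> v\<close> is
    within one more \<open>D\<close> of \<open>\<rho> u\<close>, and seen from
    \<open>\<rho> u\<close> its projection is larger by the stretch of the pair.\<close>
  have Ystep: "s + Y l v g \<le> Y (Suc l) u g"
    if uv: "u \<in> V" "v \<in> V" "sqdist m x (\<rho> u) (\<rho> v) \<le> D" "s \<le> ip m g (x (\<rho> v)) - ip m g (x (\<rho> u))" for l u v g
  proof -
    obtain w where w: "w \<in> J l v" "Y l v g = ip m g (x w) - ip m g (x (\<rho> v))"
      using Yex[OF uv(2)] by blast
    have "w \<in> J (Suc l) u"
      using w(1) tri[of "\<rho> u" w "\<rho> v"] \<rho> uv by (auto simp: J_def algebra_simps)
    from Yge[OF this, of g] w(2) uv(4) show ?thesis by simp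
  qed
  \<comment> \<open>The weights of the correction sum. Their difference \<open>c\<close> changes
    sign with \<open>g\<close>, hence averages to 0.\<close>
  define h where "h g v = (of_bool (v \<in> snd ` M g) - of_bool (v \<in> fst ` M g) :: real)" for g v
  define c where "c g v = h g v - h (\<lambda>i. - g i) v" for g v
  define \<Phi> where "\<Phi> l = (\<Sum>v\<in>V. avg m (Y l v))" for l
  define e where "e = avg m (\<lambda>g. card (M g))"
  have step: "\<Phi> l + (s * e - \<tau> * card V) \<le> \<Phi> (Suc l)" if "l < L" for l
  proof -
    have fwd: "(\<Sum>v\<in>V. Y l v g) + s * card (M g) + (\<Sum>v\<in>V. h g v * Y l v g) \<le> (\<Sum>v\<in>V. Y (Suc l) v g)" for g
      unfolding h_def using M short stretch
      by (intro sum_along_matching[OF V]) (auto intro!: Ymono Ystep dest: subsetD[OF M(1)])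
    \<comment> \<open>A pair stretched along \<open>- g\<close> is stretched along \<open>g\<close>
      when reversed, so the matching of \<open>- g\<close> gives a second inequality with the roles
      of the endpoints exchanged.\<close>
    have bwd: "(\<Sum>v\<in>V. Y l v g) + s * card (M (\<lambda>i. - g i)) - (\<Sum>v\<in>V. h (\<lambda>i. - g i) v * Y l v g)
        \<le> (\<Sum>v\<in>V. Y (Suc l) v g)" for g
    proof -
      define N where "N = M (\<lambda>i. - g i)"
      have N: "N \<subseteq> V \<times> V" "inj_on fst N" "inj_on snd N" unfolding N_def by (rule M)+
      have "inj_on fst (prod.swap ` N)" "inj_on snd (prod.swap ` N)"
        using N(2,3) by (auto simp: inj_on_def)
      moreover have "prod.swap ` N \<subseteq> V \<times> V" using N(1) by auto
      moreover have "s + Y l v g \<le> Y (Suc l) u g" if "(u, v) \<in> prod.swap ` N" for u v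
      proof (rule Ystep)
        have vu: "(v, u) \<in> N" using that by auto
        show "u \<in> V" "v \<in> V" using N(1) vu by auto
        show "sqdist m x (\<rho> u) (\<rho> v) \<le> D"
          using short vu unfolding N_def by (metis sqdist_commute)
        show "s \<le> ip m g (x (\<rho> v)) - ip m g (x (\<rho> u))"
          using stretch vu unfolding N_def by fastforce
      qed
      ultimately have "(\<Sum>v\<in>V. Y l v g) + s * card (prod.swap ` N) +
          (\<Sum>v\<in>V. (of_bool (v \<in> snd ` prod.swap ` N) - of_bool (v \<in> fst ` prod.swap ` N)) * Y l v g)
          \<le> (\<Sum>v\<in>V. Y (Suc l) v g)"
        by (intro sum_along_matching[OF V]) (auto intro: Ymono)
      moreover have "card (prod.swap ` N) = card N"
        by (intro card_image) (auto simp: inj_on_def)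
      moreover have "snd ` prod.swap ` N = fst ` N" "fst ` prod.swap ` N = snd ` N"
        by (auto simp: image_image)
      ultimately show ?thesis
        unfolding N_def[symmetric] h_def
        by (simp add: sum_subtractf left_diff_distrib)
    qed
    \<comment> \<open>As \<open>c\<close> averages to 0, \<open>Y l v\<close> may be replaced by its
      deviation from the mean: a weight of size at most 2 against a variable of variance at most
      \<open>\<tau>\<^sup>2\<close>. In the arithmetic-geometric mean below, the constant and the
      quadratic term cost \<open>\<tau>\<close> each.\<close>
    have corr: "- 2 * \<tau> \<le> avg m (\<lambda>g. c g v * Y l v g)" if v: "v \<in> V" for v
    proof -
      define \<mu> where "\<mu> = avg m (Y l v)"
      have var: "avg m (\<lambda>g. (Y l v g - \<mu>)\<^sup>2) \<le> 2 * (real l * D)"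
        unfolding \<mu>_def Y_def
      proof (rule avg_var_Max[OF fJ])
        show "J l v \<noteq> {}" using nJ[OF v] by auto
        show "(\<Sum>i<m. (x j i - x (\<rho> v) i)\<^sup>2) \<le> real l * D" if "j \<in> J l v" for j
          using that unfolding J_def by (simp add: sqdist_eq[symmetric] sqdist_commute)
      qed
      have "avg m (\<lambda>g. c g v) = 0"
        unfolding c_def avg_diff avg_neg[of m "\<lambda>g. h g v"] by simp
      then have "avg m (\<lambda>g. c g v * Y l v g) = avg m (\<lambda>g. c g v * Y l v g - \<mu> * c g v)"
        by (simp only: avg_diff avg_cmult)
      also have "\<dots> \<ge> avg m (\<lambda>g. - \<tau> - (1 / \<tau>) * (Y l v g - \<mu>)\<^sup>2)"
      proof (rule avg_mono)
        fix g
        define z where "z = Y l v g - \<mu>"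
        have "\<bar>c g v\<bar> \<le> 2" by (simp add: c_def h_def)
        then have "\<bar>c g v * z\<bar> \<le> 2 * \<bar>z\<bar>"
          unfolding abs_mult by (rule mult_right_mono) simp
        also have "2 * \<bar>z\<bar> \<le> \<tau> + (1 / \<tau>) * z\<^sup>2"
        proof -
          have "0 \<le> (\<bar>z\<bar> - \<tau>)\<^sup>2" by simp
          then have "2 * \<bar>z\<bar> * \<tau> \<le> \<tau> * \<tau> + z\<^sup>2"
            by (simp add: power2_eq_square algebra_simps)
          then show ?thesis using \<tau>(1) by (simp add: field_simps)
        qed
        finally show "- \<tau> - (1 / \<tau>) * (Y l v g - \<mu>)\<^sup>2 \<le> c g v * Y l v g - \<mu> * c g v"
          unfolding z_def[symmetric] by (simp add: z_def algebra_simps)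
      qed
      also have "avg m (\<lambda>g. - \<tau> - (1 / \<tau>) * (Y l v g - \<mu>)\<^sup>2)
          = - \<tau> - (1 / \<tau>) * avg m (\<lambda>g. (Y l v g - \<mu>)\<^sup>2)"
        by (simp only: avg_diff avg_cmult avg_const)
      also have "\<dots> \<ge> - \<tau> - (1 / \<tau>) * \<tau>\<^sup>2"
      proof -
        have "2 * (real l * D) \<le> 2 * (real L * D)"
          using that D by (intro mult_left_mono mult_right_mono) (use \<open>l < L\<close> in auto)
        with var \<tau> show ?thesis by (intro diff_left_mono mult_left_mono) auto
      qed
      finally show ?thesis using \<tau>(1) by (simp add: power2_eq_square)
    qed
    have "avg m (\<lambda>g. 2 * (\<Sum>v\<in>V. Y l v g) + s * (card (M g) + card (M (\<lambda>i. - g i))) + (\<Sum>v\<in>V. c g v * Y l v g))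
        \<le> avg m (\<lambda>g. 2 * (\<Sum>v\<in>V. Y (Suc l) v g))"
    proof (rule avg_mono)
      fix g
      have "(\<Sum>v\<in>V. c g v * Y l v g) = (\<Sum>v\<in>V. h g v * Y l v g) - (\<Sum>v\<in>V. h (\<lambda>i. - g i) v * Y l v g)"
        by (simp add: c_def left_diff_distrib sum_subtractf)
      then show "2 * (\<Sum>v\<in>V. Y l v g) + s * (card (M g) + card (M (\<lambda>i. - g i))) + (\<Sum>v\<in>V. c g v * Y l v g)
          \<le> 2 * (\<Sum>v\<in>V. Y (Suc l) v g)"
        using fwd[of g] bwd[of g] by (simp add: algebra_simps)
    qed
    then have "2 * \<Phi> l + s * (2 * e) + (\<Sum>v\<in>V. avg m (\<lambda>g. c g v * Y l v g)) \<le> 2 * \<Phi> (Suc l)"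
      using avg_neg[of m "\<lambda>g. real (card (M g))"]
      by (simp add: avg_add avg_cmult avg_sum \<Phi>_def e_def)
    moreover have "(\<Sum>v\<in>V. - 2 * \<tau>) \<le> (\<Sum>v\<in>V. avg m (\<lambda>g. c g v * Y l v g))"
      by (intro sum_mono corr)
    ultimately show ?thesis by (simp add: algebra_simps)
  qed
  have "real l * (s * e - \<tau> * card V) \<le> \<Phi> l" if "l \<le> L" for l
    using that
  proof (induction l)
    case 0
    have "0 \<le> avg m (Y 0 v)" if "v \<in> V" for v
      using avg_mono[of "\<lambda>_. 0" "Y 0 v" m] Y0[OF that] by simp
    then show ?case by (simp add: \<Phi>_def sum_nonneg)
  next
    case (Suc l)
    then show ?case using step[of l] by (simp add: algebra_simps)
  qed
  from this[of L] have "real L * (s * e - \<tau> * card V) \<le> \<Phi> L" by simp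
  also have "\<Phi> L \<le> (\<Sum>v\<in>V. ln (card W) / t + t * (L * D) / 2)"
    unfolding \<Phi>_def
  proof (rule sum_mono)
    fix v assume v: "v \<in> V"
    have "avg m (Y L v) \<le> ln (card (J L v)) / t + t * (L * D) / 2"
      unfolding Y_def
    proof (rule avg_Max_le[OF fJ _ _ t])
      show "J L v \<noteq> {}" using nJ[OF v] by auto
      show "(\<Sum>i<m. (x j i - x (\<rho> v) i)\<^sup>2) \<le> real L * D" if "j \<in> J L v" for j
        using that unfolding J_def by (simp add: sqdist_eq[symmetric] sqdist_commute)
    qed
    also have "ln (card (J L v)) \<le> ln (card W)"
    proof -
      have "card (J L v) \<le> card W" by (rule card_mono[OF W]) (auto simp: J_def)
      moreover have "0 < card (J L v)" using nJ[OF v] fJ by (auto simp: card_gt_0_iff)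
      ultimately show ?thesis by simp
    qed
    finally show "avg m (Y L v) \<le> ln (card W) / t + t * (L * D) / 2"
      using t by (simp add: divide_right_mono)
  qed
  also have "\<dots> = card V * (ln (card W) / t + t * (L * D) / 2)" by simp
  finally show ?thesis unfolding e_def .
qed

section \<open>Good sign vectors and the separated sets they yield\<close>

definition matching :: "('a \<times> 'a) set \<Rightarrow> bool" where
  "matching M \<longleftrightarrow> inj_on fst M \<and> inj_on snd M \<and> fst ` M \<inter> snd ` M = {}"

abbreviation ends :: "('a \<times> 'a) set \<Rightarrow> 'a set" where
  "ends M \<equiv> fst ` M \<union> snd ` M"

abbreviation maximal_matching :: "('a \<times> 'a) set \<Rightarrow> ('a \<times> 'a) set \<Rightarrow> bool" where
  "maximal_matching St M \<equiv> M \<subseteq> St \<and> matching M \<and> (\<forall>(u, v) \<in> St. u \<in> ends M \<or> v \<in> ends M)"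

text \<open>Pairs are directed towards the larger projection. The stretch \<open>1 / 4\<close> is
  half the distance of a pair with squared distance \<open>1 / 4\<close>, which is what
  \<open>avg_paley_zygmund\<close> provides.\<close>

definition stretched :: "nat \<Rightarrow> nat \<Rightarrow> (nat \<Rightarrow> nat \<Rightarrow> real) \<Rightarrow> real \<Rightarrow> (nat \<Rightarrow> real) \<Rightarrow> (nat \<times> nat) set" where
  "stretched n m x \<Delta> g =
     {(u, v). u < n \<and> v < n \<and> 1 / 4 \<le> ip m g (x v) - ip m g (x u) \<and> sqdist m x u v \<le> \<Delta>}"

text \<open>All matchings are required to be small, since the algorithm uses whichever maximal
  matching its greedy scan happens to find.\<close>

definition good :: "nat \<Rightarrow> nat \<Rightarrow> (nat \<Rightarrow> nat \<Rightarrow> real) \<Rightarrow> real \<Rightarrow> (nat \<Rightarrow> real) \<Rightarrow> bool" where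
  "good n m x \<Delta> g \<longleftrightarrow>
     3 / 64 * (real n)\<^sup>2 \<le> (\<Sum>u<n. \<Sum>v<n. of_bool (1 / 4 \<le> \<bar>ip m g (x v) - ip m g (x u)\<bar>)) \<and>
     (\<forall>M \<subseteq> stretched n m x \<Delta> g. matching M \<longrightarrow> real (card M) \<le> real n / 256)"

abbreviation below :: "nat \<Rightarrow> nat \<Rightarrow> (nat \<Rightarrow> nat \<Rightarrow> real) \<Rightarrow> (nat \<Rightarrow> real) \<Rightarrow> nat set \<Rightarrow> nat \<Rightarrow> nat set" where
  "below n m x g Z w \<equiv> {v. v < n \<and> v \<notin> Z \<and> ip m g (x v) \<le> ip m g (x w)}"

lemma finite_stretched [simp]: "finite (stretched n m x \<Delta> g)"
  by (rule finite_subset[of _ "{..<n} \<times> {..<n}"]) (auto simp: stretched_def)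

lemma sqdist_le_diam:
  assumes "finite T" "u \<in> T" "v \<in> T"
  shows "sqdist m x u v \<le> diam (sqdist m x) T"
proof -
  have "{sqdist m x u v | u v. u \<in> T \<and> v \<in> T} = (\<lambda>(u, v). sqdist m x u v) ` (T \<times> T)"
    by auto
  then have "finite {sqdist m x u v | u v. u \<in> T \<and> v \<in> T}"
    using assms(1) by simp
  then show ?thesis
    using assms unfolding diam_def by (auto intro!: Max_ge)
qed

text \<open>Chebyshev's inequality, from the second moment \<open>avg_ip_square\<close>.\<close>

lemma avg_ip_tail:
  assumes "0 < a"
  shows "avg m (\<lambda>g. of_bool (a < \<bar>ip m g (x v) - ip m g (x u)\<bar>)) \<le> sqdist m x u v / a\<^sup>2"
proof -
  have "avg m (\<lambda>g. of_bool (a < \<bar>ip m g (x v) - ip m g (x u)\<bar>))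
      \<le> avg m (\<lambda>g. (1 / a\<^sup>2) * (ip m g (\<lambda>i. x v i - x u i))\<^sup>2)"
  proof (rule avg_mono)
    fix g
    have "a\<^sup>2 \<le> \<bar>z\<bar>\<^sup>2" if "a < \<bar>z\<bar>" for z
      using assms that by (intro power_mono) auto
    then show "of_bool (a < \<bar>ip m g (x v) - ip m g (x u)\<bar>)
        \<le> (1 / a\<^sup>2) * (ip m g (\<lambda>i. x v i - x u i))\<^sup>2"
      using assms by (simp add: ip_diff field_simps)
  qed
  also have "\<dots> = sqdist m x u v / a\<^sup>2"
    unfolding avg_cmult avg_ip_square by (simp add: sqdist_eq power2_commute)
  finally show ?thesis .
qed

lemma sqrt_ln_ge_half:
  assumes "2 \<le> (k::nat)"
  shows "1 / 2 \<le> sqrt (ln k)"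
proof -
  have "(1 / 2 :: real) \<le> ln 2"
    using exp_half_le2 by (subst ln_ge_iff) auto
  also have "\<dots> \<le> ln k" using assms by simp
  finally have "(1 / 2)\<^sup>2 \<le> ln k" by (simp add: power2_eq_square)
  then show ?thesis by (rule real_le_rsqrt)
qed

text \<open>Pairs are discarded if an endpoint is uncovered or moves by more than
  \<open>1 / 16\<close> in projection under \<open>\<rho>\<close>; each such vertex is counted at
  most once as a first and once as a second endpoint. The other pairs keep stretch
  \<open>1 / 4 - 2 / 16 = 1 / 8\<close>, and \<open>avg_matching_bound\<close> applies to
  them.\<close>

lemma avg_stretched_matching_le:
  fixes M :: "(nat \<Rightarrow> real) \<Rightarrow> (nat \<times> nat) set" and k :: nat
  assumes n: "0 < n" and k: "2 \<le> k"
    and tri: "\<And>u v w. u < n \<Longrightarrow> v < n \<Longrightarrow> w < n \<Longrightarrow> sqdist m x u v \<le> sqdist m x u w + sqdist m x w v"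
    and T: "\<And>i. i \<in> {1..2 * k} \<Longrightarrow> T i \<subseteq> {..<n} \<and> diam (sqdist m x) (T i) \<le> (1 / 2 ^ 43) / sqrt (ln k)"
    and cover: "(1 - (1 / 2 ^ 17)) * real n \<le> card (\<Union>i \<in> {1..2 * k}. T i)"
    and M: "\<And>g. M g \<subseteq> stretched n m x ((1 / 2 ^ 42) / sqrt (ln k)) g" "\<And>g. matching (M g)"
  shows "avg m (\<lambda>g. card (M g)) \<le> real n / 2 ^ 14"
proof -
  define q where "q = sqrt (ln k)"
  have q: "1 / 2 \<le> q" unfolding q_def by (rule sqrt_ln_ge_half[OF k])
  have lnk: "ln k = q\<^sup>2" unfolding q_def using k by simp
  define V where "V = (\<Union>i \<in> {1..2 * k}. T i)"
  \<comment> \<open>The sets \<open>T i\<close> may be empty or overlap: representatives exist for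
    the nonempty ones, and a vertex is assigned to any one set that contains it.\<close>
  define I where "I = {i \<in> {1..2 * k}. T i \<noteq> {}}"
  define rep where "rep i = (SOME v. v \<in> T i)" for i
  define \<rho> where "\<rho> v = rep (SOME i. i \<in> I \<and> v \<in> T i)" for v
  define W where "W = rep ` I"
  have rep: "rep i \<in> T i" if "i \<in> I" for i
    using that unfolding rep_def I_def by (simp add: some_in_eq)
  have Tn: "T i \<subseteq> {..<n}" if "i \<in> I" for i using T that by (auto simp: I_def)
  have Wn: "W \<subseteq> {..<n}" using rep Tn by (auto simp: W_def)
  have Vn: "V \<subseteq> {..<n}" using T unfolding V_def by blast
  have fV: "finite V" and fW: "finite W" using Vn Wn finite_subset by auto
  have cl: "\<rho> v \<in> W \<and> sqdist m x (\<rho> v) v \<le> (1 / 2 ^ 43) / q" if "v \<in> V" for v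
  proof -
    define i where "i = (SOME i. i \<in> I \<and> v \<in> T i)"
    have "\<exists>i. i \<in> I \<and> v \<in> T i" using that by (auto simp: V_def I_def)
    from someI_ex[OF this] have i: "i \<in> I" "v \<in> T i" unfolding i_def by auto
    have "sqdist m x (rep i) v \<le> diam (sqdist m x) (T i)"
      using Tn[OF i(1)] rep[OF i(1)] i(2) by (intro sqdist_le_diam) (auto dest: finite_subset)
    also have "\<dots> \<le> (1 / 2 ^ 43) / q" using T i(1) by (auto simp: I_def q_def)
    finally show ?thesis using i(1) unfolding \<rho>_def i_def[symmetric] W_def by auto
  qed
  define bad where "bad g = {v \<in> V. 1 / 16 < \<bar>ip m g (x v) - ip m g (x (\<rho> v))\<bar>}" for g
  define N where "N g = {(u, v) \<in> M g. u \<in> V - bad g \<and> v \<in> V - bad g}" for g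
  \<comment> \<open>Two cluster diameters and one short pair:
    \<open>2 / 2 ^ 43 + 1 / 2 ^ 42 = 1 / 2 ^ 41\<close>.\<close>
  define D where "D = (1 / 2 ^ 41) / q"
  \<comment> \<open>Of order \<open>1 / D\<close>. That rounding down keeps \<open>L\<close> above
    \<open>2 * q\<close> relies on \<open>q \<ge> 1 / 2\<close>.\<close>
  define L where "L = nat \<lfloor>4 * q\<rfloor>"
  have L: "2 * q \<le> L" "L \<le> 4 * q"
  proof -
    have "0 \<le> \<lfloor>4 * q\<rfloor>" using q by simp
    then have "real L = of_int \<lfloor>4 * q\<rfloor>" by (simp add: L_def)
    then show "2 * q \<le> L" "L \<le> 4 * q" using q by linarith+
  qed
  have LD: "L * D \<le> (1 / 2 ^ 39)"
  proof -
    have "L * D \<le> (4 * q) * D" using L(2) q by (intro mult_right_mono) (auto simp: D_def)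
    then show ?thesis using q by (simp add: D_def)
  qed
  have Mst: "u < n" "v < n" "1 / 4 \<le> ip m g (x v) - ip m g (x u)" "sqdist m x u v \<le> (1 / 2 ^ 42) / q"
    if "(u, v) \<in> M g" for u v g
    using M(1)[of g] that by (auto simp: stretched_def q_def)
  \<comment> \<open>Here \<open>s\<close> is \<open>1 / 8\<close>, and \<open>\<tau>\<close> is
    \<open>1 / 2 ^ 19\<close>, the square root of the bound for \<open>2 * L * D\<close>. The
    parameter \<open>t = 2 ^ 20 * q\<close> balances \<open>ln (card W)\<close>, of order
    \<open>q\<^sup>2\<close>, against the constant bound for \<open>L * D\<close>.\<close>
  have "L * (1 / 8 * avg m (\<lambda>g. card (N g)) - (1 / 2 ^ 19) * card V)
      \<le> card V * (ln (card W) / (2 ^ 20 * q) + (2 ^ 20 * q) * (L * D) / 2)"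
  proof (rule avg_matching_bound[OF fV fW])
    show "\<rho> v \<in> W" if "v \<in> V" for v using cl[OF that] by simp
    show "sqdist m x a b \<le> sqdist m x a c + sqdist m x c b" if "a \<in> W" "b \<in> W" "c \<in> W" for a b c
      using that Wn by (intro tri) auto
    show "N g \<subseteq> V \<times> V" for g by (auto simp: N_def)
    show "inj_on fst (N g)" "inj_on snd (N g)" for g
      using M(2)[of g] by (auto simp: matching_def N_def intro: inj_on_subset)
    show "sqdist m x (\<rho> u) (\<rho> v) \<le> D" if uv: "(u, v) \<in> N g" for u v g
    proof -
      have V: "u \<in> V" "v \<in> V" and M: "(u, v) \<in> M g" using uv by (auto simp: N_def)
      have lt: "\<rho> u < n" "\<rho> v < n" using cl V Wn by auto
      have "sqdist m x (\<rho> u) (\<rho> v) \<le> sqdist m x (\<rho> u) u + (sqdist m x u v + sqdist m x v (\<rho> v))"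
        using tri[of "\<rho> u" "\<rho> v" u] tri[of u "\<rho> v" v] lt Mst(1,2)[OF M] by simp
      also have "\<dots> \<le> (1 / 2 ^ 43) / q + ((1 / 2 ^ 42) / q + (1 / 2 ^ 43) / q)"
        using cl[OF V(1)] cl[OF V(2)] Mst(4)[OF M] by (intro add_mono) (auto simp: sqdist_commute)
      also have "\<dots> = D" by (simp add: D_def)
      finally show ?thesis .
    qed
    show "1 / 8 \<le> ip m g (x (\<rho> v)) - ip m g (x (\<rho> u))" if uv: "(u, v) \<in> N g" for u v g
    proof -
      have M: "(u, v) \<in> M g" using uv by (auto simp: N_def)
      have "\<bar>ip m g (x w) - ip m g (x (\<rho> w))\<bar> \<le> 1 / 16" if "w = u \<or> w = v" for w
        using uv that unfolding N_def bad_def by auto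
      from this[of u] this[of v] Mst(3)[OF M] show ?thesis by linarith
    qed
    show "2 * real L * D \<le> ((1 / 2 ^ 19))\<^sup>2" using LD by (simp add: power2_eq_square)
  qed (use q in \<open>auto simp: D_def\<close>)
  also have "\<dots> \<le> card V * (q * (1 / 2 ^ 19) + q * (1 / 2 ^ 20))"
  proof (intro mult_left_mono add_mono)
    have "ln (card W) \<le> ln (real (2 * k))"
    proof (cases "card W = 0")
      case False
      have "card W \<le> card I" unfolding W_def by (rule card_image_le) (auto simp: I_def)
      also have "\<dots> \<le> card {1..2 * k}" by (rule card_mono) (auto simp: I_def)
      finally show ?thesis using False by (subst ln_le_cancel_iff) auto
    qed (use k in auto)
    \<comment> \<open>As \<open>k \<ge> 2\<close>, squaring \<open>k\<close> absorbs the factor 2 in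
      the number of sets.\<close>
    also have "\<dots> \<le> ln (real k * real k)"
      using k by (subst ln_le_cancel_iff) auto
    also have "\<dots> = 2 * q\<^sup>2" using k by (simp add: ln_mult lnk)
    finally have "ln (card W) / (2 ^ 20 * q) \<le> 2 * q\<^sup>2 / (2 ^ 20 * q)"
      using q by (intro divide_right_mono) auto
    then show "ln (card W) / (2 ^ 20 * q) \<le> q * (1 / 2 ^ 19)"
      using q by (simp add: power2_eq_square)
    have "(2 ^ 20 * q) * (L * D) / 2 \<le> (2 ^ 20 * q) * ((1 / 2 ^ 39)) / 2"
      using LD q by (intro divide_right_mono mult_left_mono) auto
    then show "(2 ^ 20 * q) * (L * D) / 2 \<le> q * (1 / 2 ^ 20)" by simp
  qed simp
  finally have key: "L * (1 / 8 * avg m (\<lambda>g. card (N g)) - (1 / 2 ^ 19) * card V)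
      \<le> card V * (q * (3 * (1 / 2 ^ 20)))" by simp
  have cV: "card V \<le> n" using card_mono[OF _ Vn] by simp
  \<comment> \<open>Otherwise each of at least \<open>2 * q\<close> levels gains more than
    \<open>n / 2 ^ 19\<close>, in total \<open>4 * q * n / 2 ^ 20\<close>, whereas
    \<open>key\<close> allows only \<open>3 * q * n / 2 ^ 20\<close>.\<close>
  have EN: "avg m (\<lambda>g. card (N g)) \<le> real n / 2 ^ 15"
  proof (rule ccontr)
    assume "\<not> ?thesis"
    then have "1 / 8 * avg m (\<lambda>g. card (N g)) - (1 / 2 ^ 19) * card V > real n / 2 ^ 19"
      using cV by simp
    then have "(2 * q) * (real n / 2 ^ 19) \<le> L * (1 / 8 * avg m (\<lambda>g. card (N g)) - (1 / 2 ^ 19) * card V)"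
      using q L by (intro mult_mono) auto
    also note key
    also have "card V * (q * (3 * (1 / 2 ^ 20))) \<le> n * (q * (3 * (1 / 2 ^ 20)))"
      using cV q by (intro mult_right_mono) auto
    finally show False using n q by simp
  qed
  have card_M: "card (M g) \<le> card (N g) + 2 * ((n - card V) + card (bad g))" for g
  proof -
    define X where "X = ({..<n} - V) \<union> bad g"
    have fX: "finite X" using fV by (auto simp: X_def bad_def)
    have fM: "finite (M g)" using M(1) finite_stretched by (rule finite_subset)
    have "M g \<subseteq> N g \<union> {e \<in> M g. fst e \<in> X} \<union> {e \<in> M g. snd e \<in> X}"
      using Mst(1,2) by (auto simp: N_def X_def)
    then have "card (M g) \<le> card (N g \<union> {e \<in> M g. fst e \<in> X} \<union> {e \<in> M g. snd e \<in> X})"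
      using fM finite_subset[of "N g" "M g"] by (intro card_mono) (auto simp: N_def)
    also have "\<dots> \<le> card (N g) + card {e \<in> M g. fst e \<in> X} + card {e \<in> M g. snd e \<in> X}"
      by (meson add_mono card_Un_le le_trans order_refl)
    also have "card {e \<in> M g. fst e \<in> X} \<le> card X"
      using M(2)[of g] fX by (intro card_inj_on_le[of fst]) (auto simp: matching_def intro: inj_on_subset)
    also have "card {e \<in> M g. snd e \<in> X} \<le> card X"
      using M(2)[of g] fX by (intro card_inj_on_le[of snd]) (auto simp: matching_def intro: inj_on_subset)
    also have "card X \<le> (n - card V) + card (bad g)"
      unfolding X_def using card_Un_le[of "{..<n} - V" "bad g"] Vn fV by (simp add: card_Diff_subset)
    finally show ?thesis by simp
  qed
  have "avg m (\<lambda>g. card (bad g)) = (\<Sum>v\<in>V. avg m (\<lambda>g. of_bool (1 / 16 < \<bar>ip m g (x v) - ip m g (x (\<rho> v))\<bar>)))"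
  proof -
    have "real (card (bad g)) = (\<Sum>v\<in>V. of_bool (1 / 16 < \<bar>ip m g (x v) - ip m g (x (\<rho> v))\<bar>))" for g
      using fV by (simp add: bad_def of_bool_def sum.If_cases Int_def)
    then show ?thesis by (simp add: avg_sum)
  qed
  also have "\<dots> \<le> (\<Sum>v\<in>V. (1 / 2 ^ 34))"
  proof (rule sum_mono)
    fix v assume v: "v \<in> V"
    have "avg m (\<lambda>g. of_bool (1 / 16 < \<bar>ip m g (x v) - ip m g (x (\<rho> v))\<bar>)) \<le> sqdist m x (\<rho> v) v / (1 / 16)\<^sup>2"
      by (rule avg_ip_tail) simp
    also have "\<dots> = 256 * sqdist m x (\<rho> v) v" by (simp add: power2_eq_square)
    also have "\<dots> \<le> 256 * ((1 / 2 ^ 43) / q)" using cl[OF v] by simp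
    also have "\<dots> \<le> (1 / 2 ^ 34)" using q by (simp add: field_simps)
    finally show "avg m (\<lambda>g. of_bool (1 / 16 < \<bar>ip m g (x v) - ip m g (x (\<rho> v))\<bar>)) \<le> (1 / 2 ^ 34)" .
  qed
  also have "\<dots> \<le> real n * (1 / 2 ^ 34)" using cV by simp
  finally have Ebad: "avg m (\<lambda>g. card (bad g)) \<le> real n * (1 / 2 ^ 34)" .
  have unc: "real (n - card V) \<le> real n / 2 ^ 17"
    using cover cV unfolding V_def[symmetric] by (simp add: of_nat_diff algebra_simps)
  have "avg m (\<lambda>g. card (M g)) \<le> avg m (\<lambda>g. card (N g) + 2 * (n - card V) + 2 * real (card (bad g)))"
  proof (rule avg_mono)
    fix g
    show "real (card (M g)) \<le> card (N g) + 2 * (n - card V) + 2 * real (card (bad g))"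
      using of_nat_mono[OF card_M[of g], where 'a = real] by simp
  qed
  also have "\<dots> = avg m (\<lambda>g. card (N g)) + 2 * (n - card V) + 2 * avg m (\<lambda>g. card (bad g))"
    unfolding of_nat_add avg_add avg_cmult by simp
  also have "\<dots> \<le> real n / 2 ^ 15 + 2 * (real n / 2 ^ 17) + 2 * (real n * (1 / 2 ^ 34))"
    using EN Ebad unc by (intro add_mono) auto
  also have "\<dots> \<le> real n / 2 ^ 14" by simp
  finally show ?thesis .
qed

text \<open>Half of the ordered pairs are far apart, so the mean of \<open>S\<close> is at least
  \<open>3 / 32\<close> of \<open>n\<^sup>2\<close>; being at most \<open>n\<^sup>2\<close>, it
  reaches half of that with probability at least \<open>3 / 64\<close>. A large matching exists with
  probability at most \<open>1 / 64\<close>.\<close>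

lemma avg_good:
  fixes k :: nat
  assumes n: "0 < n" and k: "2 \<le> k"
    and tri: "\<And>u v w. u < n \<Longrightarrow> v < n \<Longrightarrow> w < n \<Longrightarrow> sqdist m x u v \<le> sqdist m x u w + sqdist m x w v"
    and T: "\<And>i. i \<in> {1..2 * k} \<Longrightarrow> T i \<subseteq> {..<n} \<and> diam (sqdist m x) (T i) \<le> (1 / 2 ^ 43) / sqrt (ln k)"
    and cover: "(1 - (1 / 2 ^ 17)) * real n \<le> card (\<Union>i \<in> {1..2 * k}. T i)"
    and sparse: "\<And>u. u < n \<Longrightarrow> (\<Sum>v<n. of_bool (sqdist m x u v \<le> 1 / 4)) \<le> real n / 2"
  shows "1 / 32 \<le> avg m (\<lambda>g. of_bool (good n m x ((1 / 2 ^ 42) / sqrt (ln k)) g))"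
proof -
  define St where "St = stretched n m x ((1 / 2 ^ 42) / sqrt (ln k))"
  define small where "small g \<longleftrightarrow> (\<forall>M \<subseteq> St g. matching M \<longrightarrow> real (card M) \<le> real n / 256)" for g
  define S where "S = (\<lambda>g. \<Sum>u<n. \<Sum>v<n. of_bool (1 / 4 \<le> \<bar>ip m g (x v) - ip m g (x u)\<bar>) :: real)"
  \<comment> \<open>A large matching wherever there is one. Markov's inequality then turns the bound
    on the mean size into one on the probability.\<close>
  define M where "M g = (if small g then {} else SOME M. M \<subseteq> St g \<and> matching M \<and> \<not> real (card M) \<le> real n / 256)" for g
  have M: "M g \<subseteq> St g \<and> matching (M g) \<and> (small g \<or> real n / 256 < card (M g))" for g
  proof (cases "small g")
    case True
    then show ?thesis by (simp add: M_def matching_def)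
  next
    case False
    then have "\<exists>M. M \<subseteq> St g \<and> matching M \<and> \<not> real (card M) \<le> real n / 256"
      by (auto simp: small_def)
    from someI_ex[OF this] show ?thesis using False by (auto simp: M_def)
  qed
  have "avg m (\<lambda>g. of_bool (\<not> small g)) \<le> avg m (\<lambda>g. (256 / n) * card (M g))"
  proof (rule avg_mono)
    show "of_bool (\<not> small g) \<le> (256 / n) * card (M g)" for g
      using M[of g] n by (auto simp: field_simps)
  qed
  also have "\<dots> = (256 / n) * avg m (\<lambda>g. card (M g))" by (rule avg_cmult)
  also have "\<dots> \<le> (256 / n) * (real n / 2 ^ 14)"
    using M unfolding St_def
    by (intro mult_left_mono avg_stretched_matching_le[OF n k tri T cover]) auto
  also have "\<dots> = 1 / 64" using n by simp
  finally have small: "avg m (\<lambda>g. of_bool (\<not> small g)) \<le> 1 / 64" .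
  have "3 / 32 * (real n)\<^sup>2 \<le> 3 / 16 * (\<Sum>u<n. \<Sum>v<n. 1 - of_bool (sqdist m x u v \<le> 1 / 4))"
  proof -
    have "(\<Sum>u<n. real n / 2) \<le> (\<Sum>u<n. \<Sum>v<n. 1 - of_bool (sqdist m x u v \<le> 1 / 4))"
      using sparse by (intro sum_mono) (simp add: sum_subtractf)
    then show ?thesis by (simp add: power2_eq_square)
  qed
  also have "\<dots> = (\<Sum>u<n. \<Sum>v<n. 3 / 16 * (1 - of_bool (sqdist m x u v \<le> 1 / 4)))"
    by (simp only: sum_distrib_left)
  also have "\<dots> \<le> (\<Sum>u<n. \<Sum>v<n. avg m (\<lambda>g. of_bool (1 / 4 \<le> \<bar>ip m g (x v) - ip m g (x u)\<bar>)))"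
  proof (intro sum_mono)
    fix u v
    show "3 / 16 * (1 - of_bool (sqdist m x u v \<le> 1 / 4))
        \<le> avg m (\<lambda>g. of_bool (1 / 4 \<le> \<bar>ip m g (x v) - ip m g (x u)\<bar>))"
    proof (cases "sqdist m x u v \<le> 1 / 4")
      case True
      then show ?thesis
        using avg_mono[of "\<lambda>_. 0" "\<lambda>g. of_bool (1 / 4 \<le> \<bar>ip m g (x v) - ip m g (x u)\<bar>)" m] by simp
    next
      case False
      define q where "q = (\<Sum>i<m. (x v i - x u i)\<^sup>2)"
      have q: "1 / 4 < q" using False by (simp add: q_def sqdist_eq power2_commute)
      have "3 / 16 \<le> avg m (\<lambda>g. of_bool (q / 4 \<le> (ip m g (\<lambda>i. x v i - x u i))\<^sup>2))"
        using q by (intro avg_paley_zygmund q_def) auto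
      also have "\<dots> \<le> avg m (\<lambda>g. of_bool (1 / 4 \<le> \<bar>ip m g (x v) - ip m g (x u)\<bar>))"
      proof (rule avg_mono)
        fix g
        define z where "z = ip m g (x v) - ip m g (x u)"
        have "1 / 4 \<le> \<bar>z\<bar>" if "q / 4 \<le> z\<^sup>2"
        proof (rule power2_le_imp_le)
          show "(1 / 4)\<^sup>2 \<le> \<bar>z\<bar>\<^sup>2" using that q by (simp add: power2_eq_square)
        qed simp
        then show "of_bool (q / 4 \<le> (ip m g (\<lambda>i. x v i - x u i))\<^sup>2)
            \<le> (of_bool (1 / 4 \<le> \<bar>ip m g (x v) - ip m g (x u)\<bar>) :: real)"
          unfolding ip_diff z_def[symmetric] by simp
      qed
      finally show ?thesis using False by simp
    qed
  qed
  also have "\<dots> = avg m S" by (simp only: S_def avg_sum)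
  also have "\<dots> \<le> avg m (\<lambda>g. 3 / 64 * (real n)\<^sup>2 + (real n)\<^sup>2 * of_bool (3 / 64 * (real n)\<^sup>2 \<le> S g))"
  proof (rule avg_mono)
    fix g
    have "S g \<le> (\<Sum>u<n. \<Sum>v<n. 1)" unfolding S_def by (intro sum_mono) auto
    also have "\<dots> = (real n)\<^sup>2" by (simp add: power2_eq_square)
    finally show "S g \<le> 3 / 64 * (real n)\<^sup>2 + (real n)\<^sup>2 * of_bool (3 / 64 * (real n)\<^sup>2 \<le> S g)"
      by (simp add: add_increasing)
  qed
  also have "\<dots> = 3 / 64 * (real n)\<^sup>2 + (real n)\<^sup>2 * avg m (\<lambda>g. of_bool (3 / 64 * (real n)\<^sup>2 \<le> S g))"
    by (simp only: avg_add avg_cmult avg_const)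
  finally have "(real n)\<^sup>2 * (3 / 64) \<le> (real n)\<^sup>2 * avg m (\<lambda>g. of_bool (3 / 64 * (real n)\<^sup>2 \<le> S g))"
    by (simp add: algebra_simps)
  then have spread: "3 / 64 \<le> avg m (\<lambda>g. of_bool (3 / 64 * (real n)\<^sup>2 \<le> S g))"
    using n by simp
  have "1 / 32 \<le> avg m (\<lambda>g. of_bool (3 / 64 * (real n)\<^sup>2 \<le> S g) - of_bool (\<not> small g))"
    unfolding avg_diff using small spread by simp
  also have "\<dots> \<le> avg m (\<lambda>g. of_bool (good n m x ((1 / 2 ^ 42) / sqrt (ln k)) g))"
    by (rule avg_mono) (auto simp: good_def small_def S_def St_def)
  finally show ?thesis .
qed

text \<open>Many unmatched \<open>u\<close> have many unmatched vertices at least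
  \<open>1 / 4\<close> above them. The highest such \<open>u\<close> is taken as \<open>w\<close>,
  so that all of them lie at or below \<open>w\<close>. A short pair across the gap would be
  stretched with both endpoints unmatched, against maximality.\<close>

lemma good_separated:
  assumes n: "0 < n" and good: "good n m x \<Delta> g"
    and M: "M \<subseteq> stretched n m x \<Delta> g" "matching M"
    and maximal: "\<And>u v. (u, v) \<in> stretched n m x \<Delta> g \<Longrightarrow> u \<in> ends M \<or> v \<in> ends M"
  shows "\<exists>w<n. \<exists>B \<subseteq> {..<n}. n / 128 \<le> card (below n m x g (ends M) w) \<and>
     n / 128 \<le> card B \<and>
     (\<forall>a \<in> below n m x g (ends M) w. \<forall>b\<in>B. \<Delta> < sqdist m x a b)"
proof -
  define p where "p v = ip m g (x v)" for v
  define Z where "Z = ends M"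
  define U where "U = {..<n} - Z"
  define B where "B u = {v \<in> U. p u + 1 / 4 \<le> p v}" for u
  have fM: "finite M" using M(1) finite_stretched by (rule finite_subset)
  have Zn: "Z \<subseteq> {..<n}" using M(1) by (auto simp: Z_def stretched_def)
  have fZ: "finite Z" using fM by (simp add: Z_def)
  have fU: "finite U" by (simp add: U_def)
  have cZ: "card Z \<le> n / 128"
  proof -
    have "card Z \<le> card M + card M"
      unfolding Z_def by (rule order_trans[OF card_Un_le add_mono[OF card_image_le card_image_le]]) (use fM in auto)
    moreover have "card M \<le> real n / 256" using good M by (auto simp: good_def)
    ultimately show ?thesis by linarith
  qed
  have cardB: "real (card (B u)) = (\<Sum>v\<in>U. of_bool (p u + 1 / 4 \<le> p v))" for u
    using fU by (simp add: B_def of_bool_def sum.If_cases Int_def)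
  have cardB_le: "real (card (B u)) \<le> n" for u
    using card_mono[of "{..<n}" "B u"] by (auto simp: B_def U_def)
  have "3 / 64 * (real n)\<^sup>2 \<le> (\<Sum>u<n. \<Sum>v<n. of_bool (1 / 4 \<le> \<bar>p v - p u\<bar>))"
    using good by (simp add: good_def p_def)
  \<comment> \<open>A separated pair touches \<open>Z\<close> or is separated upwards in one of its
    two orders. At most \<open>n / 128\<close> vertices are matched, so pairs touching
    \<open>Z\<close> make up at most \<open>n\<^sup>2 / 64\<close> of the
    \<open>3 / 64 * n\<^sup>2\<close>.\<close>
  also have "\<dots> \<le> (\<Sum>u<n. \<Sum>v<n. of_bool (u \<in> U \<and> v \<in> U \<and> p u + 1 / 4 \<le> p v) +
      of_bool (v \<in> U \<and> u \<in> U \<and> p v + 1 / 4 \<le> p u) + of_bool (u \<in> Z) + of_bool (v \<in> Z))"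
    by (intro sum_mono) (auto simp: U_def abs_if)
  also have "\<dots> = 2 * (\<Sum>u<n. \<Sum>v<n. of_bool (u \<in> U \<and> v \<in> U \<and> p u + 1 / 4 \<le> p v)) + 2 * (real n * card Z)"
  proof -
    have "(\<Sum>v<n. of_bool (v \<in> Z)) = real (card Z)"
      using Zn by (simp add: of_bool_def sum.If_cases Int_absorb1)
    then show ?thesis
      using sum.swap[of "\<lambda>u v. of_bool (v \<in> U \<and> u \<in> U \<and> p v + 1 / 4 \<le> p u) :: real" "{..<n}" "{..<n}"]
      by (simp add: sum.distrib sum_distrib_left[symmetric])
  qed
  also have "(\<Sum>u<n. \<Sum>v<n. of_bool (u \<in> U \<and> v \<in> U \<and> p u + 1 / 4 \<le> p v)) = (\<Sum>u\<in>U. real (card (B u)))"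
  proof -
    have restrict: "(\<Sum>v<n. if v \<in> U then f v else 0) = sum f U" for f :: "nat \<Rightarrow> real"
      by (subst sum.inter_restrict[symmetric]) (auto simp: U_def intro: arg_cong[where f = "sum f"])
    have "(\<Sum>u<n. \<Sum>v<n. of_bool (u \<in> U \<and> v \<in> U \<and> p u + 1 / 4 \<le> p v))
        = (\<Sum>u<n. if u \<in> U then (\<Sum>v<n. if v \<in> U then of_bool (p u + 1 / 4 \<le> p v) else 0) else (0::real))"
      by (intro sum.cong refl, split if_split, intro conjI impI sum.cong sum.neutral ballI refl) auto
    also have "\<dots> = (\<Sum>u\<in>U. \<Sum>v\<in>U. of_bool (p u + 1 / 4 \<le> p v))"
      by (simp add: restrict)
    finally show ?thesis by (simp only: cardB)
  qed
  also have "2 * (real n * card Z) \<le> 2 * (real n * (n / 128))"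
    using cZ by (intro mult_left_mono) auto
  finally have "(real n)\<^sup>2 / 64 \<le> (\<Sum>u\<in>U. real (card (B u)))"
    by (simp add: power2_eq_square)
  \<comment> \<open>Vertices outside \<open>H\<close> contribute less than \<open>n / 128\<close>
    each, so at least half of the sum comes from \<open>H\<close>.\<close>
  define H where "H = {u \<in> U. n / 128 \<le> card (B u)}"
  have "(\<Sum>u\<in>U. real (card (B u))) \<le> (\<Sum>u\<in>U. real n * of_bool (u \<in> H) + n / 128)"
  proof (rule sum_mono)
    fix u assume "u \<in> U"
    then show "real (card (B u)) \<le> real n * of_bool (u \<in> H) + n / 128"
      using cardB_le[of u] add_increasing2[of "real n / 128" "card (B u)" "real n"]
      by (cases "u \<in> H") (auto simp: H_def simp del: of_nat_le_iff)
  qed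
  also have "\<dots> = real n * card H + card U * (n / 128)"
    using fU by (simp add: sum.distrib sum_distrib_left[symmetric] of_bool_def sum.If_cases H_def Int_def)
  also have "card U * (n / 128) \<le> n * (n / 128)"
    using card_mono[of "{..<n}" U] by (intro mult_right_mono) (auto simp: U_def)
  finally have "real n * (n / 128) \<le> real n * card H"
    using \<open>(real n)\<^sup>2 / 64 \<le> _\<close> by (simp add: power2_eq_square)
  then have cH: "n / 128 \<le> card H" using n by simp
  then have "H \<noteq> {}" using n by auto
  moreover have fH: "finite H" using fU by (simp add: H_def)
  ultimately obtain w where w: "w \<in> H" "\<And>u. u \<in> H \<Longrightarrow> p u \<le> p w"
    using obtains_MAX[of H p] by (metis Max_ge finite_imageI imageI)
  define A where "A = {v. v < n \<and> v \<notin> Z \<and> p v \<le> p w}"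
  have "H \<subseteq> A" using w(2) by (auto simp: A_def H_def U_def)
  then have "card H \<le> card A" by (rule card_mono[rotated]) (simp add: A_def)
  with cH have cA: "n / 128 \<le> card A" by linarith
  have "\<Delta> < sqdist m x a b" if "a \<in> A" "b \<in> B w" for a b
  proof (rule ccontr)
    assume "\<not> ?thesis"
    then have "(a, b) \<in> stretched n m x \<Delta> g"
      using that by (auto simp: stretched_def A_def B_def U_def p_def)
    then show False using maximal that by (auto simp: A_def B_def U_def Z_def)
  qed
  then show ?thesis
    using w cA unfolding A_def B_def Z_def p_def
    by (intro exI[of _ w] conjI exI[of _ "B w"]) (auto simp: H_def U_def B_def p_def Z_def)
qed

section \<open>Sweep cuts\<close>

text \<open>
  The weight of a value is its distance to the next larger value, so that the sum telescopes.
\<close>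

lemma threshold_weights:
  fixes F :: "real set"
  assumes "finite F"
  shows "\<exists>w. (\<forall>t. 0 \<le> w t) \<and>
     (\<forall>a\<in>F. \<forall>b\<in>F. \<bar>a - b\<bar> = (\<Sum>t\<in>F. w t * of_bool ((a \<le> t) \<noteq> (b \<le> t))))"
  using assms
proof (induction rule: finite_linorder_max_induct)
  case empty
  show ?case by (rule exI[of _ "\<lambda>_. 0"]) simp
next
  case (insert c F)
  then obtain w where w: "\<And>t. 0 \<le> w t"
      "\<And>a b. a \<in> F \<Longrightarrow> b \<in> F \<Longrightarrow> \<bar>a - b\<bar> = (\<Sum>t\<in>F. w t * of_bool ((a \<le> t) \<noteq> (b \<le> t)))"
    by blast
  show ?case
  proof (cases "F = {}")
    case True
    then show ?thesis by (intro exI[of _ "\<lambda>_. 0"]) auto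
  next
    case False
    define M where "M = Max F"
    have M: "M \<in> F" "\<And>a. a \<in> F \<Longrightarrow> a \<le> M"
      using insert.hyps(1) False by (auto simp: M_def)
    define w' where "w' = w(M := c - M, c := 0)"
    have "M < c" using insert.hyps(2) M(1) by blast
    have w': "0 \<le> w' t" for t using w(1)[of t] \<open>M < c\<close> by (simp add: w'_def)
    have old: "(\<Sum>t\<in>insert c F. w' t * of_bool ((a \<le> t) \<noteq> (b \<le> t))) = \<bar>a - b\<bar>" if "a \<in> F" "b \<in> F" for a b
    proof -
      have "(\<Sum>t\<in>insert c F. w' t * of_bool ((a \<le> t) \<noteq> (b \<le> t))) = (\<Sum>t\<in>F. w' t * of_bool ((a \<le> t) \<noteq> (b \<le> t)))"
        using insert.hyps by (subst sum.insert) (auto simp: w'_def)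
      also have "\<dots> = (\<Sum>t\<in>F. w t * of_bool ((a \<le> t) \<noteq> (b \<le> t)))"
        using M(2) that insert.hyps(2) by (intro sum.cong) (auto simp: w'_def)
      finally show ?thesis using w(2)[OF that] by simp
    qed
    have new: "(\<Sum>t\<in>insert c F. w' t * of_bool ((a \<le> t) \<noteq> (c \<le> t))) = \<bar>a - c\<bar>" if a: "a \<in> F" for a
    proof -
      have lt: "\<not> c \<le> t" if "t \<in> F" for t using insert.hyps(2) that by auto
      have "(\<Sum>t\<in>insert c F. w' t * of_bool ((a \<le> t) \<noteq> (c \<le> t))) = (\<Sum>t\<in>F. w' t * of_bool (a \<le> t))"
        using insert.hyps lt by (subst sum.insert) (auto simp: w'_def intro!: sum.cong)
      also have "\<dots> = w' M + (\<Sum>t\<in>F - {M}. w' t * of_bool (a \<le> t))"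
        using insert.hyps(1) M a by (subst sum.remove[of F M]) auto
      also have "(\<Sum>t\<in>F - {M}. w' t * of_bool (a \<le> t)) = (\<Sum>t\<in>F - {M}. w t * of_bool ((a \<le> t) \<noteq> (M \<le> t)))"
      proof (rule sum.cong)
        fix t assume t: "t \<in> F - {M}"
        then have "\<not> M \<le> t" using M(2)[of t] by auto
        moreover have "t \<noteq> c" using t lt[of t] by auto
        ultimately show "w' t * of_bool (a \<le> t) = w t * of_bool ((a \<le> t) \<noteq> (M \<le> t))"
          using t by (simp add: w'_def)
      qed simp
      also have "\<dots> = (\<Sum>t\<in>F. w t * of_bool ((a \<le> t) \<noteq> (M \<le> t)))"
        using insert.hyps(1) M a by (subst sum.remove[of F M]) auto
      also have "\<dots> = M - a" using w(2)[OF a M(1)] M(2)[OF a] by simp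
      also have "w' M = c - M" using \<open>M < c\<close> by (simp add: w'_def)
      finally show ?thesis using M(2)[OF a] \<open>M < c\<close> by simp
    qed
    have new': "(\<Sum>t\<in>insert c F. w' t * of_bool ((c \<le> t) \<noteq> (a \<le> t))) = \<bar>c - a\<bar>" if a: "a \<in> F" for a
      using new[OF a] by (simp add: abs_minus_commute eq_commute)
    have "\<bar>a - b\<bar> = (\<Sum>t\<in>insert c F. w' t * of_bool ((a \<le> t) \<noteq> (b \<le> t)))"
      if "a \<in> insert c F" "b \<in> insert c F" for a b
      using that old[of a b] new[of a] new'[of b] by (elim insertE) auto
    then show ?thesis using w' by blast
  qed
qed

definition cutsize :: "nat \<Rightarrow> (nat \<times> nat) set \<Rightarrow> nat set \<Rightarrow> nat" where
  "cutsize n E S = card (edges_between E S ({..<n} - S))"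

abbreviation spread :: "nat \<Rightarrow> (nat \<Rightarrow> real) \<Rightarrow> real" where
  "spread n f \<equiv> \<Sum>u<n. \<Sum>v<n. \<bar>f u - f v\<bar>"

text \<open>Measuring against the smaller side makes the bound invariant under complements, so a
  sweep may deliver either side. The degree is accounted for in the choice of
  \<open>K\<close>.\<close>

definition small_cut :: "nat \<Rightarrow> (nat \<times> nat) set \<Rightarrow> real \<Rightarrow> nat set \<Rightarrow> bool" where
  "small_cut n E K S \<longleftrightarrow> S \<noteq> {} \<and> S \<subset> {..<n} \<and> real (cutsize n E S) \<le> K * real (min (card S) (n - card S))"

text \<open>\<open>E\<close> contains both orientations of each edge, and \<open>prod.swap\<close>
  exchanges edges leaving and entering \<open>S\<close>. The factor 2 is matched by that of
  \<open>sum_separated_pairs\<close>.\<close>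

lemma sum_separated_edges:
  assumes E: "E \<subseteq> {..<n} \<times> {..<n}" "sym E" and S: "S \<subseteq> {..<n}"
  shows "(\<Sum>(u, v)\<in>E. of_bool ((u \<in> S) \<noteq> (v \<in> S))) = 2 * real (cutsize n E S)"
proof -
  have fE: "finite E" using E(1) by (rule finite_subset) simp
  define X where "X = edges_between E S ({..<n} - S)"
  define Y where "Y = edges_between E ({..<n} - S) S"
  have "(\<Sum>(u, v)\<in>E. of_bool ((u \<in> S) \<noteq> (v \<in> S))) = (\<Sum>e\<in>E. of_bool (e \<in> X \<union> Y) :: real)"
    using E(1) by (intro sum.cong) (auto simp: X_def Y_def edges_between_def)
  also have "\<dots> = card (X \<union> Y)"
    using fE by (simp add: X_def Y_def edges_between_def of_bool_def sum.If_cases)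
      (rule arg_cong[where f = card], auto)
  also have "\<dots> = card X + card Y"
    using fE finite_subset[of X E] finite_subset[of Y E]
    by (subst card_Un_disjoint) (auto simp: X_def Y_def edges_between_def)
  also have "Y = prod.swap ` X"
    using E(2) by (force simp: X_def Y_def edges_between_def sym_def)
  also have "card (prod.swap ` X) = card X"
    by (intro card_image) (auto simp: inj_on_def)
  finally show ?thesis by (simp add: cutsize_def X_def)
qed

lemma sum_separated_pairs:
  assumes "S \<subseteq> {..<n}"
  shows "(\<Sum>u<n. \<Sum>v<n. of_bool ((u \<in> S) \<noteq> (v \<in> S))) = 2 * (real (card S) * real (n - card S))"
proof -
  have fS: "finite S" using assms by (rule finite_subset) simp
  have c: "(\<Sum>v<n. of_bool (v \<in> S)) = real (card S)"
    using assms by (simp add: of_bool_def sum.If_cases Int_absorb1)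
  have c': "(\<Sum>v<n. 1 - of_bool (v \<in> S)) = real (n - card S)"
    using card_mono[OF _ assms] by (simp only: sum_subtractf c) (simp add: of_nat_diff)
  have "(\<Sum>u<n. \<Sum>v<n. of_bool ((u \<in> S) \<noteq> (v \<in> S)))
      = (\<Sum>u<n. \<Sum>v<n. of_bool (u \<in> S) * (1 - of_bool (v \<in> S)) + (1 - of_bool (u \<in> S)) * of_bool (v \<in> S) :: real)"
    by (intro sum.cong) auto
  then show ?thesis
    by (simp only: sum.distrib sum_distrib_left[symmetric] sum_distrib_right[symmetric] c c') simp
qed

text \<open>With the weights of \<open>threshold_weights\<close>, the spread of \<open>f\<close> and
  its variation along edges are both weighted sums over the threshold sets. If every proper
  threshold set had too many cut edges, the second sum would exceed \<open>K / n\<close> times the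
  first.\<close>

lemma sweep_cut:
  fixes f :: "nat \<Rightarrow> real" and K \<beta> :: real
  assumes E: "E \<subseteq> {..<n} \<times> {..<n}" "sym E" and n: "0 < n"
    and lip: "\<And>u v. (u, v) \<in> E \<Longrightarrow> \<bar>f u - f v\<bar> \<le> d u v"
    and spread: "\<beta> * (real n)\<^sup>2 \<le> spread n f" and \<beta>: "0 < \<beta>"
    and K: "(\<Sum>(u, v)\<in>E. d u v) \<le> K * \<beta> * n"
  shows "\<exists>t. small_cut n E K {v. v < n \<and> f v \<le> t}"
proof (rule ccontr)
  assume contra: "\<not> ?thesis"
  define F where "F = f ` {..<n}"
  have "finite F" by (simp add: F_def)
  from threshold_weights[OF this] obtain w where w: "\<And>t. 0 \<le> w t"
      "\<And>a b. a \<in> F \<Longrightarrow> b \<in> F \<Longrightarrow> \<bar>a - b\<bar> = (\<Sum>t\<in>F. w t * of_bool ((a \<le> t) \<noteq> (b \<le> t)))" by blast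
  define S where "S t = {v. v < n \<and> f v \<le> t}" for t
  have Sn: "S t \<subseteq> {..<n}" for t by (auto simp: S_def)
  have diff: "\<bar>f u - f v\<bar> = (\<Sum>t\<in>F. w t * of_bool ((u \<in> S t) \<noteq> (v \<in> S t)))" if "u < n" "v < n" for u v
    using w(2)[of "f u" "f v"] that by (simp add: F_def S_def)
  have K0: "0 \<le> K"
  proof -
    have "0 \<le> (\<Sum>(u, v)\<in>E. d u v)"
      using lip by (intro sum_nonneg) (auto intro: order_trans[OF abs_ge_zero])
    then have "0 \<le> K * (\<beta> * n)" using K by (simp add: mult.assoc)
    moreover have "0 < \<beta> * n" using \<beta> n by simp
    ultimately show ?thesis by (simp only: zero_le_mult_iff) linarith
  qed
  let ?X = "\<lambda>t. real (card (S t)) * real (n - card (S t))"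
  \<comment> \<open>Since \<open>card S * (n - card S)\<close> is at most \<open>n\<close> times the
    smaller factor, a set that is not a small cut also violates this product form. Trivial sets have
    product 0.\<close>
  have cut: "K / n * ?X t \<le> cutsize n E (S t)"
    and cut': "?X t = 0 \<or>
      K / n * ?X t < cutsize n E (S t)" for t
  proof -
    have fS: "finite (S t)" by (simp add: S_def)
    show 1: "?X t = 0 \<or>
      K / n * ?X t < cutsize n E (S t)"
    proof (cases "S t = {} \<or> S t = {..<n}")
      case False
      then have "K * min (card (S t)) (n - card (S t)) < cutsize n E (S t)"
        using contra Sn[of t] by (fastforce simp: small_cut_def S_def)
      moreover have "?X t \<le> n * min (card (S t)) (n - card (S t))"
      proof -
        have "card (S t) \<le> n" using card_mono[OF _ Sn[of t]] by simp
        then have "card (S t) * (n - card (S t)) \<le> n * min (card (S t)) (n - card (S t))"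
          by (cases "card (S t) \<le> n - card (S t)") (auto simp: min_def mult.commute intro: mult_le_mono)
        then show ?thesis by (metis of_nat_le_iff of_nat_mult)
      qed
      then have "K / n * ?X t \<le> K / n * (n * min (card (S t)) (n - card (S t)))"
        using K0 by (intro mult_left_mono) auto
      ultimately show ?thesis using n by simp
    next
      case True
      then have "card (S t) = 0 \<or> card (S t) = n" by (metis card.empty card_lessThan)
      then show ?thesis by (elim disjE) (simp_all only: diff_self_eq_0 of_nat_0 mult_zero_left mult_zero_right simp_thms)
    qed
    then show "K / n * ?X t \<le> cutsize n E (S t)"
      by (elim disjE) (simp only: mult_zero_right of_nat_0_le_iff, simp only: less_imp_le)
  qed
  define P where "P t = K / n * (2 * ?X t)" for t
  define Q where "Q t = 2 * real (cutsize n E (S t))" for t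
  have PQ: "P t \<le> Q t" for t
  proof -
    have "P t = 2 * (K / n * ?X t)"
      by (simp add: P_def)
    then show ?thesis using cut[of t] by (simp only: Q_def)
  qed
  have pairs: "K / n * spread n f = (\<Sum>t\<in>F. w t * P t)"
  proof -
    have "spread n f = (\<Sum>u<n. \<Sum>v<n. \<Sum>t\<in>F. w t * of_bool ((u \<in> S t) \<noteq> (v \<in> S t)))"
      by (intro sum.cong) (auto simp: diff)
    also have "\<dots> = (\<Sum>u<n. \<Sum>t\<in>F. \<Sum>v<n. w t * of_bool ((u \<in> S t) \<noteq> (v \<in> S t)))"
      by (intro sum.cong refl sum.swap)
    also have "\<dots> = (\<Sum>t\<in>F. \<Sum>u<n. \<Sum>v<n. w t * of_bool ((u \<in> S t) \<noteq> (v \<in> S t)))"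
      by (rule sum.swap)
    also have "\<dots> = (\<Sum>t\<in>F. w t * (2 * ?X t))"
      by (simp only: sum_distrib_left[symmetric] sum_separated_pairs[OF Sn])
    finally show ?thesis by (simp add: P_def sum_distrib_left algebra_simps)
  qed
  have edges: "(\<Sum>(u, v)\<in>E. \<bar>f u - f v\<bar>) = (\<Sum>t\<in>F. w t * Q t)"
  proof -
    have "(\<Sum>(u, v)\<in>E. \<bar>f u - f v\<bar>) = (\<Sum>e\<in>E. \<Sum>t\<in>F. w t * of_bool ((fst e \<in> S t) \<noteq> (snd e \<in> S t)))"
      using E(1) by (intro sum.cong) (auto simp: diff)
    also have "\<dots> = (\<Sum>t\<in>F. \<Sum>e\<in>E. w t * of_bool ((fst e \<in> S t) \<noteq> (snd e \<in> S t)))"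
      by (rule sum.swap)
    also have "\<dots> = (\<Sum>t\<in>F. w t * Q t)"
      by (simp only: sum_distrib_left[symmetric] Q_def sum_separated_edges[OF E Sn, unfolded case_prod_unfold])
    finally show ?thesis .
  qed
  \<comment> \<open>Strictness at one threshold is needed. If it failed everywhere, no threshold of
    positive weight would separate two vertices, and \<open>f\<close> would be constant, against
    positive spread.\<close>
  have "\<exists>t\<in>F. w t * P t < w t * Q t"
  proof (rule ccontr)
    assume *: "\<not> ?thesis"
    have zero: "w t * of_bool ((u \<in> S t) \<noteq> (v \<in> S t)) = 0" if "t \<in> F" "u < n" "v < n" for t u v
    proof (rule ccontr)
      assume "\<not> ?thesis"
      then have wt: "0 < w t" and sep: "(u \<in> S t) \<noteq> (v \<in> S t)" using w(1)[of t] by (auto simp: less_le)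
      have "card (S t) \<noteq> 0 \<and> n - card (S t) \<noteq> 0"
      proof -
        have "S t \<noteq> {}" "S t \<subset> {..<n}" using sep that Sn[of t] by auto
        moreover from this(2) have "card (S t) < n" using psubset_card_mono[of "{..<n}" "S t"] by simp
        moreover have "finite (S t)" by (simp add: S_def)
        ultimately show ?thesis by simp
      qed
      then have "K / n * ?X t < cutsize n E (S t)"
        using cut'[of t] by auto
      moreover have "P t = 2 * (K / n * ?X t)"
        by (simp add: P_def)
      ultimately have "P t < Q t" by (simp only: Q_def)
      then show False using * wt that(1) by auto
    qed
    have eq: "\<bar>f u - f v\<bar> = 0" if "u < n" "v < n" for u v
      unfolding diff[OF that] using zero that by (intro sum.neutral) blast
    have "spread n f = 0"
      by (rule sum.neutral, rule ballI, rule sum.neutral, rule ballI, rule eq) (auto simp only: lessThan_iff)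
    moreover have "0 < \<beta> * (real n)\<^sup>2" using \<beta> n by simp
    ultimately show False using spread by linarith
  qed
  then have "(\<Sum>t\<in>F. w t * P t) < (\<Sum>t\<in>F. w t * Q t)"
    using \<open>finite F\<close> w(1) PQ by (intro sum_strict_mono_ex1) (auto intro!: mult_left_mono)
  also have "\<dots> \<le> (\<Sum>(u, v)\<in>E. d u v)"
    unfolding edges[symmetric] using lip by (intro sum_mono) auto
  also have "\<dots> \<le> K / n * (\<beta> * (real n)\<^sup>2)" using K n by (simp add: power2_eq_square algebra_simps)
  also have "\<dots> \<le> K / n * spread n f"
    using spread K0 by (intro mult_left_mono) auto
  finally show False using pairs by simp
qed

text \<open>Pairs between \<open>A\<close> and its complement are counted in both orders;
  \<open>h = 0\<close> on \<open>A\<close> makes pairs inside \<open>A\<close> contribute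
  nothing.\<close>

lemma sum_pairs_ge:
  fixes f h :: "nat \<Rightarrow> real"
  assumes A: "A \<subseteq> {..<n}" and h: "\<And>a. a \<in> A \<Longrightarrow> h a = 0"
    and le: "\<And>a v. a \<in> A \<Longrightarrow> v < n \<Longrightarrow> h v \<le> \<bar>f a - f v\<bar>"
  shows "2 * (card A * (\<Sum>v<n. h v)) \<le> spread n f"
proof -
  have c: "(\<Sum>v<n. of_bool (v \<in> A)) = real (card A)"
    using A by (simp add: of_bool_def sum.If_cases Int_absorb1)
  have "2 * (card A * (\<Sum>v<n. h v)) = (\<Sum>u<n. \<Sum>v<n. of_bool (u \<in> A) * h v + h u * of_bool (v \<in> A))"
    by (simp only: sum.distrib sum_distrib_left[symmetric] sum_distrib_right[symmetric] c) simp
  also have "\<dots> \<le> spread n f"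
  proof (intro sum_mono)
    fix u v assume "u \<in> {..<n}" "v \<in> {..<n}"
    then show "of_bool (u \<in> A) * h v + h u * of_bool (v \<in> A) \<le> \<bar>f u - f v\<bar>"
      using le[of u v] le[of v u] h by (cases "u \<in> A"; cases "v \<in> A") (auto simp: abs_minus_commute)
  qed
  finally show ?thesis .
qed

definition level :: "nat \<Rightarrow> nat \<Rightarrow> (nat \<Rightarrow> nat \<Rightarrow> real) \<Rightarrow> nat set \<Rightarrow> real \<Rightarrow> nat set" where
  "level n m x A t = {v. v < n \<and> (\<exists>a\<in>A. sqdist m x v a \<le> t)}"

text \<open>Radii are pairwise distances because the program can try only finitely many;
  \<open>level_distance\<close> shows that these suffice.\<close>

abbreviation level_cut ::
  "nat \<Rightarrow> nat \<Rightarrow> (nat \<times> nat) set \<Rightarrow> (nat \<Rightarrow> nat \<Rightarrow> real) \<Rightarrow> real \<Rightarrow> nat set \<Rightarrow> bool" where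
  "level_cut n m E x K A \<equiv> \<exists>c<n. \<exists>e<n. small_cut n E K (level n m x A (sqdist m x c e))"

lemma finite_ex_max_pair:
  fixes f :: "'a \<Rightarrow> 'b \<Rightarrow> 'c :: linorder"
  assumes P: "finite P" "P \<noteq> {}"
  obtains c e where "(c, e) \<in> P" "\<And>c' e'. (c', e') \<in> P \<Longrightarrow> f c' e' \<le> f c e"
proof -
  obtain p where "p \<in> P" "Max (case_prod f ` P) = case_prod f p"
    using Max_in[of "case_prod f ` P"] P by (metis finite_imageI imageE image_is_empty)
  moreover have "case_prod f p' \<le> Max (case_prod f ` P)" if "p' \<in> P" for p'
    using P that by (intro Max_ge) auto
  ultimately show ?thesis by (intro that[of "fst p" "snd p"]) (auto simp: case_prod_beta)
qed

text \<open>The radius \<open>t\<close> is lowered to the largest pairwise distance not above it; a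
  nonempty level set guarantees that there is one.\<close>

lemma level_distance:
  assumes A: "A \<subseteq> {..<n}" and ne: "level n m x A t \<noteq> {}"
  shows "\<exists>c<n. \<exists>e<n. level n m x A t = level n m x A (sqdist m x c e)"
proof -
  define P where "P = {(c, e). c < n \<and> e < n \<and> sqdist m x c e \<le> t}"
  have fP: "finite P" by (rule finite_subset[of _ "{..<n} \<times> {..<n}"]) (auto simp: P_def)
  have "P \<noteq> {}" using ne A by (auto simp: level_def P_def)
  then obtain c e where ce: "(c, e) \<in> P" "\<And>c' e'. (c', e') \<in> P \<Longrightarrow> sqdist m x c' e' \<le> sqdist m x c e"
    using finite_ex_max_pair[OF fP, of "sqdist m x"] by blast
  have "sqdist m x v a \<le> t \<longleftrightarrow> sqdist m x v a \<le> sqdist m x c e" if "v < n" "a < n" for v a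
    using ce that by (force simp: P_def)
  then have "level n m x A t = level n m x A (sqdist m x c e)"
    using A unfolding level_def by blast
  then show ?thesis using ce(1) by (auto simp: P_def)
qed

section \<open>Sweeps on a feasible solution of the relaxation\<close>

locale arv =
  fixes n r m :: nat and E :: "(nat \<times> nat) set" and x :: "nat \<Rightarrow> nat \<Rightarrow> real"
  assumes n: "0 < n" and r: "0 < r" and reg: "regular_graph n r E" and feas: "arv_feasible n m x"
begin

abbreviation "d \<equiv> sqdist m x"

lemma E: "E \<subseteq> {..<n} \<times> {..<n}" "sym E"
  using reg by (auto simp: regular_graph_def)

lemma tri: "u < n \<Longrightarrow> v < n \<Longrightarrow> w < n \<Longrightarrow> d u v \<le> d u w + d w v"
  using feas by (auto simp: arv_feasible_def)

lemma sum_edges: "(\<Sum>(u, v)\<in>E. d u v) = 2 * r * n * arv_cost n r E m x"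
  using n r by (simp add: arv_cost_def)

lemma cost_nonneg: "0 \<le> arv_cost n r E m x"
  by (simp add: arv_cost_def sum_nonneg case_prod_beta)

text \<open>Normalisation and triangle inequality force mean squared distance at least
  \<open>1 / 2\<close> from \<open>u\<close>. Truncation at \<open>1 / 4\<close> makes
  \<open>f\<close> constant on the ball, which holds half of the vertices, and still leaves mean
  excess \<open>1 / 4\<close>; so the spread is at least a quarter of
  \<open>n\<^sup>2\<close>.\<close>

lemma ball_cut:
  assumes u: "u < n" and dense: "real n / 2 < (\<Sum>v<n. of_bool (d u v \<le> 1 / 4))"
    and K: "8 * r * arv_cost n r E m x \<le> K"
  shows "level_cut n m E x K {u}"
proof -
  define f where "f v = max (d v u) (1 / 4)" for v
  define B where "B = {v. v < n \<and> d u v \<le> 1 / 4}"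
  have fB: "finite B" "B \<subseteq> {..<n}" by (auto simp: B_def)
  have cB: "real n / 2 \<le> card B"
    using dense by (simp add: B_def of_bool_def sum.If_cases Int_def)
  have far: "real n / 4 \<le> (\<Sum>v<n. f v - 1 / 4)"
  proof -
    have "(real n)\<^sup>2 = (\<Sum>v<n. \<Sum>w<n. d v w)" using feas by (simp add: arv_feasible_def)
    also have "\<dots> \<le> (\<Sum>v<n. \<Sum>w<n. d v u + d w u)"
      using tri[OF _ _ u] by (intro sum_mono) (auto simp: sqdist_commute[of m x u])
    also have "\<dots> = 2 * real n * (\<Sum>v<n. d v u)"
      by (simp add: sum.distrib sum_distrib_left mult.assoc)
    finally have "real n / 2 \<le> (\<Sum>v<n. d v u)"
      using n by (simp add: power2_eq_square)
    also have "\<dots> \<le> (\<Sum>v<n. f v)" by (intro sum_mono) (simp add: f_def)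
    finally show ?thesis by (simp add: sum_subtractf)
  qed
  have "(1 / 4) * (real n)\<^sup>2 = 2 * (real n / 2 * (real n / 4))"
    by (simp add: power2_eq_square)
  also have "\<dots> \<le> 2 * (card B * (\<Sum>v<n. f v - 1 / 4))"
    using cB far by (intro mult_left_mono mult_mono) auto
  also have "\<dots> \<le> spread n f"
    using fB(2) by (intro sum_pairs_ge) (auto simp: f_def B_def sqdist_commute[of m x u])
  finally have "(1 / 4) * (real n)\<^sup>2 \<le> spread n f" .
  moreover have "\<bar>f a - f b\<bar> \<le> d a b" if "(a, b) \<in> E" for a b
  proof -
    have ab: "a < n" "b < n" using E that by auto
    have "d a u \<le> d a b + d b u" "d b u \<le> d a b + d a u"
      using tri[OF ab(1) u ab(2)] tri[OF ab(2) u ab(1)] by (auto simp: sqdist_commute)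
    then show ?thesis using sqdist_nonneg[of m x a b] by (auto simp: f_def max_def abs_if)
  qed
  moreover have "(\<Sum>(u, v)\<in>E. d u v) \<le> K * (1 / 4) * n"
    unfolding sum_edges using mult_right_mono[OF K, of "real n / 4"] by (simp add: algebra_simps)
  ultimately obtain t where t: "small_cut n E K {v. v < n \<and> f v \<le> t}"
    using sweep_cut[OF E n, of f d "1 / 4" K] by auto
  \<comment> \<open>A nonempty threshold set has \<open>t \<ge> 1 / 4\<close>, where the truncation
    is invisible.\<close>
  have "{v. v < n \<and> f v \<le> t} = level n m x {u} t"
    using t by (auto simp: level_def f_def small_cut_def)
  then have t: "small_cut n E K (level n m x {u} t)" using t by simp
  then have "level n m x {u} t \<noteq> {}" by (simp add: small_cut_def)
  with level_distance[of "{u}" n m x t] u t show ?thesis by (metis empty_subsetI insert_subset lessThan_iff)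
qed

text \<open>Sweep over the squared distance to \<open>A\<close>, which is Lipschitz because
  \<open>d\<close> satisfies the triangle inequality. The two sets give spread at least
  \<open>2 * (n / 128) * (n / 128) * \<Delta>\<close>; this is the origin of
  \<open>2 ^ 14\<close>.\<close>

lemma separated_cut:
  assumes A: "A \<subseteq> {..<n}" "n / 128 \<le> card A" and B: "B \<subseteq> {..<n}" "n / 128 \<le> card B"
    and sep: "\<And>a b. a \<in> A \<Longrightarrow> b \<in> B \<Longrightarrow> \<Delta> < d a b" and \<Delta>: "0 < \<Delta>"
    and K: "2 ^ 14 * r * arv_cost n r E m x / \<Delta> \<le> K"
  shows "level_cut n m E x K A"
proof -
  have fA: "finite A" using A(1) by (rule finite_subset) simp
  have neA: "A \<noteq> {}" using A(2) n by auto
  define f where "f v = Min ((\<lambda>a. d v a) ` A)" for v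
  have f_le: "f v \<le> t \<longleftrightarrow> (\<exists>a\<in>A. d v a \<le> t)" for v t
    using fA neA by (simp add: f_def Min_le_iff)
  have f_ge: "t \<le> f v \<longleftrightarrow> (\<forall>a\<in>A. t \<le> d v a)" for v t
    using fA neA by (simp add: f_def)
  define h where "h v = \<Delta> * of_bool (v \<in> B)" for v
  have fA0: "f a = 0" if "a \<in> A" for a
    using f_le[of a 0] f_ge[of 0 a] that by (auto intro: bexI[of _ a])
  have AB: "A \<inter> B = {}"
    using sep \<Delta> by (metis disjoint_iff less_asym sqdist_self)
  have "(2 * \<Delta> / 2 ^ 14) * (real n)\<^sup>2 = 2 * (real n / 128 * (\<Delta> * (real n / 128)))"
    by (simp add: power2_eq_square)
  also have "\<dots> \<le> 2 * (card A * (\<Delta> * card B))"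
    using A B \<Delta> by (intro mult_left_mono mult_mono) auto
  also have "\<Delta> * card B = (\<Sum>v<n. h v)"
    using B(1) by (simp add: h_def sum_distrib_left[symmetric] of_bool_def sum.If_cases Int_absorb1)
  also have "2 * (card A * (\<Sum>v<n. h v)) \<le> spread n f"
  proof (rule sum_pairs_ge[OF A(1)])
    show "h a = 0" if "a \<in> A" for a using that AB by (auto simp: h_def)
    show "h v \<le> \<bar>f a - f v\<bar>" if "a \<in> A" "v < n" for a v
    proof (cases "v \<in> B")
      case True
      then have "\<Delta> \<le> f v" unfolding f_ge using sep by (auto simp: sqdist_commute[of m x v] less_imp_le)
      then show ?thesis using fA0[OF that(1)] \<Delta> by (simp add: h_def)
    qed (simp add: h_def)
  qed
  finally have spread: "(2 * \<Delta> / 2 ^ 14) * (real n)\<^sup>2 \<le> spread n f" .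
  have lip: "\<bar>f u - f v\<bar> \<le> d u v" if "(u, v) \<in> E" for u v
  proof -
    have "f u \<le> d u v + f v" if "u < n" "v < n" for u v
    proof -
      obtain a where a: "a \<in> A" "d v a \<le> f v" using f_le[of v "f v"] by auto
      have "d u a \<le> d u v + f v" using tri[of u a v] a A(1) that by auto
      then show ?thesis unfolding f_le using a(1) by blast
    qed
    from this[of u v] this[of v u] show ?thesis
      using that E by (auto simp: sqdist_commute[of m x v])
  qed
  have "(\<Sum>(u, v)\<in>E. d u v) \<le> K * (2 * \<Delta> / 2 ^ 14) * n"
  proof -
    have "2 ^ 14 * r * arv_cost n r E m x \<le> K * \<Delta>" using K \<Delta> by (simp add: field_simps)
    from mult_right_mono[OF this, of "2 * real n / 2 ^ 14"] show ?thesis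
      unfolding sum_edges by (simp add: algebra_simps)
  qed
  then obtain t where t: "small_cut n E K {v. v < n \<and> f v \<le> t}"
    using sweep_cut[OF E n lip spread] \<Delta> by auto
  have "{v. v < n \<and> f v \<le> t} = level n m x A t"
    by (simp add: level_def f_le)
  then have t: "small_cut n E K (level n m x A t)" using t by simp
  then have "level n m x A t \<noteq> {}" by (simp add: small_cut_def)
  from level_distance[OF A(1) this] t show ?thesis by metis
qed

text \<open>
  Only finitely many matching thresholds are relevant, so the unknown \<open>\<Delta>\<close> may be replaced by
  one of the distances.
\<close>

lemma good_cut:
  assumes good: "good n m x \<Delta> g" and \<Delta>: "0 < \<Delta>" and K: "2 ^ 14 * r * arv_cost n r E m x / \<Delta> \<le> K"
  shows "\<exists>a<n. \<exists>b<n. \<forall>M. maximal_matching (stretched n m x (d a b) g) M \<longrightarrow>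
    (\<exists>w<n. level_cut n m E x K (below n m x g (ends M) w))"
proof -
  define P where "P = {(a, b). a < n \<and> b < n \<and> d a b \<le> \<Delta>}"
  have fP: "finite P" by (rule finite_subset[of _ "{..<n} \<times> {..<n}"]) (auto simp: P_def)
  have "(0, 0) \<in> P" using n \<Delta> by (auto simp: P_def)
  then obtain a b where ab: "(a, b) \<in> P" "\<And>a' b'. (a', b') \<in> P \<Longrightarrow> d a' b' \<le> d a b"
    using finite_ex_max_pair[OF fP, of d] by blast
  have same: "stretched n m x (d a b) g = stretched n m x \<Delta> g"
    using ab by (force simp: stretched_def P_def)
  have "\<exists>w<n. level_cut n m E x K (below n m x g (ends M) w)"
    if M: "M \<subseteq> stretched n m x \<Delta> g" "matching M"
      "\<And>u v. (u, v) \<in> stretched n m x \<Delta> g \<Longrightarrow> u \<in> ends M \<or> v \<in> ends M" for M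
  proof -
    define A where "A w = below n m x g (ends M) w" for w
    obtain w B where w: "w < n" "B \<subseteq> {..<n}" "n / 128 \<le> card (A w)" "n / 128 \<le> card B"
        "\<And>a b. a \<in> A w \<Longrightarrow> b \<in> B \<Longrightarrow> \<Delta> < d a b"
      using good_separated[OF n good M] unfolding A_def by blast
    have "A w \<subseteq> {..<n}" by (auto simp: A_def)
    from separated_cut[OF this w(3) w(2) w(4) w(5) \<Delta> K] w(1) show ?thesis
      unfolding A_def by blast
  qed
  note cuts = this
  have "a < n" "b < n" using ab(1) by (auto simp: P_def)
  show ?thesis
  proof (rule exI[of _ a], rule conjI[OF \<open>a < n\<close>], rule exI[of _ b], rule conjI[OF \<open>b < n\<close>], intro allI impI)
    fix M
    assume "maximal_matching (stretched n m x (d a b) g) M"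
    then show "\<exists>w<n. level_cut n m E x K (below n m x g (ends M) w)"
      unfolding same by (intro cuts) auto
  qed
qed

end

section \<open>Programs\<close>

text \<open>All coin tosses are quantified over, and different runs may meet \<open>Q\<close> at
  different times within the budget. Time bounds therefore add up even when branches differ in
  length.\<close>

primrec reach :: "nat \<Rightarrow> config \<Rightarrow> (config \<Rightarrow> bool) \<Rightarrow> bool" where
  "reach 0 c Q \<longleftrightarrow> Q c"
| "reach (Suc t) c Q \<longleftrightarrow> Q c \<or> (\<forall>c' \<in> set_pmf (step c). reach t c' Q)"

lemma reach_now: "Q c \<Longrightarrow> reach t c Q"
  by (cases t) auto

lemma reach_mono: "reach t c Q \<Longrightarrow> t \<le> t' \<Longrightarrow> (\<And>c. Q c \<Longrightarrow> Q' c) \<Longrightarrow> reach t' c Q'"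
proof (induction t arbitrary: c t')
  case (Suc t)
  then obtain t'' where "t' = Suc t''" "t \<le> t''" by (cases t') auto
  moreover have "reach t'' c' Q'" if "c' \<in> set_pmf (step c)" "\<not> Q c" for c'
    using Suc.prems that \<open>t \<le> t''\<close> by (intro Suc.IH[of c' t'']) auto
  ultimately show ?case using Suc.prems by (cases "Q c") auto
qed (auto intro: reach_now)

lemma reach_trans: "reach t c Q \<Longrightarrow> (\<And>c. Q c \<Longrightarrow> reach u c R) \<Longrightarrow> reach (t + u) c R"
proof (induction t arbitrary: c)
  case (Suc t)
  show ?case
  proof (cases "Q c")
    case True
    from Suc.prems(2)[OF True] show ?thesis by (rule reach_mono) simp_all
  next
    case False
    have "reach (t + u) c' R" if "c' \<in> set_pmf (step c)" for c'
      using that Suc.prems False by (intro Suc.IH) auto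
    then show ?thesis by simp
  qed
qed simp

lemma reach_invariant:
  assumes "reach t c Q" "J c" "\<And>c c'. J c \<Longrightarrow> c' \<in> set_pmf (step c) \<Longrightarrow> J c'"
  shows "reach t c (\<lambda>c. Q c \<and> J c)"
  using assms(1,2)
proof (induction t arbitrary: c)
  case (Suc t)
  then show ?case using assms(3)[of c] by (cases "Q c") simp_all
qed simp

definition conts :: "com list \<Rightarrow> config \<Rightarrow> config" where
  "conts cs = (\<lambda>(ds, s). (ds @ cs, s))"

lemma step_append: "ds \<noteq> [] \<Longrightarrow> step (ds @ cs, s) = map_pmf (conts cs) (step (ds, s))"
  by (cases "(ds, s)" rule: step.cases) (auto simp: conts_def pmf.map_comp o_def)

lemma reach_halted: "reach t ([], s) Q \<Longrightarrow> Q ([], s)"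
  by (induction t) auto

text \<open>A step inspects only the head of the command list, so appended commands wait until the
  front is used up.\<close>

lemma reach_append:
  assumes "reach t (ds, s) (\<lambda>(cs', s). cs' = [] \<and> Q s)"
  shows "reach t (ds @ cs, s) (\<lambda>(cs', s). cs' = cs \<and> Q s)"
  using assms
proof (induction t arbitrary: ds s)
  case (Suc t)
  show ?case
  proof (cases "ds = []")
    case True
    with Suc.prems have "Q s" using reach_halted[of "Suc t" s] by fastforce
    then show ?thesis using True by (intro reach_now) auto
  next
    case False
    then have "reach t (conts cs c) (\<lambda>(cs', s). cs' = cs \<and> Q s)" if "c \<in> set_pmf (step (ds, s))" for c
      using Suc.IH[of "fst c" "snd c"] Suc.prems that False by (cases c) (auto simp: conts_def)
    then show ?thesis using False by (auto simp: step_append)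
  qed
qed auto

text \<open>Worst-case number of steps provided that no loop makes more than \<open>N\<close>
  rounds; for a fixed program this is polynomial in \<open>N\<close>.\<close>

primrec tm :: "nat \<Rightarrow> com \<Rightarrow> nat" where
  "tm N (NWrite a i j e) = 1"
| "tm N (RWrite a i j e) = 1"
| "tm N (Coin a i j) = 1"
| "tm N (Seq c d) = 1 + tm N c + tm N d"
| "tm N (Cond b c d) = 1 + tm N c + tm N d"
| "tm N (Loop b c) = N * (1 + tm N c) + 1"

lemma tm_poly: "\<exists>p. \<forall>N. tm N c = poly p N"
proof (induction c)
  case (Seq c d)
  then obtain p q where "\<And>N. tm N c = poly p N" "\<And>N. tm N d = poly q N" by auto
  then show ?case by (intro exI[of _ "1 + p + q"]) simp
next
  case (Cond b c d)
  then obtain p q where "\<And>N. tm N c = poly p N" "\<And>N. tm N d = poly q N" by auto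
  then show ?case by (intro exI[of _ "1 + p + q"]) simp
next
  case (Loop b c)
  then obtain p where "\<And>N. tm N c = poly p N" by auto
  then show ?case by (intro exI[of _ "[:0, 1:] * (1 + p) + 1"]) simp
qed (rule exI[of _ 1], simp)+

primrec writes :: "com \<Rightarrow> nat set" where
  "writes (NWrite a i j e) = {a}"
| "writes (RWrite a i j e) = {}"
| "writes (Coin a i j) = {a}"
| "writes (Seq c d) = writes c \<union> writes d"
| "writes (Cond b c d) = writes c \<union> writes d"
| "writes (Loop b c) = writes c"

primrec rwrites :: "com \<Rightarrow> nat set" where
  "rwrites (NWrite a i j e) = {}"
| "rwrites (RWrite a i j e) = {a}"
| "rwrites (Coin a i j) = {}"
| "rwrites (Seq c d) = rwrites c \<union> rwrites d"
| "rwrites (Cond b c d) = rwrites c \<union> rwrites d"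
| "rwrites (Loop b c) = rwrites c"

definition frame :: "com \<Rightarrow> store \<Rightarrow> store \<Rightarrow> bool" where
  "frame c s s' \<longleftrightarrow> (\<forall>a. a \<notin> writes c \<longrightarrow> nats s' a = nats s a) \<and> (\<forall>a. a \<notin> rwrites c \<longrightarrow> reals s' a = reals s a)"

text \<open>Preservation of unwritten arrays is syntactic. Built into \<open>wp_conseq\<close>, it
  lets specifications speak only of what a program changes.\<close>

lemma reach_frame:
  assumes "reach t ([c], s) Q"
  shows "reach t ([c], s) (\<lambda>(ds, s'). Q (ds, s') \<and> frame c s s')"
proof -
  define J where "J = (\<lambda>(ds, s'). (\<forall>d \<in> set ds. writes d \<subseteq> writes c \<and> rwrites d \<subseteq> rwrites c) \<and> frame c s s')"
  have "J p'" if "J p" "p' \<in> set_pmf (step p)" for p p'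
    using that by (cases p rule: step.cases) (auto simp: J_def frame_def upd_def)
  moreover have "J ([c], s)" by (auto simp: J_def frame_def)
  ultimately have "reach t ([c], s) (\<lambda>p. Q p \<and> J p)" by (intro reach_invariant[OF assms]) auto
  then show ?thesis by (rule reach_mono) (auto simp: J_def)
qed

section \<open>Total correctness by preconditions\<close>

definition wp :: "nat \<Rightarrow> com \<Rightarrow> (store \<Rightarrow> bool) \<Rightarrow> store \<Rightarrow> bool" where
  "wp N c Q s \<longleftrightarrow> reach (tm N c) ([c], s) (\<lambda>(cs, s). cs = [] \<and> Q s)"

lemma wp_conseq: "wp N c Q s \<Longrightarrow> (\<And>s'. frame c s s' \<Longrightarrow> Q s' \<Longrightarrow> Q' s') \<Longrightarrow> wp N c Q' s"
  unfolding wp_def by (drule reach_frame, erule reach_mono) auto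

lemma wp_cont: "wp N c Q s \<Longrightarrow> reach (tm N c) (c # cs, s) (\<lambda>(cs', s). cs' = cs \<and> Q s)"
  unfolding wp_def using reach_append[of "tm N c" "[c]"] by simp

lemma wp_NWrite: "Q (s\<lparr>nats := upd a (nval i s) (nval j s) (nval e s) (nats s)\<rparr>) \<Longrightarrow> wp N (NWrite a i j e) Q s"
  by (simp add: wp_def)

lemma wp_RWrite: "Q (s\<lparr>reals := upd a (nval i s) (nval j s) (rval e s) (reals s)\<rparr>) \<Longrightarrow> wp N (RWrite a i j e) Q s"
  by (simp add: wp_def)

lemma wp_Coin: "(\<And>b. Q (s\<lparr>nats := upd a (nval i s) (nval j s) (of_bool b) (nats s)\<rparr>)) \<Longrightarrow> wp N (Coin a i j) Q s"
  by (auto simp: wp_def)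

lemma wp_Seq:
  assumes "wp N c (wp N d Q) s"
  shows "wp N (Seq c d) Q s"
proof -
  have "reach (tm N c + tm N d) (c # [d], s) (\<lambda>(cs, s). cs = [] \<and> Q s)"
    using wp_cont[OF assms, of "[d]"] by (rule reach_trans) (auto simp: wp_def)
  then show ?thesis by (simp add: wp_def)
qed

lemma wp_Cond:
  assumes "bval b s \<Longrightarrow> wp N c Q s" "\<not> bval b s \<Longrightarrow> wp N d Q s"
  shows "wp N (Cond b c d) Q s"
proof (cases "bval b s")
  case True
  with assms(1) have "reach (tm N c + tm N d) ([c], s) (\<lambda>(cs, s). cs = [] \<and> Q s)"
    unfolding wp_def by (auto elim!: reach_mono)
  with True show ?thesis by (simp add: wp_def)
next
  case False
  with assms(2) have "reach (tm N c + tm N d) ([d], s) (\<lambda>(cs, s). cs = [] \<and> Q s)"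
    unfolding wp_def by (auto elim!: reach_mono)
  with False show ?thesis by (simp add: wp_def)
qed

definition Var :: "nat \<Rightarrow> nexp" where
  "Var a = NRead a (NConst 0) (NConst 0)"

definition Set :: "nat \<Rightarrow> nexp \<Rightarrow> com" where
  "Set a e = NWrite a (NConst 0) (NConst 0) e"

text \<open>The bound is evaluated anew before each round and the counter is an ordinary scalar. The
  rules therefore ask that the bound keep its value and that the body preserve the counter.\<close>

definition For :: "nat \<Rightarrow> nexp \<Rightarrow> com \<Rightarrow> com" where
  "For a e c = Seq (Set a (NConst 0)) (Loop (NLess (Var a) e) (Seq c (Set a (NAdd (Var a) (NConst 1)))))"

abbreviation get :: "store \<Rightarrow> nat \<Rightarrow> nat" where
  "get s a \<equiv> nats s a 0 0"

definition put :: "nat \<Rightarrow> nat \<Rightarrow> store \<Rightarrow> store" where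
  "put a y s = s\<lparr>nats := upd a 0 0 y (nats s)\<rparr>"

lemma put_simps [simp]:
  "nats (put a y s) b i j = (if b = a \<and> i = 0 \<and> j = 0 then y else nats s b i j)"
  "reals (put a y s) = reals s"
  by (auto simp: put_def upd_def)

lemma nval_Var [simp]: "nval (Var a) s = get s a"
  by (simp add: Var_def)

lemma wp_Set: "Q (put a (nval e s) s) \<Longrightarrow> wp N (Set a e) Q s"
  unfolding Set_def put_def by (rule wp_NWrite) simp

lemma tm_Set [simp]: "tm N (Set a e) = 1"
  by (simp add: Set_def)

text \<open>
  Used with \<open>\<Phi> t p v\<close> saying that every run from \<open>p\<close> reaches a postcondition within \<open>t\<close> steps, and that
  success within \<open>t\<close> steps has probability at least \<open>v\<close>.  The invariant refers to the store in which the
  counter has already been set.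
\<close>

lemma For_rule:
  fixes \<Phi> :: "nat \<Rightarrow> config \<Rightarrow> 'v \<Rightarrow> bool"
  assumes det: "\<And>t p p' v. step p = return_pmf p' \<Longrightarrow> \<Phi> t p' v \<Longrightarrow> \<Phi> (Suc t) p v"
    and bound: "\<And>s'. frame (For a e c) s s' \<Longrightarrow> nval e s' = M"
    and init: "I 0 (put a 0 s)"
    and step: "\<And>j s' cs t. j < M \<Longrightarrow> I j s' \<Longrightarrow> get s' a = j \<Longrightarrow> frame (For a e c) s s' \<Longrightarrow>
      (\<And>s''. get s'' a = j \<Longrightarrow> I (Suc j) (put a (Suc j) s'') \<Longrightarrow> frame c s' s'' \<Longrightarrow>
        \<Phi> t (cs, s'') (V (Suc j) (put a (Suc j) s''))) \<Longrightarrow> \<Phi> (T + t) (c # cs, s') (V j s')"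
    and final: "\<And>s'. I M s' \<Longrightarrow> frame (For a e c) s s' \<Longrightarrow> \<Phi> u (cs, s') (V M s')"
  shows "\<Phi> (M * (T + 3) + 3 + u) (For a e c # cs, s) (V 0 (put a 0 s))"
proof -
  define A where "A = Set a (NAdd (Var a) (NConst 1))"
  define L where "L = Loop (NLess (Var a) e) (Seq c A)"
  define K where "K = (\<lambda>j s'. get s' a = j \<and> I j s' \<and> frame (For a e c) s s')"
  \<comment> \<open>Induction on the number of rounds left. Besides the body, a round takes three
    steps: the loop test, the unfolding of \<open>Seq\<close> and the increment.\<close>
  have loop: "\<Phi> ((M - j) * (T + 3) + 1 + u) (L # cs, s') (V j s')" if "j \<le> M" "K j s'" for j s'
    using that
  proof (induction "M - j" arbitrary: j s')
    case 0
    then have "j = M" "I M s'" "get s' a = M" "nval e s' = M" "frame (For a e c) s s'"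
      using bound by (auto simp: K_def)
    then show ?case
      using det[of "(L # cs, s')" "(cs, s')" u "V M s'"] final[of s'] by (simp add: L_def)
  next
    case (Suc i)
    then have j: "j < M" "i = M - Suc j" by auto
    have K: "get s' a = j" "I j s'" "frame (For a e c) s s'" using Suc.prems by (auto simp: K_def)
    define r where "r = (M - Suc j) * (T + 3) + 1 + u"
    have "\<Phi> (T + Suc r) (c # A # L # cs, s') (V j s')"
    proof (rule step[OF j(1) K(2,1,3)])
      fix s'' assume s'': "get s'' a = j" "I (Suc j) (put a (Suc j) s'')" "frame c s' s''"
      have "K (Suc j) (put a (Suc j) s'')"
        using K(3) s'' by (auto simp: K_def frame_def For_def Set_def put_def upd_def)
      then have "\<Phi> r (L # cs, put a (Suc j) s'') (V (Suc j) (put a (Suc j) s''))"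
        unfolding r_def using Suc.hyps(1)[OF j(2)] j(1) by simp
      moreover have "step (A # L # cs, s'') = return_pmf (L # cs, put a (Suc j) s'')"
        using s''(1) by (simp add: A_def Set_def put_def)
      ultimately show "\<Phi> (Suc r) (A # L # cs, s'') (V (Suc j) (put a (Suc j) s''))" by (intro det)
    qed
    moreover have "step (L # cs, s') = return_pmf (Seq c A # L # cs, s')"
      using K(1) j(1) bound[OF K(3)] by (simp add: L_def)
    moreover have "step (Seq c A # L # cs, s') = return_pmf (c # A # L # cs, s')" by simp
    ultimately have "\<Phi> (Suc (Suc (T + Suc r))) (L # cs, s') (V j s')" by (intro det)
    moreover have "M - j = Suc (M - Suc j)" using j by simp
    then have "(M - j) * (T + 3) + 1 + u = Suc (Suc (T + Suc r))" by (simp add: r_def)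
    ultimately show ?case by (simp only:)
  qed
  have "K 0 (put a 0 s)"
    using init by (auto simp: K_def frame_def For_def Set_def put_def upd_def)
  from loop[OF _ this] have "\<Phi> (M * (T + 3) + 1 + u) (L # cs, put a 0 s) (V 0 (put a 0 s))" by simp
  moreover have "step (For a e c # cs, s) = return_pmf (Set a (NConst 0) # L # cs, s)"
    by (simp add: For_def L_def A_def)
  moreover have "step (Set a (NConst 0) # L # cs, s) = return_pmf (L # cs, put a 0 s)"
    by (simp add: Set_def put_def)
  ultimately have "\<Phi> (Suc (Suc (M * (T + 3) + 1 + u))) (For a e c # cs, s) (V 0 (put a 0 s))"
    by (intro det)
  moreover have "Suc (Suc (M * (T + 3) + 1 + u)) = M * (T + 3) + 3 + u" by simp
  ultimately show ?thesis by (simp only:)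
qed

lemma wp_For:
  assumes bound: "\<And>s'. frame (For a e c) s s' \<Longrightarrow> nval e s' = M" and M: "M \<le> N"
    and init: "I 0 (put a 0 s)"
    and step: "\<And>j s'. j < M \<Longrightarrow> I j s' \<Longrightarrow> get s' a = j \<Longrightarrow> frame (For a e c) s s' \<Longrightarrow>
      wp N c (\<lambda>s''. get s'' a = j \<and> I (Suc j) (put a (Suc j) s'')) s'"
    and final: "\<And>s'. I M s' \<Longrightarrow> frame (For a e c) s s' \<Longrightarrow> Q s'"
  shows "wp N (For a e c) Q s"
proof -
  have "reach (M * (tm N c + 3) + 3 + 0) (For a e c # [], s) (\<lambda>(cs, s). cs = [] \<and> Q s)"
  proof (rule For_rule[where \<Phi> = "\<lambda>t p (_ :: unit). reach t p (\<lambda>(cs, s). cs = [] \<and> Q s)" and V = "\<lambda>_ _. ()" and I = I])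
    fix j s' cs t assume j: "j < M" "I j s'" "get s' a = j" "frame (For a e c) s s'"
      and cont: "\<And>s''. get s'' a = j \<Longrightarrow> I (Suc j) (put a (Suc j) s'') \<Longrightarrow> frame c s' s'' \<Longrightarrow>
        reach t (cs, s'') (\<lambda>(cs, s). cs = [] \<and> Q s)"
    have "wp N c (\<lambda>s''. (get s'' a = j \<and> I (Suc j) (put a (Suc j) s'')) \<and> frame c s' s'') s'"
      using step[OF j] by (rule wp_conseq) simp
    from wp_cont[OF this, of cs] show "reach (tm N c + t) (c # cs, s') (\<lambda>(cs, s). cs = [] \<and> Q s)"
      by (rule reach_trans) (auto intro: cont)
  qed (use bound init final in auto)
  then show ?thesis
    unfolding wp_def
  proof (rule reach_mono)
    have "M * (tm N c + 3) \<le> N * (tm N c + 3)" using M by (rule mult_le_mono1)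
    then show "M * (tm N c + 3) + 3 + 0 \<le> tm N (For a e c)"
      by (simp add: For_def algebra_simps)
  qed auto
qed

section \<open>Halting times and termination\<close>

lemma run_halted [simp]: "run t ([], s) = return_pmf ([], s)"
  by (induction t) (auto simp: bind_return_pmf)

lemma run_add: "run (t + u) c = bind_pmf (run t c) (run u)"
proof (induction t arbitrary: c)
  case (Suc t)
  then have "run (t + u) = (\<lambda>c. bind_pmf (run t c) (run u))" by (intro ext)
  then show ?case by (simp add: bind_assoc_pmf)
qed (simp add: bind_return_pmf)

lemma reach_run:
  assumes "reach t c (\<lambda>(cs, s). cs = [] \<and> Q s)" "c' \<in> set_pmf (run t c)"
  shows "fst c' = [] \<and> Q (snd c')"
  using assms
proof (induction t arbitrary: c)
  case (Suc t)
  show ?case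
  proof (cases "fst c = [] \<and> Q (snd c)")
    case True
    then obtain s where "c = ([], s)" "Q s" by (cases c) auto
    with Suc.prems show ?thesis by (auto simp: bind_return_pmf)
  next
    case False
    obtain d where "d \<in> set_pmf (step c)" "c' \<in> set_pmf (run t d)"
      using Suc.prems(2) by auto
    moreover from this False have "reach t d (\<lambda>(cs, s). cs = [] \<and> Q s)"
      using Suc.prems(1) by (cases c) auto
    ultimately show ?thesis by (intro Suc.IH)
  qed
qed auto

lemma halts_within_tm: "wp N P Q s \<Longrightarrow> halts_within P s (tm N P)"
  unfolding halts_within_def wp_def using reach_run by (fastforce simp: case_prod_beta)

lemma halts_within_mono: "halts_within P s t \<Longrightarrow> t \<le> t' \<Longrightarrow> halts_within P s t'"
proof -
  assume "halts_within P s t" "t \<le> t'"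
  then obtain u where "t' = t + u" by (auto simp: le_iff_add)
  with \<open>halts_within P s t\<close> show ?thesis
    by (fastforce simp: halts_within_def run_add case_prod_beta)
qed

lemma run_stable:
  assumes "halts_within P s t" "t \<le> t'"
  shows "run t' ([P], s) = run t ([P], s)"
proof -
  obtain u where u: "t' = t + u" using assms(2) by (auto simp: le_iff_add)
  have "bind_pmf (run t ([P], s)) (run u) = bind_pmf (run t ([P], s)) return_pmf"
    using assms(1) by (intro bind_pmf_cong refl) (auto simp: halts_within_def)
  then show ?thesis by (simp add: u run_add bind_return_pmf')
qed

text \<open>Runs are stationary after halting, so any halting bound can stand in for the least
  one.\<close>

lemma final_store_eq:
  assumes "halts_within P s t"
  shows "final_store P s = map_pmf snd (run t ([P], s))"
proof -
  have "halts_within P s (LEAST t. halts_within P s t)" using assms by (rule LeastI)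
  from run_stable[OF this, of t] Least_le[of "halts_within P s", OF assms] show ?thesis
    by (simp add: final_store_def)
qed

text \<open>Loop bounds are read from array \<open>0\<close>; as it is never written, they stay
  fixed, and termination can be checked without functional specifications.\<close>

definition terminates :: "nat \<Rightarrow> nat \<Rightarrow> nat \<Rightarrow> com \<Rightarrow> bool" where
  "terminates n m N c \<longleftrightarrow> 0 \<notin> writes c \<and>
     (\<forall>s. nats s 0 0 0 = n \<and> nats s 0 1 0 = m \<longrightarrow> wp N c (\<lambda>_. True) s)"

lemma terminates_basic [intro!]:
  "a \<noteq> 0 \<Longrightarrow> terminates n m N (NWrite a i j e)"
  "a \<noteq> 0 \<Longrightarrow> terminates n m N (Set a e)"
  "terminates n m N (RWrite b i j f)"
  "a \<noteq> 0 \<Longrightarrow> terminates n m N (Coin a i j)"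
  by (auto simp: terminates_def Set_def intro!: wp_NWrite wp_RWrite wp_Coin)

lemma terminates_Seq [intro!]:
  assumes c: "terminates n m N c" and d: "terminates n m N d"
  shows "terminates n m N (Seq c d)"
proof -
  have "wp N (Seq c d) (\<lambda>_. True) s" if s: "nats s 0 0 0 = n \<and> nats s 0 1 0 = m" for s
  proof (rule wp_Seq)
    have "wp N c (\<lambda>_. True) s" using c s by (auto simp: terminates_def)
    then show "wp N c (wp N d (\<lambda>_. True)) s"
      by (rule wp_conseq) (use c d s in \<open>auto simp: terminates_def frame_def\<close>)
  qed
  then show ?thesis using c d by (auto simp: terminates_def)
qed

lemma terminates_Cond [intro!]:
  "terminates n m N c \<Longrightarrow> terminates n m N d \<Longrightarrow> terminates n m N (Cond b c d)"
  by (auto simp: terminates_def intro!: wp_Cond)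

lemma terminates_For:
  assumes c: "terminates n m N c" and a: "a \<noteq> 0" "a \<notin> writes c"
    and e: "\<And>s. nats s 0 0 0 = n \<Longrightarrow> nats s 0 1 0 = m \<Longrightarrow> nval e s = M" and M: "M \<le> N"
  shows "terminates n m N (For a e c)"
proof -
  have z: "0 \<notin> writes (For a e c)" using c a by (auto simp: For_def Set_def terminates_def)
  have "wp N (For a e c) (\<lambda>_. True) s" if s: "nats s 0 0 0 = n \<and> nats s 0 1 0 = m" for s
  proof (rule wp_For[where I = "\<lambda>_ _. True"])
    show "nval e s' = M" if "frame (For a e c) s s'" for s'
      using e[of s'] that z s by (auto simp: frame_def)
    show "wp N c (\<lambda>s''. get s'' a = j \<and> True) s'" if "get s' a = j" "frame (For a e c) s s'" for j s'
    proof -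
      have "nats s' 0 = nats s 0" using that(2) z by (auto simp: frame_def)
      then have "wp N c (\<lambda>_. True) s'" using c s by (auto simp: terminates_def)
      then show ?thesis by (rule wp_conseq) (use that a in \<open>auto simp: frame_def\<close>)
    qed
  qed (use M in auto)
  then show ?thesis using z by (auto simp: terminates_def)
qed

section \<open>Lower bounds for the probability of success\<close>

definition wins :: "nat \<Rightarrow> config \<Rightarrow> (store \<Rightarrow> bool) \<Rightarrow> real \<Rightarrow> bool" where
  "wins t c G p \<longleftrightarrow> ennreal p \<le> emeasure (run t c) {(cs, s). cs = [] \<and> G s}"

lemma wins_step:
  assumes "\<And>c'. c' \<in> set_pmf (step c) \<Longrightarrow> wins t c' G p"
  shows "wins (Suc t) c G p"
proof -
  have "ennreal p = (\<integral>\<^sup>+c'. ennreal p \<partial>step c)" by simp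
  also have "\<dots> \<le> (\<integral>\<^sup>+c'. emeasure (run t c') {(cs, s). cs = [] \<and> G s} \<partial>step c)"
    using assms by (intro nn_integral_mono_AE) (auto simp: wins_def AE_measure_pmf_iff)
  finally show ?thesis by (simp add: wins_def)
qed

text \<open>Halted configurations are stationary, so longer runs can only gain successes.\<close>

lemma wins_Suc: "emeasure (run t c) {(cs, s). cs = [] \<and> G s} \<le> emeasure (run (Suc t) c) {(cs, s). cs = [] \<and> G s}"
proof (induction t arbitrary: c)
  case 0
  obtain cs s where c: "c = (cs, s)" by (cases c)
  show ?case
    by (cases cs) (auto simp: c bind_return_pmf indicator_def)
next
  case (Suc t)
  show ?case
    using nn_integral_mono[of "step c", OF Suc.IH] by simp
qed

lemma wins_mono: "wins t c G p \<Longrightarrow> t \<le> t' \<Longrightarrow> p' \<le> p \<Longrightarrow> wins t' c G p'"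
proof -
  assume p: "wins t c G p" "p' \<le> p" and t: "t \<le> t'"
  have "emeasure (run t c) {(cs, s). cs = [] \<and> G s} \<le> emeasure (run t' c) {(cs, s). cs = [] \<and> G s}"
    using t
  proof (induction rule: dec_induct)
    case (step t')
    from step.IH wins_Suc show ?case by (rule order_trans)
  qed simp
  moreover have "ennreal p' \<le> ennreal p" using p(2) by (rule ennreal_leI)
  ultimately show ?thesis using p(1) unfolding wins_def by (meson order_trans)
qed

text \<open>A stage that works for all coin tosses costs time but no probability.\<close>

lemma wins_reach:
  assumes "reach t c Q" "\<And>c. Q c \<Longrightarrow> wins u c G p"
  shows "wins (t + u) c G p"
  using assms(1)
proof (induction t arbitrary: c)
  case (Suc t)
  show ?case
  proof (cases "Q c")
    case True
    from assms(2)[OF True] show ?thesis by (rule wins_mono) auto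
  next
    case False
    have "wins (t + u) c' G p" if "c' \<in> set_pmf (step c)" for c'
      using Suc.prems that False by (intro Suc.IH) auto
    then show ?thesis by (simp only: add_Suc) (rule wins_step)
  qed
qed (simp add: assms(2))

lemma wins_wp:
  assumes "wp N c Q s" "\<And>s'. frame c s s' \<Longrightarrow> Q s' \<Longrightarrow> wins u (cs, s') G p"
  shows "wins (tm N c + u) (c # cs, s) G p"
proof -
  have "wp N c (\<lambda>s'. frame c s s' \<and> Q s') s" using assms(1) by (rule wp_conseq) auto
  from wp_cont[OF this, of cs] show ?thesis by (rule wins_reach) (use assms(2) in auto)
qed

lemma wins_Coin:
  assumes "wins t (cs, s\<lparr>nats := upd a (nval i s) (nval j s) 1 (nats s)\<rparr>) G p"
    "wins t (cs, s\<lparr>nats := upd a (nval i s) (nval j s) 0 (nats s)\<rparr>) G q" "0 \<le> p" "0 \<le> q"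
  shows "wins (Suc t) (Coin a i j # cs, s) G ((p + q) / 2)"
proof -
  define e where "e b = emeasure (run t (cs, s\<lparr>nats := upd a (nval i s) (nval j s) (of_bool b) (nats s)\<rparr>))
    {(cs, s). cs = [] \<and> G s}" for b
  have e: "ennreal p \<le> e True" "ennreal q \<le> e False" using assms by (auto simp: wins_def e_def)
  have "ennreal ((p + q) / 2) = ennreal p * ennreal (1 / 2) + ennreal q * ennreal (1 / 2)"
    using assms(3,4) ennreal_plus[of "p * (1 / 2)" "q * (1 / 2)"]
    by (simp only: ennreal_mult[symmetric]) (simp add: add_divide_distrib)
  also have "\<dots> \<le> e True * ennreal (1 / 2) + e False * ennreal (1 / 2)"
    using e by (intro add_mono mult_right_mono) auto
  also have "\<dots> = (\<integral>\<^sup>+b. e b \<partial>bernoulli_pmf (1 / 2))"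
    by simp
  finally show ?thesis by (simp add: wins_def e_def bind_map_pmf)
qed

section \<open>Binary length of the stored real numbers\<close>

primrec small_exp :: "rexp \<Rightarrow> bool" where
  "small_exp (RRead a i j) \<longleftrightarrow> a = 0"
| "small_exp (RMul e f) \<longleftrightarrow> (\<exists>i j i' j'. e = RSub (RRead 0 i j) (RRead 0 i' j') \<and> f = e)"
| "small_exp (ROfNat e) \<longleftrightarrow> False"
| "small_exp (RAdd e f) \<longleftrightarrow> False"
| "small_exp (RSub e f) \<longleftrightarrow> False"
| "small_exp (RDiv e f) \<longleftrightarrow> False"

text \<open>A working entry may be reset to 0 or changed by one input entry or one square of a
  difference of input entries. Products never feed into further products, so numbers stay short.
  Tests are unrestricted because their values are not stored.\<close>

fun accumulates :: "rexp \<Rightarrow> bool" where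
  "accumulates (RAdd (RRead a i j) e) \<longleftrightarrow> a \<noteq> 0 \<and> small_exp e"
| "accumulates (RSub (RRead a i j) e) \<longleftrightarrow> a \<noteq> 0 \<and> small_exp e"
| "accumulates e \<longleftrightarrow> e = ROfNat (NConst 0)"

primrec accumulating :: "com \<Rightarrow> bool" where
  "accumulating (NWrite a i j e) = True"
| "accumulating (RWrite a i j e) \<longleftrightarrow> a \<noteq> 0 \<and> accumulates e"
| "accumulating (Coin a i j) = True"
| "accumulating (Seq c d) \<longleftrightarrow> accumulating c \<and> accumulating d"
| "accumulating (Cond b c d) \<longleftrightarrow> accumulating c \<and> accumulating d"
| "accumulating (Loop b c) \<longleftrightarrow> accumulating c"

text \<open>A step changes magnitudes by at most \<open>4 * B\<^sup>2\<close>, the bound for the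
  square of a difference, and keeps all entries integer multiples of
  \<open>1 / Q\<^sup>2\<close>.\<close>

lemma run_accumulating:
  fixes Q :: int
  assumes acc: "accumulating P" and B: "1 \<le> B"
    and s0: "\<And>i j. \<bar>reals s 0 i j\<bar> \<le> B" "\<And>i j. reals s 0 i j * Q \<in> \<int>" "\<And>a i j. a \<noteq> 0 \<Longrightarrow> reals s a i j = 0"
    and c: "(cs, s') \<in> set_pmf (run t ([P], s))"
  shows "reals s' 0 = reals s 0 \<and> (\<forall>a i j. a \<noteq> 0 \<longrightarrow> \<bar>reals s' a i j\<bar> \<le> real t * (4 * B\<^sup>2) \<and> reals s' a i j * (of_int Q)\<^sup>2 \<in> \<int>)"
proof -
  define J where "J t = (\<lambda>(cs, s' :: store). (\<forall>c\<in>set cs. accumulating c) \<and> reals s' 0 = reals s 0 \<and>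
    (\<forall>a i j. a \<noteq> 0 \<longrightarrow> \<bar>reals s' a i j\<bar> \<le> real t * (4 * B\<^sup>2) \<and> reals s' a i j * (of_int Q)\<^sup>2 \<in> \<int>))" for t
  have small: "\<bar>rval e s'\<bar> \<le> 4 * B\<^sup>2 \<and> rval e s' * (of_int Q)\<^sup>2 \<in> \<int>"
    if e: "small_exp e" and s': "reals s' 0 = reals s 0" for e s'
  proof (cases e)
    case (RRead a i j)
    then have [simp]: "rval e s' = reals s 0 (nval i s') (nval j s')" using e s' by simp
    have "\<bar>rval e s'\<bar> \<le> B" using s0(1) by simp
    also have "B \<le> 4 * B\<^sup>2" using B by (simp add: power2_eq_square)
    moreover have "rval e s' * (of_int Q)\<^sup>2 = (reals s 0 (nval i s') (nval j s') * Q) * of_int Q"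
      by (simp add: power2_eq_square)
    then have "rval e s' * (of_int Q)\<^sup>2 \<in> \<int>" using s0(2) by (metis Ints_mult Ints_of_int)
    ultimately show ?thesis by simp
  next
    case (RMul f g)
    then obtain i j i' j' where f: "e = RMul f f" "f = RSub (RRead 0 i j) (RRead 0 i' j')" using e by auto
    define y where "y = reals s 0 (nval i s') (nval j s')"
    define z where "z = reals s 0 (nval i' s') (nval j' s')"
    have v: "rval e s' = (y - z)\<^sup>2" using f s' by (simp add: y_def z_def power2_eq_square)
    have "\<bar>y - z\<bar> \<le> 2 * B" using s0(1)[of "nval i s'" "nval j s'"] s0(1)[of "nval i' s'" "nval j' s'"]
      by (simp add: y_def z_def)
    then have "\<bar>y - z\<bar>\<^sup>2 \<le> (2 * B)\<^sup>2" by (intro power_mono) auto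
    moreover have "(y - z)\<^sup>2 * (of_int Q)\<^sup>2 = (y * Q - z * Q) * (y * Q - z * Q)"
      by (simp add: power2_eq_square algebra_simps)
    moreover have "y * Q - z * Q \<in> \<int>" unfolding y_def z_def by (intro Ints_diff s0(2))
    ultimately show ?thesis by (simp add: v Ints_mult power_mult_distrib)
  qed (use e in auto)
  have growth: "0 \<le> 4 * B\<^sup>2" by simp
  have acc_val: "\<bar>rval e s'\<bar> \<le> real (Suc t) * (4 * B\<^sup>2) \<and> rval e s' * (of_int Q)\<^sup>2 \<in> \<int>"
    if e: "accumulates e" and J: "J t (cs, s')" for e t cs s'
  proof (cases e rule: accumulates.cases)
    case (1 a i j f)
    then have "\<bar>reals s' a (nval i s') (nval j s')\<bar> \<le> real t * (4 * B\<^sup>2)" "reals s' a (nval i s') (nval j s') * (of_int Q)\<^sup>2 \<in> \<int>"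
      using e J by (auto simp: J_def)
    moreover have "\<bar>rval f s'\<bar> \<le> 4 * B\<^sup>2" "rval f s' * (of_int Q)\<^sup>2 \<in> \<int>" using small[of f s'] e J 1 by (auto simp: J_def)
    ultimately show ?thesis using 1 by (auto simp: algebra_simps)
  next
    case (2 a i j f)
    then have "\<bar>reals s' a (nval i s') (nval j s')\<bar> \<le> real t * (4 * B\<^sup>2)" "reals s' a (nval i s') (nval j s') * (of_int Q)\<^sup>2 \<in> \<int>"
      using e J by (auto simp: J_def)
    moreover have "\<bar>rval f s'\<bar> \<le> 4 * B\<^sup>2" "rval f s' * (of_int Q)\<^sup>2 \<in> \<int>" using small[of f s'] e J 2 by (auto simp: J_def)
    ultimately show ?thesis using 2 by (auto simp: algebra_simps)
  qed (use e in auto)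
  have weaken: "\<bar>y\<bar> \<le> real (Suc t) * (4 * B\<^sup>2)" if "\<bar>y\<bar> \<le> real t * (4 * B\<^sup>2)" for y t
  proof -
    have "real t * (4 * B\<^sup>2) \<le> real (Suc t) * (4 * B\<^sup>2)" by (intro mult_right_mono) auto
    with that show ?thesis by linarith
  qed
  have step: "J (Suc t) c'" if J: "J t c" and c': "c' \<in> set_pmf (step c)" for t c c'
  proof -
    obtain ds s' where c: "c = (ds, s')" by (cases c)
    have old: "\<bar>reals s' b k l\<bar> \<le> real (Suc t) * (4 * B\<^sup>2) \<and> reals s' b k l * (of_int Q)\<^sup>2 \<in> \<int>" if "b \<noteq> 0" for b k l
      using J that weaken unfolding c J_def by blast
    have r0: "reals s' 0 = reals s 0" and ds: "\<forall>d\<in>set ds. accumulating d"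
      using J by (auto simp: c J_def)
    show ?thesis
    proof (cases c rule: step.cases)
      case (3 a i j e cs s1)
      then have eq: "s1 = s'" "ds = RWrite a i j e # cs" using c by auto
      have "a \<noteq> 0" "accumulates e" using ds eq by auto
      with acc_val[OF this(2), of t ds s'] J c' r0 ds show ?thesis
        unfolding 3 eq by (simp add: J_def upd_def old c eq del: of_nat_Suc)
    qed (use c c' r0 ds in \<open>auto simp: J_def old simp del: of_nat_Suc\<close>)
  qed
  have "J t c" if "c \<in> set_pmf (run t ([P], s))" for c
    using that
  proof (induction t arbitrary: c)
    case 0
    then show ?case using acc s0(3) by (simp add: J_def)
  next
    case (Suc t)
    from Suc.prems have "c \<in> set_pmf (bind_pmf (run t ([P], s)) (run 1))"
      by (simp add: run_add[symmetric] del: run.simps)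
    then obtain d where "d \<in> set_pmf (run t ([P], s))" "c \<in> set_pmf (step d)"
      by (auto simp: bind_return_pmf')
    then show ?case using step Suc.IH by blast
  qed
  from this[OF c] show ?thesis by (simp add: J_def)
qed

text \<open>The product of all \<open>n * m\<close> denominators, whose length is at most the sum of
  theirs.\<close>

lemma common_denominator:
  fixes x :: "nat \<Rightarrow> nat \<Rightarrow> real"
  assumes "\<And>v i. v < n \<Longrightarrow> i < m \<Longrightarrow> fraction_of_bits b (x v i)"
  obtains Q :: int where "0 < Q" "Q \<le> 2 ^ (b * (n * m))"
    "\<And>v i. v < n \<Longrightarrow> i < m \<Longrightarrow> x v i * Q \<in> \<int> \<and> \<bar>x v i\<bar> \<le> 2 ^ b"
proof -
  have "\<exists>p q :: int. x v i = of_int p / of_int q \<and> 0 < q \<and> \<bar>p\<bar> < 2 ^ b \<and> q < 2 ^ b" if "v < n" "i < m" for v i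
    using assms[OF that] by (simp add: fraction_of_bits_def)
  then obtain p q :: "nat \<Rightarrow> nat \<Rightarrow> int" where
    pq: "\<And>v i. v < n \<Longrightarrow> i < m \<Longrightarrow> x v i = of_int (p v i) / of_int (q v i) \<and> 0 < q v i \<and> \<bar>p v i\<bar> < 2 ^ b \<and> q v i < 2 ^ b"
    by metis
  define Q where "Q = (\<Prod>(v, i)\<in>{..<n} \<times> {..<m}. q v i)"
  show ?thesis
  proof
    show "0 < Q" unfolding Q_def using pq by (intro prod_pos) auto
    have "Q \<le> (\<Prod>(v, i)\<in>{..<n} \<times> {..<m}. 2 ^ b)"
      unfolding Q_def using pq by (intro prod_mono) (auto simp: less_imp_le)
    also have "\<dots> = 2 ^ (b * (n * m))"
      by (simp add: case_prod_beta power_mult)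
    finally show "Q \<le> 2 ^ (b * (n * m))" .
    show "x v i * Q \<in> \<int> \<and> \<bar>x v i\<bar> \<le> 2 ^ b" if vi: "v < n" "i < m" for v i
    proof
      have "q v i dvd Q"
        unfolding Q_def using vi dvd_prodI[of "{..<n} \<times> {..<m}" "(v, i)" "\<lambda>(v, i). q v i"] by auto
      then obtain z where "Q = q v i * z" by (elim dvdE)
      then have "x v i * Q = of_int (p v i * z)" using pq[OF vi] by simp
      then show "x v i * Q \<in> \<int>" by (metis Ints_of_int)
      have "\<bar>x v i\<bar> = \<bar>of_int (p v i)\<bar> / of_int (q v i)" using pq[OF vi] by simp
      also have "\<dots> \<le> \<bar>of_int (p v i)\<bar> / 1"
        using pq[OF vi] by (intro divide_left_mono) auto
      also have "\<dots> = of_int \<bar>p v i\<bar>" by simp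
      also have "\<dots> \<le> of_int (2 ^ b)" using pq[OF vi] by (intro of_int_le_iff[THEN iffD2]) auto
      finally show "\<bar>x v i\<bar> \<le> 2 ^ b" by simp
    qed
  qed
qed

lemma poly_nat_mono: "a \<le> b \<Longrightarrow> poly p a \<le> poly (p :: nat poly) b"
  by (induction p) (auto intro!: add_mono mult_mono)

lemma randomized_poly_timeI:
  assumes acc: "accumulating P" and ends: "\<And>n m. terminates n m (C * (n + m)) P"
  shows "randomized_poly_time P"
proof -
  obtain p0 where p0: "\<And>N. tm N P = poly p0 N" using tm_poly by blast
  define p where "p = pcompose p0 [:0, C:]"
  have halts: "halts_within P (encode n E m x) (poly p (n + m))" for n E m x
    using halts_within_tm[of "C * (n + m)" P "\<lambda>_. True" "encode n E m x"] ends[of n m]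
    by (auto simp: terminates_def p_def poly_pcompose p0 encode_def mult.commute)
  \<comment> \<open>Chosen to exceed the exponent \<open>?e\<close> below; the cube dominates
    \<open>b * (n * m)\<close>.\<close>
  define q where "q = p + 2 * [:0, 1:] ^ 3 + 2 * [:0, 1:] + 4"
  have q: "poly q N = poly p N + 2 * N ^ 3 + 2 * N + 4" for N
    by (simp add: q_def algebra_simps)
  have bits: "fraction_of_bits (poly q (n + m + b)) (reals s a i j)"
    if x: "\<And>v i. v < n \<Longrightarrow> i < m \<Longrightarrow> fraction_of_bits b (x v i)"
      and cs: "(cs, s) \<in> set_pmf (run t ([P], encode n E m x))" for n E m x b t cs s a i j
  proof -
    define s0 where "s0 = encode n E m x"
    define T where "T = poly p (n + m)"
    \<comment> \<open>Nothing changes after \<open>T\<close> steps, so the time may be assumed to be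
      at most \<open>T\<close>.\<close>
    obtain t' where t': "t' \<le> T" "(cs, s) \<in> set_pmf (run t' ([P], s0))"
    proof (cases "t \<le> T")
      case False
      then show ?thesis using cs run_stable[OF halts, of n m t E x] that[of T] by (simp add: T_def s0_def)
    qed (use cs that in \<open>auto simp: s0_def\<close>)
    obtain Q :: int where Q: "0 < Q" "Q \<le> 2 ^ (b * (n * m))"
      "\<And>v i. v < n \<Longrightarrow> i < m \<Longrightarrow> x v i * Q \<in> \<int> \<and> \<bar>x v i\<bar> \<le> 2 ^ b"
      using common_denominator[of n m b x] x by metis
    have main: "reals s 0 = reals s0 0 \<and> (\<forall>a i j. a \<noteq> 0 \<longrightarrow>
      \<bar>reals s a i j\<bar> \<le> real t' * (4 * (2 ^ b)\<^sup>2) \<and> reals s a i j * (of_int Q)\<^sup>2 \<in> \<int>)"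
      by (rule run_accumulating[OF acc _ _ _ _ t'(2)]) (use Q(3) in \<open>auto simp: s0_def encode_def\<close>)
    have "\<bar>reals s a i j\<bar> \<le> real (T + 1) * (4 * (2 ^ b)\<^sup>2) \<and> reals s a i j * (of_int Q)\<^sup>2 \<in> \<int>"
    proof (cases "a = 0")
      case True
      have "(2 ^ b :: real) \<le> (2 ^ b)\<^sup>2" by (intro self_le_power) auto
      also have "\<dots> \<le> real (T + 1) * (4 * (2 ^ b)\<^sup>2)"
        using mult_right_mono[of 1 "real (T + 1) * 4" "(2 ^ b :: real)\<^sup>2"] by simp
      finally have "(2 ^ b :: real) \<le> real (T + 1) * (4 * (2 ^ b)\<^sup>2)" .
      moreover have "\<bar>reals s0 0 i j\<bar> \<le> 2 ^ b \<and> reals s0 0 i j * Q \<in> \<int>"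
        using Q(3) by (auto simp: s0_def encode_def)
      moreover have "reals s0 0 i j * (of_int Q)\<^sup>2 = reals s0 0 i j * Q * of_int Q" by (simp add: power2_eq_square)
      ultimately have "\<bar>reals s0 0 i j\<bar> \<le> real (T + 1) * (4 * (2 ^ b)\<^sup>2) \<and> reals s0 0 i j * (of_int Q)\<^sup>2 \<in> \<int>"
        by (metis Ints_mult Ints_of_int order_trans)
      then show ?thesis using main True by simp
    next
      case False
      have "real t' * (4 * (2 ^ b)\<^sup>2) \<le> real (T + 1) * (4 * (2 ^ b)\<^sup>2)"
        using t'(1) by (intro mult_right_mono) auto
      moreover have "\<bar>reals s a i j\<bar> \<le> real t' * (4 * (2 ^ b)\<^sup>2)" "reals s a i j * (of_int Q)\<^sup>2 \<in> \<int>"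
        using main False by blast+
      ultimately show ?thesis by linarith
    qed
    then obtain z :: int where z: "reals s a i j * (of_int Q)\<^sup>2 = z" and le: "\<bar>reals s a i j\<bar> \<le> real (T + 1) * (4 * (2 ^ b)\<^sup>2)"
      by (auto elim: Ints_cases)
    \<comment> \<open>Length of the numerator: \<open>T + 1\<close> for the number of steps, 2 for
      the factor 4, \<open>2 * b\<close> for the squared input bound, the rest for the
      denominator.\<close>
    let ?e = "T + 1 + 2 + 2 * b + 2 * (b * (n * m))"
    have eq: "reals s a i j = of_int z / of_int (Q\<^sup>2)" using z Q(1) by (simp add: eq_divide_eq)
    have Q2: "Q\<^sup>2 \<le> 2 ^ (2 * (b * (n * m)))"
      using power_mono[OF Q(2), of 2] Q(1) by (simp add: power_mult[symmetric] mult.commute)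
    have "real_of_int \<bar>z\<bar> = \<bar>reals s a i j\<bar> * of_int (Q\<^sup>2)"
      using z by (metis abs_mult abs_power2 of_int_abs of_int_power)
    also have "\<dots> \<le> (real (T + 1) * (4 * (2 ^ b)\<^sup>2)) * of_int (2 ^ (2 * (b * (n * m))))"
      using le Q2 by (intro mult_mono of_int_le_iff[THEN iffD2]) auto
    also have "\<dots> \<le> (2 ^ (T + 1) * (4 * (2 ^ b)\<^sup>2)) * 2 ^ (2 * (b * (n * m)))"
      using of_nat_less_two_power[of "T + 1", where 'a = real]
      by (simp only: of_int_power of_int_numeral) (intro mult_right_mono; simp)
    also have "\<dots> = 2 ^ ?e"
      by (simp add: power_add power_mult power2_eq_square mult.commute)
    finally have "real_of_int \<bar>z\<bar> \<le> of_int (2 ^ ?e)"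
      by (simp only: of_int_power of_int_numeral)
    then have zle: "\<bar>z\<bar> \<le> 2 ^ ?e"
      by (simp only: of_int_le_iff)
    have "b * (n * m) \<le> (n + m + b) * ((n + m + b) * (n + m + b))"
      by (intro mult_le_mono) auto
    moreover have "T \<le> poly p (n + m + b)" unfolding T_def by (rule poly_nat_mono) simp
    ultimately have "?e < poly q (n + m + b)"
      by (simp add: q power3_eq_cube mult.assoc)
    then have lt: "(2::int) ^ (T + 1 + 2 + 2 * b + 2 * (b * (n * m))) < 2 ^ poly q (n + m + b)"
      by (intro power_strict_increasing) auto
    have "(2::int) ^ (2 * (b * (n * m))) \<le> 2 ^ ?e"
      by (intro power_increasing) auto
    with Q2 lt have "Q\<^sup>2 < 2 ^ poly q (n + m + b)" by linarith
    moreover have "\<bar>z\<bar> < 2 ^ poly q (n + m + b)" using zle lt by linarith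
    moreover have "0 < Q\<^sup>2" using Q(1) by simp
    ultimately show ?thesis unfolding fraction_of_bits_def using eq by blast
  qed
  show ?thesis
    unfolding randomized_poly_time_def
  proof
    show "\<exists>p. \<forall>n E m x. halts_within P (encode n E m x) (poly p (n + m))"
      using halts by blast
    show "\<exists>q. \<forall>n E m x b. (\<forall>v<n. \<forall>i<m. fraction_of_bits b (x v i)) \<longrightarrow>
      (\<forall>t. \<forall>(cs, s) \<in> set_pmf (run t ([P], encode n E m x)).
         \<forall>a i j. fraction_of_bits (poly q (n + m + b)) (reals s a i j))"
      using bits by (intro exI[of _ q]) blast
  qed
qed

section \<open>The rounding algorithm\<close>

lemma writes_For [simp]: "writes (For a e c) = insert a (writes c)" "rwrites (For a e c) = rwrites c"
  and writes_Set [simp]: "writes (Set a e) = {a}" "rwrites (Set a e) = {}"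
  by (auto simp: For_def Set_def)

lemma frameD: "frame c s s' \<Longrightarrow> a \<notin> writes c \<Longrightarrow> nats s' a = nats s a"
  "frame c s s' \<Longrightarrow> a \<notin> rwrites c \<Longrightarrow> reals s' a = reals s a"
  by (auto simp: frame_def)

lemma upd_upd: "upd a i j y (upd a i j z M) = upd a i j y M"
  by (simp add: upd_def)

abbreviation Elt :: "nat \<Rightarrow> nexp \<Rightarrow> nexp" where
  "Elt a i \<equiv> NRead a i (NConst 0)"

abbreviation Proj :: "nexp \<Rightarrow> rexp" where
  "Proj i \<equiv> RRead 2 i (NConst 0)"

abbreviation Mark :: "nat \<Rightarrow> nexp \<Rightarrow> nexp \<Rightarrow> com" where
  "Mark a i e \<equiv> NWrite a i (NConst 0) e"

abbreviation Dim :: nexp where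
  "Dim \<equiv> NRead 0 (NConst 1) (NConst 0)"

text \<open>The language has no empty command; this one writes to a scratch array that no expression
  reads.\<close>

definition skip :: com where
  "skip = Set 7 (NConst 0)"

text \<open>
  Arrays of naturals: \<open>3\<close> coin tosses, \<open>4\<close> matched vertices, \<open>5\<close> centre set, \<open>6\<close> candidate cut;
  every scalar occupies an array of its own, so that frame conditions are about arrays only.  The
  scalars \<open>20\<close>, \<open>21\<close> are edge boundary and size of the candidate, \<open>22\<close>, \<open>23\<close> those of the best cut.
  Arrays of reals: \<open>1\<close> squared distances, \<open>2\<close> projections.
\<close>

definition distance_com :: com where
  "distance_com = Seq (RWrite 1 (Var 10) (Var 11) (ROfNat (NConst 0)))
     (For 12 Dim
       (RWrite 1 (Var 10) (Var 11) (RAdd (RRead 1 (Var 10) (Var 11))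
         (RMul (RSub (RRead 0 (Var 10) (Var 12)) (RRead 0 (Var 11) (Var 12)))
           (RSub (RRead 0 (Var 10) (Var 12)) (RRead 0 (Var 11) (Var 12)))))))"

definition distances :: com where
  "distances = For 10 (Var 0) (For 11 (Var 0) distance_com)"

definition level_test :: com where
  "level_test = Cond
     (BAnd (NLess (NConst 0) (Elt 5 (Var 11)))
       (BNot (RLess (RRead 1 (Var 16) (Var 17)) (RRead 1 (Var 10) (Var 11)))))
     (Mark 6 (Var 10) (NConst 1)) skip"

definition level_com :: com where
  "level_com = For 10 (Var 0) (Seq (Mark 6 (Var 10) (NConst 0))
     (For 11 (Var 0) level_test))"

text \<open>
  For bits, \<open>S u + adj u v - (1 + S v)\<close> (cut-off) indicates that \<open>u\<close> is in the set, \<open>v\<close> is not, and \<open>uv\<close> is an edge.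
\<close>

abbreviation count_edge :: com where
  "count_edge \<equiv> Set 20 (NAdd (Var 20)
     (NSub (NAdd (Elt 6 (Var 10)) (NRead 1 (Var 10) (Var 11))) (NAdd (NConst 1) (Elt 6 (Var 11)))))"

definition count_row :: com where
  "count_row = Seq (Set 21 (NAdd (Var 21) (Elt 6 (Var 10))))
     (For 11 (Var 0) count_edge)"

definition count_com :: com where
  "count_com = Seq (Set 20 (NConst 0)) (Seq (Set 21 (NConst 0)) (For 10 (Var 0) count_row))"

abbreviation flip_com :: com where
  "flip_com \<equiv> For 10 (Var 0) (Mark 6 (Var 10) (NSub (NConst 1) (Elt 6 (Var 10))))"

text \<open>Only sets of at most half of the vertices may be output. Passing to the complement
  leaves the boundary stored in \<open>20\<close> valid.\<close>

definition normalize_com :: com where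
  "normalize_com = Cond (NLess (Var 0) (NAdd (Var 21) (Var 21)))
     (Seq (Set 21 (NSub (Var 0) (Var 21)))
       flip_com)
     skip"

abbreviation copy_com :: com where
  "copy_com \<equiv> For 10 (Var 0) (Mark 2 (Var 10) (Elt 6 (Var 10)))"

text \<open>Ratios of boundary to size, compared by cross multiplication. The products are real
  because naturals cannot be multiplied, and they occur only inside a test.\<close>

abbreviation improves :: bexp where
  "improves \<equiv> RLess (RMul (ROfNat (Var 20)) (ROfNat (Var 23)))
     (RMul (ROfNat (Var 22)) (ROfNat (Var 21)))"

definition keep_best :: com where
  "keep_best = Cond improves
     (Seq (Set 22 (Var 20)) (Seq (Set 23 (Var 21))
       copy_com))
     skip"

definition try_cut :: com where
  "try_cut = Seq count_com (Seq normalize_com keep_best)"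

definition sweep :: com where
  "sweep = For 16 (Var 0) (For 17 (Var 0) (Seq level_com try_cut))"

definition centre :: com where
  "centre = Seq (For 10 (Var 0) (Mark 5 (Var 10) (NConst 0))) (Mark 5 (Var 13) (NConst 1))"

definition balls :: com where
  "balls = For 13 (Var 0) (Seq centre sweep)"

definition project_com :: com where
  "project_com = Seq (RWrite 2 (Var 10) (NConst 0) (ROfNat (NConst 0)))
     (For 12 Dim (Cond (NLess (NConst 0) (Elt 3 (Var 12)))
       (RWrite 2 (Var 10) (NConst 0) (RAdd (Proj (Var 10)) (RRead 0 (Var 10) (Var 12))))
       (RWrite 2 (Var 10) (NConst 0) (RSub (Proj (Var 10)) (RRead 0 (Var 10) (Var 12))))))"

definition project :: com where
  "project = For 10 (Var 0) project_com"

text \<open>The sum of two bits is below 1 if both endpoints are still free. The distance of the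
  pair in \<open>14\<close> and \<open>15\<close> plays the part of \<Delta>.\<close>

abbreviation match_guard :: bexp where
  "match_guard \<equiv> BAnd (NLess (NAdd (Elt 4 (Var 10)) (Elt 4 (Var 11))) (NConst 1))
     (BAnd (BNot (RLess (RSub (Proj (Var 11)) (Proj (Var 10))) (RDiv (ROfNat (NConst 1)) (ROfNat (NConst 4)))))
       (BNot (RLess (RRead 1 (Var 14) (Var 15)) (RRead 1 (Var 10) (Var 11)))))"

definition match_pair :: com where
  "match_pair = Cond
     match_guard
     (Seq (Mark 4 (Var 10) (NConst 1)) (Mark 4 (Var 11) (NConst 1)))
     skip"

definition match_com :: com where
  "match_com = Seq (For 10 (Var 0) (Mark 4 (Var 10) (NConst 0)))
     (For 10 (Var 0) (For 11 (Var 0) match_pair))"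

abbreviation halfspace_test :: com where
  "halfspace_test \<equiv> Cond
     (BAnd (NLess (Elt 4 (Var 10)) (NConst 1)) (BNot (RLess (Proj (Var 13)) (Proj (Var 10)))))
     (Mark 5 (Var 10) (NConst 1)) (Mark 5 (Var 10) (NConst 0))"

definition halfspace :: com where
  "halfspace = For 10 (Var 0) halfspace_test"

abbreviation halfspaces :: com where
  "halfspaces \<equiv> For 13 (Var 0) (Seq halfspace sweep)"

abbreviation threshold_row :: com where
  "threshold_row \<equiv> For 15 (Var 0) (Seq match_com halfspaces)"

definition round_com :: com where
  "round_com = Seq project (For 14 (Var 0) threshold_row)"

definition coins :: com where
  "coins = For 12 Dim (Coin 3 (Var 12) (NConst 0))"

text \<open>With addition as the only increasing operation on naturals, a constant factor is
  unfolded into a sum.\<close>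

primrec times :: "nat \<Rightarrow> nexp \<Rightarrow> nexp" where
  "times 0 e = NConst 0"
| "times (Suc k) e = NAdd e (times k e)"

lemma nval_times [simp]: "nval (times k e) s = k * nval e s"
  by (induction k) auto

text \<open>If no ball cut is good enough, a trial succeeds with probability at least
  \<open>1 / 32\<close>, so all \<open>32 * n\<close> fail with probability at most
  \<open>exp (- n)\<close>.\<close>

definition trials :: com where
  "trials = For 18 (times 32 (Var 0)) (Seq coins round_com)"

definition rounding :: com where
  "rounding = Seq distances (Seq (Set 22 (NConst 1)) (Seq balls trials))"

lemmas com_defs = skip_def distance_com_def distances_def level_test_def level_com_def count_row_def
  count_com_def normalize_com_def keep_best_def try_cut_def sweep_def centre_def balls_def project_com_def
  project_def match_pair_def match_com_def halfspace_def round_com_def coins_def trials_def rounding_def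

lemma writes_com [simp]:
  "writes skip = {7}" "writes distance_com = {12}" "writes distances = {10, 11, 12}"
  "writes level_test = {6, 7}" "writes level_com = {6, 7, 10, 11}"
  "writes count_row = {11, 20, 21}" "writes count_com = {10, 11, 20, 21}" "writes normalize_com = {6, 7, 10, 21}"
  "writes keep_best = {2, 7, 10, 22, 23}" "writes sweep = {2, 6, 7, 10, 11, 16, 17, 20, 21, 22, 23}"
  "writes try_cut = {2, 6, 7, 10, 11, 20, 21, 22, 23}" "writes centre = {5, 10}"
  "writes balls = {2, 5, 6, 7, 10, 11, 13, 16, 17, 20, 21, 22, 23}" "writes project_com = {12}"
  "writes project = {10, 12}" "writes match_pair = {4, 7}" "writes match_com = {4, 7, 10, 11}" "writes halfspace = {5, 10}"
  "writes round_com = {2, 4, 5, 6, 7, 10, 11, 12, 13, 14, 15, 16, 17, 20, 21, 22, 23}" "writes coins = {3, 12}"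
  by (auto simp: com_defs)

lemma rwrites_com [simp]:
  "rwrites skip = {}" "rwrites distance_com = {1}" "rwrites distances = {1}" "rwrites level_test = {}"
  "rwrites level_com = {}" "rwrites count_row = {}" "rwrites count_com = {}" "rwrites try_cut = {}"
  "rwrites centre = {}" "rwrites balls = {}" "rwrites project_com = {2}" "rwrites match_pair = {}" "rwrites round_com = {2}" "rwrites normalize_com = {}" "rwrites keep_best = {}" "rwrites sweep = {}"
  "rwrites project = {2}" "rwrites match_com = {}" "rwrites halfspace = {}" "rwrites coins = {}"
  by (auto simp: com_defs)

lemma accumulating_rounding: "accumulating rounding"
  by (simp add: com_defs For_def Set_def)

lemma terminates_rounding: "terminates n m (32 * (n + m)) rounding"
proof -
  have F: "terminates n m (32 * (n + m)) (For a (Var 0) c)"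
    if "terminates n m (32 * (n + m)) c" "a \<noteq> 0" "a \<notin> writes c" for a c
    using that by (intro terminates_For[where M = n]) auto
  have F': "terminates n m (32 * (n + m)) (For a Dim c)"
    if "terminates n m (32 * (n + m)) c" "a \<noteq> 0" "a \<notin> writes c" for a c
    using that by (intro terminates_For[where M = m]) auto
  have F'': "terminates n m (32 * (n + m)) (For a (times 32 (Var 0)) c)"
    if "terminates n m (32 * (n + m)) c" "a \<noteq> 0" "a \<notin> writes c" for a c
    using that by (intro terminates_For[where M = "32 * n"]) auto
  show ?thesis
    unfolding com_defs
    by (intro F F' F'' terminates_Seq terminates_Cond terminates_basic) auto
qed

lemma randomized_poly_time_rounding: "randomized_poly_time rounding"
  by (rule randomized_poly_timeI[OF accumulating_rounding terminates_rounding])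

section \<open>Correctness of the subprograms\<close>

locale rounding_input =
  fixes n m :: nat and E :: "(nat \<times> nat) set" and x :: "nat \<Rightarrow> nat \<Rightarrow> real" and N :: nat
  assumes N: "n \<le> N" "m \<le> N" and E: "E \<subseteq> {..<n} \<times> {..<n}" "sym E"
begin

abbreviation "d \<equiv> sqdist m x"

definition inp :: "store \<Rightarrow> bool" where
  "inp s \<longleftrightarrow> nats s 0 = nats (encode n E m x) 0 \<and> nats s 1 = nats (encode n E m x) 1 \<and>
     reals s 0 = reals (encode n E m x) 0"

definition dist :: "store \<Rightarrow> bool" where
  "dist s \<longleftrightarrow> inp s \<and> (\<forall>u<n. \<forall>v<n. reals s 1 u v = d u v)"

definition bits :: "store \<Rightarrow> nat \<Rightarrow> nat set \<Rightarrow> bool" where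
  "bits s a S \<longleftrightarrow> S \<subseteq> {..<n} \<and> (\<forall>v<n. nats s a v 0 = of_bool (v \<in> S))"

lemma inp_simps:
  assumes "inp s"
  shows "nats s 0 0 0 = n" "nats s 0 (Suc 0) 0 = m" "u < n \<Longrightarrow> v < n \<Longrightarrow> nats s 1 u v = of_bool ((u, v) \<in> E)"
    "v < n \<Longrightarrow> i < m \<Longrightarrow> reals s 0 v i = x v i"
  using assms by (auto simp: inp_def encode_def)

lemma inp_frame: "inp s \<Longrightarrow> frame c s s' \<Longrightarrow> 0 \<notin> writes c \<Longrightarrow> 1 \<notin> writes c \<Longrightarrow> 0 \<notin> rwrites c \<Longrightarrow> inp s'"
  by (auto simp: inp_def frame_def)

lemma dist_frame: "dist s \<Longrightarrow> frame c s s' \<Longrightarrow> 0 \<notin> writes c \<Longrightarrow> 1 \<notin> writes c \<Longrightarrow>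
    0 \<notin> rwrites c \<Longrightarrow> 1 \<notin> rwrites c \<Longrightarrow> dist s'"
  by (auto simp: inp_def dist_def frame_def)

lemma bits_frame: "bits s a S \<Longrightarrow> frame c s s' \<Longrightarrow> a \<notin> writes c \<Longrightarrow> bits s' a S"
  by (auto simp: bits_def frame_def)

text \<open>Shared by loops up to \<open>n\<close> and up to \<open>m\<close>. The invariant has to
  survive any change of the counter, so the body may establish it before the increment.\<close>

lemma wp_For_dim:
  assumes e: "e = Var 0 \<and> M = n \<or> e = Dim \<and> M = m" and s: "inp s"
    and w: "a \<noteq> 0" "a \<noteq> 1" "a \<notin> writes c" "0 \<notin> writes c" "1 \<notin> writes c" "0 \<notin> rwrites c"
    and put: "\<And>j y s'. I j s' \<Longrightarrow> I j (put a y s')" and init: "I 0 s"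
    and step: "\<And>j s'. j < M \<Longrightarrow> I j s' \<Longrightarrow> get s' a = j \<Longrightarrow> frame (For a e c) s s' \<Longrightarrow> inp s' \<Longrightarrow>
      wp N c (I (Suc j)) s'"
    and final: "\<And>s'. I M s' \<Longrightarrow> frame (For a e c) s s' \<Longrightarrow> inp s' \<Longrightarrow> Q s'"
  shows "wp N (For a e c) Q s"
proof -
  have inp: "inp s'" if "frame (For a e c) s s'" for s'
    using inp_frame[OF s that] w by simp
  show ?thesis
  proof (rule wp_For[where I = I and M = M])
    show "nval e s' = M" if "frame (For a e c) s s'" for s'
      using e inp_simps(1,2)[OF inp[OF that]] by auto
    show "M \<le> N" using e N by auto
    show "wp N c (\<lambda>s''. get s'' a = j \<and> I (Suc j) (put a (Suc j) s'')) s'"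
      if "j < M" "I j s'" "get s' a = j" "frame (For a e c) s s'" for j s'
      by (rule wp_conseq[OF step[OF that inp[OF that(4)]]]) (use put frameD(1)[OF _ w(3)] that(3) in auto)
  qed (use put init final inp in auto)
qed

lemmas wp_For_n = wp_For_dim[OF disjI1[OF conjI[OF refl refl]]]
lemmas wp_For_m = wp_For_dim[OF disjI2[OF conjI[OF refl refl]]]

text \<open>Round \<open>j\<close> touches entry \<open>j\<close> only, so this entry is still
  original when it is computed. This allows updates in place as in \<open>flip_com\<close>.\<close>

lemma wp_For_fill:
  assumes s: "inp s" and w: "a \<noteq> 0" "a \<noteq> 1" "a \<noteq> b" "a \<notin> writes c" "0 \<notin> writes c" "1 \<notin> writes c" "0 \<notin> rwrites c"
    and step: "\<And>j s'. j < n \<Longrightarrow> get s' a = j \<Longrightarrow> frame (For a (Var 0) c) s s' \<Longrightarrow> inp s' \<Longrightarrow>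
      nats s' b j 0 = nats s b j 0 \<Longrightarrow>
      wp N c (\<lambda>s''. nats s'' b j 0 = f j \<and> (\<forall>v. v \<noteq> j \<longrightarrow> nats s'' b v 0 = nats s' b v 0)) s'"
  shows "wp N (For a (Var 0) c) (\<lambda>s'. \<forall>v<n. nats s' b v 0 = f v) s"
proof (rule wp_For_n[where I = "\<lambda>j s'. \<forall>v<n. nats s' b v 0 = (if v < j then f v else nats s b v 0)", OF s])
  fix j s' assume j: "j < n" "get s' a = j" "frame (For a (Var 0) c) s s'" "inp s'"
    and I: "\<forall>v<n. nats s' b v 0 = (if v < j then f v else nats s b v 0)"
  show "wp N c (\<lambda>s'. \<forall>v<n. nats s' b v 0 = (if v < Suc j then f v else nats s b v 0)) s'"
    by (rule wp_conseq[OF step[OF j]]) (use I j(1) in \<open>auto simp: less_Suc_eq\<close>)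
qed (use w in auto)

lemma wp_For_Mark:
  assumes s: "inp s" and w: "a \<noteq> 0" "a \<noteq> 1" "a \<noteq> b" "b \<noteq> 0" "b \<noteq> 1"
    and val: "\<And>j s'. j < n \<Longrightarrow> get s' a = j \<Longrightarrow> frame (For a (Var 0) (Mark b (Var a) e)) s s' \<Longrightarrow>
      nats s' b j 0 = nats s b j 0 \<Longrightarrow> nval e s' = f j"
  shows "wp N (For a (Var 0) (Mark b (Var a) e)) (\<lambda>s'. \<forall>v<n. nats s' b v 0 = f v) s"
proof (rule wp_For_fill[OF s])
  fix j s' assume "j < n" "get s' a = j" "frame (For a (Var 0) (Mark b (Var a) e)) s s'" "nats s' b j 0 = nats s b j 0"
  from val[OF this] this(2)
  show "wp N (Mark b (Var a) e) (\<lambda>s''. nats s'' b j 0 = f j \<and> (\<forall>v. v \<noteq> j \<longrightarrow> nats s'' b v 0 = nats s' b v 0)) s'"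
    by (intro wp_NWrite) (auto simp: upd_def)
qed (use w in auto)

lemma wp_distance_com:
  assumes s: "inp s" and uv: "get s 10 = u" "get s 11 = v" "u < n" "v < n"
  shows "wp N distance_com (\<lambda>s'. reals s' = upd 1 u v (d u v) (reals s)) s"
proof -
  have i: "inp (s\<lparr>reals := upd 1 u v 0 (reals s)\<rparr>)" using s by (auto simp: inp_def upd_def)
  show ?thesis
    unfolding distance_com_def
  proof (rule wp_Seq, rule wp_RWrite, rule wp_For_m[where I = "\<lambda>l s'. get s' 10 = u \<and> get s' 11 = v \<and>
       reals s' = upd 1 u v (\<Sum>i<l. (x u i - x v i)\<^sup>2) (reals s)"]; (use i uv in \<open>simp add: sqdist_eq; fail\<close>)?)
    fix l s'
    assume l: "l < m" "get s' 12 = l" "inp s'" and I: "get s' 10 = u \<and> get s' 11 = v \<and>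
        reals s' = upd 1 u v (\<Sum>i<l. (x u i - x v i)\<^sup>2) (reals s)"
    have "reals s' 0 u l = x u l" "reals s' 0 v l = x v l" using inp_simps(4)[OF l(3)] uv l(1) by auto
    moreover have "reals s' 1 u v = (\<Sum>i<l. (x u i - x v i)\<^sup>2)" using I by (simp add: upd_def)
    ultimately show "wp N (RWrite 1 (Var 10) (Var 11) (RAdd (RRead 1 (Var 10) (Var 11))
        (RMul (RSub (RRead 0 (Var 10) (Var 12)) (RRead 0 (Var 11) (Var 12)))
          (RSub (RRead 0 (Var 10) (Var 12)) (RRead 0 (Var 11) (Var 12))))))
      (\<lambda>s'. get s' 10 = u \<and> get s' 11 = v \<and> reals s' = upd 1 u v (\<Sum>i<Suc l. (x u i - x v i)\<^sup>2) (reals s)) s'"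
      by (intro wp_RWrite) (use I l in \<open>simp add: upd_upd power2_eq_square\<close>)
  qed
qed

lemma wp_distances:
  assumes s: "inp s"
  shows "wp N distances dist s"
  unfolding distances_def
proof (rule wp_For_n[where I = "\<lambda>j s. \<forall>u<j. \<forall>v<n. reals s 1 u v = d u v", OF s]; (simp add: dist_def; fail)?)
  fix j s1 assume j: "j < n" "\<forall>u<j. \<forall>v<n. reals s1 1 u v = d u v" "get s1 10 = j" "inp s1"
  show "wp N (For 11 (Var 0) distance_com) (\<lambda>s. \<forall>u<Suc j. \<forall>v<n. reals s 1 u v = d u v) s1"
  proof (rule wp_For_n[where I = "\<lambda>k s. get s 10 = j \<and> (\<forall>u<j. \<forall>v<n. reals s 1 u v = d u v) \<and> (\<forall>v<k. reals s 1 j v = d j v)", OF j(4)];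
      (use j in \<open>auto simp: less_Suc_eq; fail\<close>)?)
    fix k s2 assume k: "k < n" "get s2 10 = j \<and> (\<forall>u<j. \<forall>v<n. reals s2 1 u v = d u v) \<and> (\<forall>v<k. reals s2 1 j v = d j v)"
      "get s2 11 = k" "inp s2"
    have "wp N distance_com (\<lambda>s'. reals s' = upd 1 j k (d j k) (reals s2)) s2"
      using k j(1) by (intro wp_distance_com) auto
    then show "wp N distance_com (\<lambda>s. get s 10 = j \<and> (\<forall>u<j. \<forall>v<n. reals s 1 u v = d u v) \<and> (\<forall>v<Suc k. reals s 1 j v = d j v)) s2"
      by (rule wp_conseq) (use k(2,3) in \<open>auto simp: upd_def less_Suc_eq dest: frameD(1)[where a = 10]\<close>)
  qed
qed

lemma wp_level_com:
  assumes s: "dist s" and A: "bits s 5 A" and ce: "get s 16 = c" "get s 17 = e" "c < n" "e < n"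
  shows "wp N level_com (\<lambda>s. bits s 6 (level n m x A (d c e))) s"
proof -
  define L where "L = level n m x A (d c e)"
  have i: "inp s" using s by (simp add: dist_def)
  have "wp N level_com (\<lambda>s'. \<forall>v<n. nats s' 6 v 0 = of_bool (v \<in> L)) s"
    unfolding level_com_def
  proof (rule wp_For_fill[OF i]; (simp; fail)?)
    fix j s1 assume j: "j < n" "get s1 10 = j" "inp s1"
      and f: "frame (For 10 (Var 0) (Seq (Mark 6 (Var 10) (NConst 0)) (For 11 (Var 0) level_test))) s s1"
    define s2 where "s2 = s1\<lparr>nats := upd 6 j 0 0 (nats s1)\<rparr>"
    have i2: "inp s2" using j(3) by (auto simp: s2_def inp_def upd_def)
    have f2: "nats s2 5 = nats s 5" "nats s2 16 = nats s 16" "nats s2 17 = nats s 17" "reals s2 = reals s"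
      using frameD[OF f] by (auto simp: s2_def upd_def)
    let ?I = "\<lambda>l s'. get s' 10 = j \<and> nats s' 6 j 0 = of_bool (\<exists>a<l. a \<in> A \<and> d j a \<le> d c e) \<and>
      (\<forall>v. v \<noteq> j \<longrightarrow> nats s' 6 v 0 = nats s1 6 v 0)"
    have "wp N (For 11 (Var 0) level_test) (?I n) s2"
    proof (rule wp_For_n[where I = ?I, OF i2]; (use j in \<open>simp add: s2_def upd_def; fail\<close>)?)
      fix l s3 assume l: "l < n" "?I l s3" "get s3 11 = l" and f3: "frame (For 11 (Var 0) level_test) s2 s3"
      have "nats s3 5 l 0 = of_bool (l \<in> A)" "get s3 16 = c" "get s3 17 = e"
          "reals s3 1 c e = d c e" "reals s3 1 j l = d j l"
        using frameD[OF f3] f2 A ce s l(1) j(1) by (auto simp: bits_def dist_def)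
      then show "wp N level_test (?I (Suc l)) s3"
        unfolding level_test_def skip_def
        by (intro wp_Cond wp_NWrite wp_Set) (use l in \<open>auto simp: upd_def less_Suc_eq\<close>)
    qed
    moreover have "(\<exists>a<n. a \<in> A \<and> d j a \<le> d c e) \<longleftrightarrow> j \<in> L"
      using A j(1) by (auto simp: L_def level_def bits_def)
    ultimately show "wp N (Seq (Mark 6 (Var 10) (NConst 0)) (For 11 (Var 0) level_test))
       (\<lambda>s''. nats s'' 6 j 0 = of_bool (j \<in> L) \<and> (\<forall>v. v \<noteq> j \<longrightarrow> nats s'' 6 v 0 = nats s1 6 v 0)) s1"
      using j(2) by (intro wp_Seq wp_NWrite) (auto simp: s2_def elim: wp_conseq)
  qed
  then show ?thesis by (rule wp_conseq) (auto simp: bits_def L_def level_def)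
qed

end

context rounding_input
begin

lemma wp_count_row:
  assumes s: "inp s" and S: "bits s 6 S" and u: "get s 10 = u" "u < n"
  shows "wp N count_row (\<lambda>s'. get s' 21 = get s 21 + of_bool (u \<in> S) \<and>
    get s' 20 = get s 20 + (\<Sum>v<n. of_bool (u \<in> S \<and> v \<notin> S \<and> (u, v) \<in> E))) s"
proof -
  define s1 where "s1 = put 21 (get s 21 + of_bool (u \<in> S)) s"
  have i1: "inp s1" using s by (auto simp: s1_def put_def inp_def upd_def)
  let ?I = "\<lambda>l s'. get s' 21 = get s 21 + of_bool (u \<in> S) \<and>
    get s' 20 = get s 20 + (\<Sum>v<l. of_bool (u \<in> S \<and> v \<notin> S \<and> (u, v) \<in> E))"
  have "wp N (For 11 (Var 0) count_edge) (?I n) s1"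
  proof (rule wp_For_n[where I = ?I, OF i1]; (simp add: s1_def; fail)?)
    fix l s2 assume l: "l < n" "?I l s2" "get s2 11 = l" "inp s2" and f: "frame (For 11 (Var 0) count_edge) s1 s2"
    have "get s2 10 = u" "nats s2 6 u 0 = of_bool (u \<in> S)" "nats s2 6 l 0 = of_bool (l \<in> S)"
        "nats s2 1 u l = of_bool ((u, l) \<in> E)"
      using frameD(1)[OF f] S u l(1) inp_simps(3)[OF l(4)] by (auto simp: s1_def bits_def)
    then show "wp N count_edge (?I (Suc l)) s2" using l by (intro wp_Set) auto
  qed
  then show ?thesis
    unfolding count_row_def using S u by (intro wp_Seq wp_Set) (simp add: s1_def bits_def)
qed

lemma wp_count_com:
  assumes s: "inp s" and S: "bits s 6 S"
  shows "wp N count_com (\<lambda>s'. get s' 21 = card S \<and> get s' 20 = cutsize n E S) s"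
proof -
  define s1 where "s1 = put 21 0 (put 20 0 s)"
  have i1: "inp s1" using s by (auto simp: s1_def put_def inp_def upd_def)
  have S1: "bits s1 6 S" using S by (simp add: s1_def bits_def)
  have Sn: "S \<subseteq> {..<n}" using S by (simp add: bits_def)
  have card: "card S = (\<Sum>u<n. of_bool (u \<in> S))"
    using Sn by (simp add: of_bool_def sum.If_cases Int_absorb1)
  have cut: "cutsize n E S = (\<Sum>u<n. \<Sum>v<n. of_bool (u \<in> S \<and> v \<notin> S \<and> (u, v) \<in> E))"
  proof -
    have "edges_between E S ({..<n} - S) = {e \<in> {..<n} \<times> {..<n}. fst e \<in> S \<and> snd e \<notin> S \<and> e \<in> E}"
      using Sn by (auto simp: edges_between_def)
    then have "cutsize n E S = (\<Sum>e \<in> {..<n} \<times> {..<n}. of_bool (fst e \<in> S \<and> snd e \<notin> S \<and> e \<in> E))"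
      by (simp add: cutsize_def of_bool_def sum.If_cases Int_def)
    then show ?thesis by (simp add: sum.cartesian_product' )
  qed
  let ?I = "\<lambda>l s'. get s' 21 = (\<Sum>u<l. of_bool (u \<in> S)) \<and>
      get s' 20 = (\<Sum>u<l. \<Sum>v<n. of_bool (u \<in> S \<and> v \<notin> S \<and> (u, v) \<in> E))"
  have "wp N (For 10 (Var 0) count_row) (?I n) s1"
  proof (rule wp_For_n[where I = ?I, OF i1]; (simp add: s1_def; fail)?)
    fix l s2 assume l: "l < n" "?I l s2" "get s2 10 = l" "inp s2" and f: "frame (For 10 (Var 0) count_row) s1 s2"
    have "bits s2 6 S" using bits_frame[OF S1 f] by simp
    from wp_count_row[OF l(4) this l(3,1)] show "wp N count_row (?I (Suc l)) s2"
      by (rule wp_conseq) (use l(2) in auto)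
  qed
  then show ?thesis
    unfolding count_com_def by (intro wp_Seq wp_Set) (simp add: s1_def card cut)
qed

text \<open>A set and its complement separate the same ordered pairs, and
  \<open>sum_separated_edges\<close> counts these.\<close>

lemma cutsize_complement:
  assumes "S \<subseteq> {..<n}"
  shows "cutsize n E ({..<n} - S) = cutsize n E S"
proof -
  have "2 * real (cutsize n E ({..<n} - S)) = 2 * real (cutsize n E S)"
    using assms E(1) unfolding sum_separated_edges[OF E assms, symmetric]
    by (subst sum_separated_edges[OF E, symmetric]) (auto intro!: sum.cong)
  then show ?thesis by simp
qed

lemma wp_normalize_com:
  assumes s: "inp s" and S: "bits s 6 S" and z: "get s 21 = card S"
  shows "wp N normalize_com (\<lambda>s'. \<exists>S'. bits s' 6 S' \<and> cutsize n E S' = cutsize n E S \<and> 2 * card S' \<le> n \<and>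
    card S' = min (card S) (n - card S) \<and> get s' 21 = card S') s" (is "wp N _ ?Q s")
  unfolding normalize_com_def
proof (rule wp_Cond)
  have Sn: "S \<subseteq> {..<n}" using S by (simp add: bits_def)
  define C where "C = {..<n} - S"
  have cC: "card C = n - card S"
    using Sn finite_subset[OF Sn] by (simp add: C_def card_Diff_subset)
  assume "bval (NLess (Var 0) (NAdd (Var 21) (Var 21))) s"
  then have lt: "n < 2 * card S" using inp_simps(1)[OF s] z by simp
  define s1 where "s1 = put 21 (n - card S) s"
  have i1: "inp s1" using s by (auto simp: s1_def put_def inp_def upd_def)
  have "wp N flip_com (\<lambda>s'. \<forall>v<n. nats s' 6 v 0 = of_bool (v \<in> C)) s1"
    by (rule wp_For_Mark[OF i1]) (use S in \<open>auto simp: s1_def bits_def C_def\<close>)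
  then have "wp N flip_com ?Q s1"
  proof (rule wp_conseq)
    fix s' assume f: "frame flip_com s1 s'" and "\<forall>v<n. nats s' 6 v 0 = of_bool (v \<in> C)"
    then have "bits s' 6 C" by (auto simp: bits_def C_def)
    then show "?Q s'" using lt cutsize_complement[OF Sn] frameD(1)[OF f, of 21]
      by (intro exI[of _ C]) (auto simp: cC C_def[symmetric] s1_def)
  qed
  then show "wp N (Seq (Set 21 (NSub (Var 0) (Var 21))) flip_com) ?Q s"
    using inp_simps(1)[OF s] z by (intro wp_Seq wp_Set) (simp add: s1_def)
next
  assume "\<not> bval (NLess (Var 0) (NAdd (Var 21) (Var 21))) s"
  then have "2 * card S \<le> n" using inp_simps(1)[OF s] z by simp
  then show "wp N skip ?Q s"
    unfolding skip_def using S z by (intro wp_Set exI[of _ S]) (auto simp: bits_def)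
qed

text \<open>The pair \<open>1\<close>, \<open>0\<close> is the initial value: a ratio that is worse than that of every cut.\<close>

definition best :: "store \<Rightarrow> bool" where
  "best s \<longleftrightarrow> get s 22 = 1 \<and> get s 23 = 0 \<or>
     (\<exists>S. bits s 2 S \<and> S \<noteq> {} \<and> 2 * card S \<le> n \<and> get s 22 = cutsize n E S \<and> get s 23 = card S)"

text \<open>The bound \<open>K\<close> belongs to the analysis and is unknown to the program, which
  minimises the ratio and so meets every bound that some candidate meets.\<close>

definition accepts :: "real \<Rightarrow> store \<Rightarrow> bool" where
  "accepts K s \<longleftrightarrow> 0 < get s 23 \<and> real (get s 22) \<le> K * real (get s 23)"

lemma best_frame: "best s \<Longrightarrow> frame c s s' \<Longrightarrow> {2, 22, 23} \<inter> writes c = {} \<Longrightarrow> best s'"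
  by (auto simp: best_def bits_def frame_def)

lemma accepts_frame: "frame c s s' \<Longrightarrow> {22, 23} \<inter> writes c = {} \<Longrightarrow> accepts K s' = accepts K s"
  by (auto simp: accepts_def frame_def)

lemma best_put [simp]: "a \<notin> {2, 22, 23} \<Longrightarrow> best (put a y s) = best s"
  by (auto simp: best_def bits_def)

lemma accepts_put [simp]: "a \<notin> {22, 23} \<Longrightarrow> accepts K (put a y s) = accepts K s"
  by (auto simp: accepts_def)

abbreviation improved :: "real \<Rightarrow> store \<Rightarrow> bool \<Rightarrow> store \<Rightarrow> bool" where
  "improved K s R s' \<equiv> best s' \<and> (accepts K s \<or> R \<longrightarrow> accepts K s')"

lemma wp_keep_best:
  assumes s: "inp s" and b: "best s" and S: "bits s 6 S" "2 * card S \<le> n"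
    and e: "get s 20 = cutsize n E S" and z: "get s 21 = card S"
  shows "wp N keep_best (improved K s (0 < card S \<and> real (cutsize n E S) \<le> K * real (card S))) s" (is "wp N _ ?Q s")
  unfolding keep_best_def
proof (rule wp_Cond)
  assume "bval improves s"
  then have lt: "real (cutsize n E S) * real (get s 23) < real (get s 22) * real (card S)"
    using e z by simp
  have "0 \<le> real (cutsize n E S) * real (get s 23)" by simp
  \<comment> \<open>An empty candidate makes the right-hand product 0 and can never win.\<close>
  with lt have pos: "0 < card S" by (cases "card S = 0") auto
  define s1 where "s1 = put 23 (card S) (put 22 (cutsize n E S) s)"
  have i1: "inp s1" using s by (auto simp: s1_def put_def inp_def upd_def)
  have acc: "accepts K s1" if "accepts K s \<or> 0 < card S \<and> real (cutsize n E S) \<le> K * real (card S)"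
    using that
  proof
    assume a: "accepts K s"
    have "real (cutsize n E S) * real (get s 23) < (K * real (get s 23)) * real (card S)"
      using lt a by (intro less_le_trans[OF lt] mult_right_mono) (auto simp: accepts_def)
    then have "real (get s 23) * real (cutsize n E S) < real (get s 23) * (K * real (card S))"
      by (simp add: algebra_simps)
    then show ?thesis using pos by (simp add: accepts_def s1_def mult_less_cancel_left)
  qed (simp add: accepts_def s1_def)
  have "wp N copy_com (\<lambda>s'. \<forall>v<n. nats s' 2 v 0 = of_bool (v \<in> S)) s1"
  proof (rule wp_For_Mark[OF i1]; (simp; fail)?)
    fix j s' assume j: "j < n" "get s' 10 = j" and f: "frame copy_com s1 s'"
    show "nval (Elt 6 (Var 10)) s' = of_bool (j \<in> S)"
      using frameD(1)[OF f, of 6] S(1) j by (auto simp: s1_def bits_def)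
  qed
  then have "wp N copy_com ?Q s1"
  proof (rule wp_conseq)
    fix s' assume f: "frame copy_com s1 s'" and "\<forall>v<n. nats s' 2 v 0 = of_bool (v \<in> S)"
    then have "bits s' 2 S" using S(1) by (simp add: bits_def)
    then have "best s'"
      unfolding best_def using S(2) pos frameD(1)[OF f, of 22] frameD(1)[OF f, of 23]
      by (intro disjI2 exI[of _ S]) (auto simp: s1_def)
    moreover have "accepts K s' = accepts K s1" using accepts_frame[OF f] by simp
    ultimately show "?Q s'" using acc by simp
  qed
  then show "wp N (Seq (Set 22 (Var 20)) (Seq (Set 23 (Var 21)) copy_com)) ?Q s"
    using e z by (intro wp_Seq wp_Set) (simp add: s1_def)
next
  assume "\<not> bval improves s"
  then have ge: "real (get s 22) * real (card S) \<le> real (cutsize n E S) * real (get s 23)"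
    using e z by simp
  have "accepts K s" if "0 < card S \<and> real (cutsize n E S) \<le> K * real (card S)"
  proof -
    \<comment> \<open>The initial pair loses to every nonempty candidate, so a rejected one shows
      that a genuine set is already stored.\<close>
    have "get s 23 \<noteq> 0"
    proof
      assume "get s 23 = 0"
      then have "get s 22 = 1" using b that by (auto simp: best_def bits_def dest: finite_subset)
      then show False using ge that \<open>get s 23 = 0\<close> by simp
    qed
    note ge
    also have "real (cutsize n E S) * real (get s 23) \<le> (K * real (card S)) * real (get s 23)"
      using that by (intro mult_right_mono) auto
    also have "\<dots> = (K * real (get s 23)) * real (card S)" by simp
    finally have "real (get s 22) \<le> K * real (get s 23)"
      using that by (simp only: mult_le_cancel_right of_nat_0_less_iff)
    with \<open>get s 23 \<noteq> 0\<close> show ?thesis by (simp add: accepts_def)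
  qed
  then show "wp N skip ?Q s" unfolding skip_def using b by (intro wp_Set) auto
qed

lemma wp_try_cut:
  assumes s: "inp s" and b: "best s" and S: "bits s 6 S"
  shows "wp N try_cut (improved K s (small_cut n E K S)) s"
  unfolding try_cut_def
proof (rule wp_Seq, rule wp_conseq[OF wp_count_com[OF s S]], rule wp_Seq)
  fix s1 assume f1: "frame count_com s s1" and v1: "get s1 21 = card S \<and> get s1 20 = cutsize n E S"
  have i1: "inp s1" using inp_frame[OF s f1] by simp
  have S1: "bits s1 6 S" using bits_frame[OF S f1] by simp
  show "wp N normalize_com (wp N keep_best (improved K s (small_cut n E K S))) s1"
  proof (rule wp_conseq[OF wp_normalize_com[OF i1 S1]])
    show "get s1 21 = card S" using v1 by simp
    fix s2 assume f2: "frame normalize_com s1 s2"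
      and "\<exists>S'. bits s2 6 S' \<and> cutsize n E S' = cutsize n E S \<and> 2 * card S' \<le> n \<and>
        card S' = min (card S) (n - card S) \<and> get s2 21 = card S'"
    then obtain S' where S': "bits s2 6 S'" "cutsize n E S' = cutsize n E S" "2 * card S' \<le> n"
        "card S' = min (card S) (n - card S)" "get s2 21 = card S'" by blast
    have i2: "inp s2" using inp_frame[OF i1 f2] by simp
    have b2: "best s2" using best_frame[OF best_frame[OF b f1] f2] by simp
    have a2: "accepts K s2 = accepts K s" using accepts_frame[OF f1] accepts_frame[OF f2] by simp
    have e2: "get s2 20 = cutsize n E S'" using frameD(1)[OF f2, of 20] v1 S'(2) by simp
    have "0 < card S' \<and> real (cutsize n E S') \<le> K * real (card S')" if "small_cut n E K S"
    proof -
      have "S \<subset> {..<n}" "S \<noteq> {}" using that by (auto simp: small_cut_def)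
      then have "0 < card S" "card S < n"
        using psubset_card_mono[of "{..<n}" S] finite_subset[of S "{..<n}"] by (auto simp: card_gt_0_iff)
      then show ?thesis using that S'(2,4) by (auto simp: small_cut_def)
    qed
    then show "wp N keep_best (improved K s (small_cut n E K S)) s2"
      using wp_keep_best[OF i2 b2 S'(1,3) e2 S'(5), of K] a2 by (elim wp_conseq) auto
  qed
qed

text \<open>Common form of the search loops: acceptance is never lost, and one favourable round
  suffices. Nesting this rule produces the existential quantifiers of \<open>level_cut\<close> and
  \<open>cut_row\<close>.\<close>

lemma wp_For_search:
  assumes s: "dist s" "best s" and a: "a \<notin> {0, 1, 2, 22, 23}"
    and w: "a \<notin> writes c" "0 \<notin> writes c" "1 \<notin> writes c" "0 \<notin> rwrites c" "1 \<notin> rwrites c"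
    and step: "\<And>j s'. j < n \<Longrightarrow> get s' a = j \<Longrightarrow> frame (For a (Var 0) c) s s' \<Longrightarrow> dist s' \<Longrightarrow> best s' \<Longrightarrow>
      wp N c (\<lambda>s''. best s'' \<and> (accepts K s' \<or> R j \<longrightarrow> accepts K s'')) s'"
  shows "wp N (For a (Var 0) c) (improved K s (\<exists>j<n. R j)) s"
proof -
  have i: "inp s" using s by (simp add: dist_def)
  let ?I = "\<lambda>j s'. best s' \<and> (accepts K s \<or> (\<exists>i<j. R i) \<longrightarrow> accepts K s')"
  show ?thesis
  proof (rule wp_For_n[where I = ?I, OF i])
    fix j s' assume j: "j < n" "?I j s'" "get s' a = j" and f: "frame (For a (Var 0) c) s s'"
    have d: "dist s'" using dist_frame[OF s(1) f] a w by simp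
    show "wp N c (?I (Suc j)) s'"
      by (rule wp_conseq[OF step[OF j(1,3) f d]]) (use j(2) in \<open>auto simp: less_Suc_eq\<close>)
  qed (use a w s in auto)
qed

lemma wp_sweep:
  assumes s: "dist s" and b: "best s" and A: "bits s 5 A"
  shows "wp N sweep (improved K s (level_cut n m E x K A)) s"
  unfolding sweep_def
proof (rule wp_For_search[OF s b]; (simp; fail)?)
  fix j s1 assume j: "j < n" "get s1 16 = j" "dist s1" "best s1"
    and f1: "frame (For 16 (Var 0) (For 17 (Var 0) (Seq level_com try_cut))) s s1"
  show "wp N (For 17 (Var 0) (Seq level_com try_cut)) (improved K s1 (\<exists>e<n. small_cut n E K (level n m x A (d j e)))) s1"
  proof (rule wp_For_search[OF j(3,4)]; (simp; fail)?)
    fix k s2 assume k: "k < n" "get s2 17 = k" "dist s2" "best s2"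
      and f2: "frame (For 17 (Var 0) (Seq level_com try_cut)) s1 s2"
    have A2: "bits s2 5 A" using bits_frame[OF bits_frame[OF A f1] f2] by simp
    have g2: "get s2 16 = j" using frameD(1)[OF f2, of 16] j(2) by simp
    show "wp N (Seq level_com try_cut)
      (improved K s2 (small_cut n E K (level n m x A (d j k)))) s2"
    proof (rule wp_Seq, rule wp_conseq[OF wp_level_com[OF k(3) A2 g2 k(2) j(1) k(1)]])
      fix s3 assume f3: "frame level_com s2 s3" and L: "bits s3 6 (level n m x A (d j k))"
      have i3: "inp s3" using dist_frame[OF k(3) f3] by (simp add: dist_def)
      have b3: "best s3" using best_frame[OF k(4) f3] by simp
      have a3: "accepts K s3 = accepts K s2" using accepts_frame[OF f3] by simp
      from wp_try_cut[OF i3 b3 L, of K] show "wp N try_cut (improved K s2 (small_cut n E K (level n m x A (d j k)))) s3"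
        unfolding a3 .
    qed
  qed
qed

lemma wp_centre:
  assumes s: "inp s" and w: "get s 13 = w" "w < n"
  shows "wp N centre (\<lambda>s'. bits s' 5 {w}) s"
  unfolding centre_def
proof (rule wp_Seq, rule wp_conseq)
  show "wp N (For 10 (Var 0) (Mark 5 (Var 10) (NConst 0))) (\<lambda>s'. \<forall>v<n. nats s' 5 v 0 = 0) s"
    by (rule wp_For_Mark[OF s]) auto
  fix s1 assume z: "\<forall>v<n. nats s1 5 v 0 = 0" and f: "frame (For 10 (Var 0) (Mark 5 (Var 10) (NConst 0))) s s1"
  have "get s1 13 = w" using frameD(1)[OF f, of 13] w(1) by simp
  then show "wp N (Mark 5 (Var 13) (NConst 1)) (\<lambda>s'. bits s' 5 {w}) s1"
    using z w(2) by (intro wp_NWrite) (auto simp: bits_def upd_def)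
qed

lemma wp_balls:
  assumes s: "dist s" and b: "best s"
  shows "wp N balls (improved K s (\<exists>w<n. level_cut n m E x K {w})) s"
  unfolding balls_def
proof (rule wp_For_search[OF s b]; (simp; fail)?)
  fix j s1 assume j: "j < n" "get s1 13 = j" "dist s1" "best s1"
  have i1: "inp s1" using j(3) by (simp add: dist_def)
  show "wp N (Seq centre sweep)
    (improved K s1 (level_cut n m E x K {j})) s1"
  proof (rule wp_Seq, rule wp_conseq[OF wp_centre[OF i1 j(2,1)]])
    fix s2 assume f2: "frame centre s1 s2" and A: "bits s2 5 {j}"
    have d2: "dist s2" using dist_frame[OF j(3) f2] by simp
    have b2: "best s2" using best_frame[OF j(4) f2] by simp
    have a2: "accepts K s2 = accepts K s1" using accepts_frame[OF f2] by simp
    from wp_sweep[OF d2 b2 A, of K] show "wp N sweep (improved K s1 (level_cut n m E x K {j})) s2"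
      unfolding a2 .
  qed
qed

text \<open>Coordinates from \<open>l\<close> on are 0, as in the base case of \<open>avg\<close>,
  so that tossing coin \<open>l\<close> is exactly the update made by
  \<open>tail_avg\<close>.\<close>

definition signs_of :: "nat \<Rightarrow> store \<Rightarrow> nat \<Rightarrow> real" where
  "signs_of l s = (\<lambda>i. if i < l then (if nats s 3 i 0 = 0 then - 1 else 1) else 0)"

lemma wp_project_com:
  assumes s: "inp s" and u: "get s 10 = u" "u < n"
  shows "wp N project_com (\<lambda>s'. reals s' = upd 2 u 0 (ip m (signs_of m s) (x u)) (reals s)) s"
proof -
  define g where "g = signs_of m s"
  have i: "inp (s\<lparr>reals := upd 2 u 0 0 (reals s)\<rparr>)" using s by (auto simp: inp_def upd_def)
  show ?thesis
    unfolding project_com_def g_def[symmetric]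
  proof (rule wp_Seq, rule wp_RWrite, rule wp_For_m[where I = "\<lambda>l s'. get s' 10 = u \<and> nats s' 3 = nats s 3 \<and>
       reals s' = upd 2 u 0 (\<Sum>i<l. g i * x u i) (reals s)"]; (use i u in \<open>auto simp: ip_def put_def upd_def; fail\<close>)?)
    fix l s'
    assume l: "l < m" "get s' 12 = l" "inp s'" and I: "get s' 10 = u \<and> nats s' 3 = nats s 3 \<and>
      reals s' = upd 2 u 0 (\<Sum>i<l. g i * x u i) (reals s)"
    have "reals s' 0 u l = x u l" using inp_simps(4)[OF l(3)] u l(1) by auto
    moreover have "reals s' 2 u 0 = (\<Sum>i<l. g i * x u i)" using I by (simp add: upd_def)
    moreover have "g l = (if nats s 3 l 0 = 0 then - 1 else 1)" using l(1) by (simp add: g_def signs_of_def)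
    ultimately show "wp N (Cond (NLess (NConst 0) (Elt 3 (Var 12)))
        (RWrite 2 (Var 10) (NConst 0) (RAdd (Proj (Var 10)) (RRead 0 (Var 10) (Var 12))))
        (RWrite 2 (Var 10) (NConst 0) (RSub (Proj (Var 10)) (RRead 0 (Var 10) (Var 12)))))
      (\<lambda>s'. get s' 10 = u \<and> nats s' 3 = nats s 3 \<and> reals s' = upd 2 u 0 (\<Sum>i<Suc l. g i * x u i) (reals s)) s'"
      by (intro wp_Cond wp_RWrite) (use I l in \<open>simp_all add: upd_upd\<close>)
  qed
qed

definition projected :: "(nat \<Rightarrow> real) \<Rightarrow> store \<Rightarrow> bool" where
  "projected g s \<longleftrightarrow> (\<forall>u<n. reals s 2 u 0 = ip m g (x u))"

lemma wp_project:
  assumes s: "inp s"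
  shows "wp N project (projected (signs_of m s)) s"
  unfolding project_def
proof (rule wp_For_n[where I = "\<lambda>j s'. \<forall>u<j. reals s' 2 u 0 = ip m (signs_of m s) (x u)", OF s];
    (simp add: projected_def; fail)?)
  fix j s1 assume j: "j < n" "\<forall>u<j. reals s1 2 u 0 = ip m (signs_of m s) (x u)" "get s1 10 = j" "inp s1"
    and f: "frame (For 10 (Var 0) project_com) s s1"
  have sg: "signs_of m s1 = signs_of m s" using frameD(1)[OF f, of 3] by (auto simp: signs_of_def)
  show "wp N project_com (\<lambda>s'. \<forall>u<Suc j. reals s' 2 u 0 = ip m (signs_of m s) (x u)) s1"
    by (rule wp_conseq[OF wp_project_com[OF j(4,3,1)]]) (use j(2) in \<open>auto simp: sg upd_def less_Suc_eq\<close>)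
qed

end

section \<open>Coin tosses as conditional averages, and the randomised trials\<close>

lemma wins_det: "step c = return_pmf c' \<Longrightarrow> wins t c' G p \<Longrightarrow> wins (Suc t) c G p"
  by (rule wins_step) simp

text \<open>\<open>avg\<close> fixes the last coordinate first, but the program tosses the first
  coin first. Here the coordinates below \<open>i\<close> are given and the \<open>k\<close> from
  \<open>i\<close> on are averaged.\<close>

primrec tail_avg :: "nat \<Rightarrow> nat \<Rightarrow> ((nat \<Rightarrow> real) \<Rightarrow> real) \<Rightarrow> (nat \<Rightarrow> real) \<Rightarrow> real" where
  "tail_avg 0 i f g = f g"
| "tail_avg (Suc k) i f g = (tail_avg k (Suc i) f (g(i := 1)) + tail_avg k (Suc i) f (g(i := - 1))) / 2"

lemma avg_split: "avg (k + i) f = avg i (tail_avg k i f)"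
proof (induction k arbitrary: i)
  case (Suc k)
  have "avg (Suc k + i) f = avg (Suc i) (tail_avg k (Suc i) f)"
    using Suc.IH[of "Suc i"] by simp
  then show ?case by (simp add: avg_add avg_divide)
qed (simp add: tail_avg.simps(1)[abs_def])

lemma tail_avg_nonneg: "(\<And>g. 0 \<le> f g) \<Longrightarrow> 0 \<le> tail_avg k i f g"
  by (induction k arbitrary: i g) auto

context rounding_input
begin

text \<open>The conclusion of \<open>good_cut\<close>. All maximal matchings are quantified over
  because the one found depends on the scanning order.\<close>

definition cut_row :: "real \<Rightarrow> (nat \<Rightarrow> real) \<Rightarrow> bool" where
  "cut_row K g \<longleftrightarrow> (\<exists>a<n. \<exists>b<n. \<forall>M. maximal_matching (stretched n m x (d a b) g) M \<longrightarrow>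
    (\<exists>w<n. level_cut n m E x K (below n m x g (ends M) w)))"

lemma projected_frame: "projected g s \<Longrightarrow> frame c s s' \<Longrightarrow> 2 \<notin> rwrites c \<Longrightarrow> projected g s'"
  by (auto simp: projected_def frame_def)

lemma wp_halfspace:
  assumes s: "inp s" and Z: "bits s 4 Z" and p: "projected g s" and w: "get s 13 = w" "w < n"
  shows "wp N halfspace (\<lambda>s'. bits s' 5 (below n m x g Z w)) s"
proof -
  have "wp N halfspace (\<lambda>s'. \<forall>v<n. nats s' 5 v 0 = of_bool (v \<notin> Z \<and> ip m g (x v) \<le> ip m g (x w))) s"
    unfolding halfspace_def
  proof (rule wp_For_fill[OF s]; (simp; fail)?)
    fix l s1 assume l: "l < n" "get s1 10 = l" and f: "frame (For 10 (Var 0) halfspace_test) s s1"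
    have "nats s1 4 l 0 = of_bool (l \<in> Z)" "get s1 13 = w"
        "reals s1 2 l 0 = ip m g (x l)" "reals s1 2 w 0 = ip m g (x w)"
      using frameD[OF f] Z p w l(1) by (auto simp: bits_def projected_def)
    then show "wp N halfspace_test (\<lambda>s''. nats s'' 5 l 0 = of_bool (l \<notin> Z \<and> ip m g (x l) \<le> ip m g (x w)) \<and>
        (\<forall>v. v \<noteq> l \<longrightarrow> nats s'' 5 v 0 = nats s1 5 v 0)) s1"
      using l by (intro wp_Cond wp_NWrite) (auto simp: upd_def)
  qed
  then show ?thesis by (rule wp_conseq) (auto simp: bits_def)
qed

text \<open>Invariant of the greedy scan, with \<open>R\<close> the pairs already visited. The
  program stores only the endpoints, so the matching itself is existentially quantified.\<close>

definition matched :: "(nat \<times> nat) set \<Rightarrow> (nat \<Rightarrow> nat \<Rightarrow> bool) \<Rightarrow> store \<Rightarrow> bool" where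
  "matched St R s \<longleftrightarrow> (\<exists>M \<subseteq> St. matching M \<and> bits s 4 (ends M) \<and>
     (\<forall>(u, v) \<in> St. R u v \<longrightarrow> u \<in> ends M \<or> v \<in> ends M))"

lemma matched_weaken:
  assumes "matched St R s" "nats s' 4 = nats s 4" "\<And>u v. (u, v) \<in> St \<Longrightarrow> R' u v \<Longrightarrow> R u v"
  shows "matched St R' s'"
proof -
  from assms(1)[unfolded matched_def] obtain M where M: "M \<subseteq> St" "matching M" "bits s 4 (ends M)"
      and all: "\<forall>(u, v) \<in> St. R u v \<longrightarrow> u \<in> ends M \<or> v \<in> ends M"
    by (elim exE conjE)
  have M4: "u \<in> ends M \<or> v \<in> ends M" if "(u, v) \<in> St" "R u v" for u v
    using bspec[OF all that(1)] that(2) by (simp only: case_prod_conv simp_thms)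
  have "bits s' 4 (ends M)" using M(3) assms(2) by (simp add: bits_def)
  moreover have "\<forall>(u, v) \<in> St. R' u v \<longrightarrow> u \<in> ends M \<or> v \<in> ends M"
    using M4 assms(3) by (intro ballI) (simp only: case_prod_beta, metis prod.collapse)
  ultimately show ?thesis unfolding matched_def using M(1,2) by (intro exI[of _ M] conjI)
qed

lemma wp_match_pair:
  assumes s: "dist s" and p: "projected g s" and a: "get s 14 = a" "a < n" and b: "get s 15 = b" "b < n"
    and u: "get s 10 = u" "u < n" and v: "get s 11 = v" "v < n"
    and m: "matched (stretched n m x (d a b) g) R s"
  shows "wp N match_pair (matched (stretched n m x (d a b) g) (\<lambda>u' v'. R u' v' \<or> u' = u \<and> v' = v)) s"
proof -
  define St where "St = stretched n m x (d a b) g"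
  from m[folded St_def, unfolded matched_def] obtain M where M: "M \<subseteq> St" "matching M" "bits s 4 (ends M)"
      and all: "\<forall>(u, v) \<in> St. R u v \<longrightarrow> u \<in> ends M \<or> v \<in> ends M"
    by (elim exE conjE)
  have M4: "u \<in> ends M \<or> v \<in> ends M" if "(u, v) \<in> St" "R u v" for u v
    using bspec[OF all that(1)] that(2) by (simp only: case_prod_conv simp_thms)
  have val: "reals s 1 a b = d a b" "reals s 1 u v = d u v" "reals s 2 u 0 = ip m g (x u)" "reals s 2 v 0 = ip m g (x v)"
      "nats s 4 u 0 = of_bool (u \<in> ends M)" "nats s 4 v 0 = of_bool (v \<in> ends M)"
    using s p a b u v M(3) by (auto simp: dist_def projected_def bits_def)
  have St: "(u, v) \<in> St \<longleftrightarrow> 1 / 4 \<le> ip m g (x v) - ip m g (x u) \<and> d u v \<le> d a b"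
    using u v by (simp add: St_def stretched_def)
  show ?thesis
    unfolding match_pair_def skip_def St_def[symmetric]
  proof (rule wp_Cond)
    assume "bval match_guard s"
    then have new: "(u, v) \<in> St" "u \<notin> ends M" "v \<notin> ends M"
      unfolding St using a b u v val by (auto simp: not_less split: if_splits)
    define M' where "M' = insert (u, v) M"
    \<comment> \<open>A loop has stretch 0 and is never added, which keeps first and second
      endpoints disjoint.\<close>
    have uv: "u \<noteq> v" using new(1) by (auto simp: St)
    have "matching M'"
      using M(2) new uv by (auto simp: matching_def M'_def inj_on_def)
    moreover have "M' \<subseteq> St" using M(1) new(1) by (simp add: M'_def)
    moreover have ends: "ends M' = insert u (insert v (ends M))" by (auto simp: M'_def)
    define s' where "s' = s\<lparr>nats := upd 4 v 0 1 (upd 4 u 0 1 (nats s))\<rparr>"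
    have "bits s' 4 (ends M')"
      unfolding ends using M(3) u v by (auto simp: bits_def s'_def upd_def)
    ultimately have "matched St (\<lambda>u' v'. R u' v' \<or> u' = u \<and> v' = v) s'"
      unfolding matched_def using M4 by (intro exI[of _ M'] conjI) (auto simp: M'_def)
    then show "wp N (Seq (Mark 4 (Var 10) (NConst 1)) (Mark 4 (Var 11) (NConst 1)))
        (matched St (\<lambda>u' v'. R u' v' \<or> u' = u \<and> v' = v)) s"
      using u(1) v(1) by (intro wp_Seq wp_NWrite) (simp add: s'_def upd_def)
  next
    assume "\<not> bval match_guard s"
    then have old: "(u, v) \<in> St \<Longrightarrow> u \<in> ends M \<or> v \<in> ends M"
      unfolding St using a b u v val by (auto simp: not_less split: if_splits)
    have "bits (put 7 0 s) 4 (ends M)" using M(3) by (simp add: bits_def)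
    then have "matched St (\<lambda>u' v'. R u' v' \<or> u' = u \<and> v' = v) (put 7 0 s)"
      unfolding matched_def using M(1,2) M4 old by (intro exI[of _ M] conjI) auto
    then show "wp N (Set 7 (NConst 0)) (matched St (\<lambda>u' v'. R u' v' \<or> u' = u \<and> v' = v)) s"
      by (intro wp_Set) simp
  qed
qed

lemma matched_put: "a \<noteq> 4 \<Longrightarrow> matched St R s \<Longrightarrow> matched St R (put a y s)"
  by (erule matched_weaken) (auto simp: put_def upd_def)

lemma wp_match_com:
  assumes s: "dist s" and p: "projected g s" and a: "get s 14 = a" "a < n" and b: "get s 15 = b" "b < n"
  shows "wp N match_com (matched (stretched n m x (d a b) g) (\<lambda>_ _. True)) s"
proof -
  define St where "St = stretched n m x (d a b) g"
  have i: "inp s" using s by (simp add: dist_def)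
  show ?thesis
    unfolding match_com_def St_def[symmetric]
  proof (rule wp_Seq, rule wp_conseq)
    show "wp N (For 10 (Var 0) (Mark 4 (Var 10) (NConst 0))) (\<lambda>s'. \<forall>v<n. nats s' 4 v 0 = 0) s"
      by (rule wp_For_Mark[OF i]) auto
    fix s1 assume z: "\<forall>v<n. nats s1 4 v 0 = 0" and f1: "frame (For 10 (Var 0) (Mark 4 (Var 10) (NConst 0))) s s1"
    have d1: "dist s1" using dist_frame[OF s f1] by simp
    then have i1: "inp s1" by (simp add: dist_def)
    have p1: "projected g s1" using projected_frame[OF p f1] by simp
    have m1: "matched St (\<lambda>u v. u < 0) s1"
      unfolding matched_def using z by (intro exI[of _ "{}"]) (auto simp: matching_def bits_def)
    show "wp N (For 10 (Var 0) (For 11 (Var 0) match_pair)) (matched St (\<lambda>_ _. True)) s1"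
    proof (rule wp_For_n[where I = "\<lambda>j. matched St (\<lambda>u v. u < j)", OF i1]; ((use m1 in \<open>simp add: matched_put\<close>); fail)?)
      fix j s2 assume j: "j < n" "matched St (\<lambda>u v. u < j) s2" "get s2 10 = j" "inp s2"
        and f2: "frame (For 10 (Var 0) (For 11 (Var 0) match_pair)) s1 s2"
      show "wp N (For 11 (Var 0) match_pair) (matched St (\<lambda>u v. u < Suc j)) s2"
      proof (rule wp_For_n[where I = "\<lambda>l. matched St (\<lambda>u v. u < j \<or> u = j \<and> v < l)", OF j(4)];
          (simp add: j(2) matched_put; fail)?)
        fix l s3 assume l: "l < n" "matched St (\<lambda>u v. u < j \<or> u = j \<and> v < l) s3" "get s3 11 = l"
          and f3: "frame (For 11 (Var 0) match_pair) s2 s3"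
        have d3: "dist s3" using dist_frame[OF dist_frame[OF d1 f2] f3] by simp
        have p3: "projected g s3" using projected_frame[OF projected_frame[OF p1 f2] f3] by simp
        have g3: "get s3 14 = a" "get s3 15 = b" "get s3 10 = j"
          using frameD(1)[OF f1, of 14] frameD(1)[OF f2, of 14] frameD(1)[OF f3, of 14]
            frameD(1)[OF f1, of 15] frameD(1)[OF f2, of 15] frameD(1)[OF f3, of 15]
            frameD(1)[OF f3, of 10] a b j(3) by auto
        show "wp N match_pair (matched St (\<lambda>u v. u < j \<or> u = j \<and> v < Suc l)) s3"
          by (rule wp_conseq[OF wp_match_pair[OF d3 p3 g3(1) a(2) g3(2) b(2) g3(3) j(1) l(3,1) l(2)[unfolded St_def]]])
            (auto simp: St_def elim!: matched_weaken)
      next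
        show "matched St (\<lambda>u v. u < Suc j) s3" if "matched St (\<lambda>u v. u < j \<or> u = j \<and> v < n) s3" for s3
          by (rule matched_weaken[OF that]) (auto simp: St_def stretched_def)
      qed
    next
      show "matched St (\<lambda>_ _. True) s2" if "matched St (\<lambda>u v. u < n) s2" for s2
        by (rule matched_weaken[OF that]) (auto simp: St_def stretched_def)
    qed
  qed
qed

lemma wp_halfspaces:
  assumes s: "dist s" and b: "best s" and p: "projected g s" and Z: "bits s 4 Z"
  shows "wp N halfspaces (improved K s (\<exists>w<n. level_cut n m E x K (below n m x g Z w))) s"
proof (rule wp_For_search[OF s b]; (simp; fail)?)
  fix j s1 assume j: "j < n" "get s1 13 = j" "dist s1" "best s1" and f1: "frame halfspaces s s1"
  have Z1: "bits s1 4 Z" using bits_frame[OF Z f1] by simp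
  have p1: "projected g s1" using projected_frame[OF p f1] by simp
  have i1: "inp s1" using j(3) by (simp add: dist_def)
  show "wp N (Seq halfspace sweep)
    (improved K s1 (level_cut n m E x K (below n m x g Z j))) s1"
  proof (rule wp_Seq, rule wp_conseq[OF wp_halfspace[OF i1 Z1 p1 j(2,1)]])
    fix s2 assume f2: "frame halfspace s1 s2" and A: "bits s2 5 (below n m x g Z j)"
    have d2: "dist s2" using dist_frame[OF j(3) f2] by simp
    have b2: "best s2" using best_frame[OF j(4) f2] by simp
    have a2: "accepts K s2 = accepts K s1" using accepts_frame[OF f2] by simp
    from wp_sweep[OF d2 b2 A, of K] show "wp N sweep
        (improved K s1 (level_cut n m E x K (below n m x g Z j))) s2"
      unfolding a2 .
  qed
qed

lemma wp_round_com:
  assumes s: "dist s" and b: "best s"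
  shows "wp N round_com (improved K s (cut_row K (signs_of m s))) s"
proof -
  define g where "g = signs_of m s"
  define R where "R a b \<longleftrightarrow> (\<forall>M. maximal_matching (stretched n m x (d a b) g) M \<longrightarrow>
    (\<exists>w<n. level_cut n m E x K (below n m x g (ends M) w)))" for a b
  have row: "cut_row K g \<longleftrightarrow> (\<exists>a<n. \<exists>b<n. R a b)"
    unfolding cut_row_def R_def ..
  have i: "inp s" using s by (simp add: dist_def)
  show ?thesis
    unfolding round_com_def g_def[symmetric] row
  proof (rule wp_Seq, rule wp_conseq[OF wp_project[OF i]])
    fix s0 assume f0: "frame project s s0" and "projected (signs_of m s) s0"
    then have p0: "projected g s0" by (simp add: g_def)
    have d0: "dist s0" using dist_frame[OF s f0] by simp
    have b0: "best s0" using best_frame[OF b f0] by simp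
    have "wp N (For 14 (Var 0) threshold_row)
      (improved K s0 (\<exists>a<n. \<exists>b<n. R a b)) s0"
    proof (rule wp_For_search[OF d0 b0]; (simp; fail)?)
      fix j s1 assume j: "j < n" "get s1 14 = j" "dist s1" "best s1" and f1: "frame (For 14 (Var 0) threshold_row) s0 s1"
      have p1: "projected g s1" using projected_frame[OF p0 f1] by simp
      show "wp N threshold_row (improved K s1 (\<exists>b<n. R j b)) s1"
      proof (rule wp_For_search[OF j(3,4)]; (simp; fail)?)
        fix l s2 assume l: "l < n" "get s2 15 = l" "dist s2" "best s2" and f2: "frame threshold_row s1 s2"
        have p2: "projected g s2" using projected_frame[OF p1 f2] by simp
        have g2: "get s2 14 = j" using frameD(1)[OF f2, of 14] j(2) by simp
        show "wp N (Seq match_com halfspaces) (improved K s2 (R j l)) s2"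
        proof (rule wp_Seq, rule wp_conseq[OF wp_match_com[OF l(3) p2 g2 j(1) l(2,1)]])
          fix s3 assume f3: "frame match_com s2 s3"
            and "matched (stretched n m x (d j l) g) (\<lambda>_ _. True) s3"
          then obtain M where M: "maximal_matching (stretched n m x (d j l) g) M" "bits s3 4 (ends M)"
            unfolding matched_def by auto
          have d3: "dist s3" using dist_frame[OF l(3) f3] by simp
          have p3: "projected g s3" using projected_frame[OF p2 f3] by simp
          have b3: "best s3" using best_frame[OF l(4) f3] by simp
          have a3: "accepts K s3 = accepts K s2" using accepts_frame[OF f3] by simp
          have "R j l \<Longrightarrow> \<exists>w<n. level_cut n m E x K (below n m x g (ends M) w)"
            using M(1) unfolding R_def by (elim allE impE)
          then show "wp N halfspaces (improved K s2 (R j l)) s3"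
            unfolding a3[symmetric] by (intro wp_conseq[OF wp_halfspaces[OF d3 b3 p3 M(2), of K]]) simp
        qed
      qed
    qed
    then show "wp N (For 14 (Var 0) threshold_row)
      (improved K s (\<exists>a<n. \<exists>b<n. R a b)) s0"
      using accepts_frame[OF f0, of K] by simp
  qed
qed

text \<open>\<open>V i\<close> is the average of \<open>H\<close> conditioned on the first
  \<open>i\<close> tosses. It starts at \<open>avg m H\<close> and ends at \<open>H\<close> of the
  tossed vector; \<open>wins_Coin\<close> is its averaging property.\<close>

lemma wins_coins:
  assumes s: "inp s" and H: "\<And>g. 0 \<le> H g"
    and cont: "\<And>s'. frame coins s s' \<Longrightarrow> wins u (cs, s') G (H (signs_of m s'))"
  shows "wins (m * 4 + 3 + u) (coins # cs, s) G (avg m H)"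
proof -
  define V where "V i s' = tail_avg (m - i) i H (signs_of i s')" for i s'
  have "wins (m * (1 + 3) + 3 + u) (For 12 Dim (Coin 3 (Var 12) (NConst 0)) # cs, s) G (V 0 (put 12 0 s))"
  proof (rule For_rule[where \<Phi> = "\<lambda>t p. wins t p G" and I = "\<lambda>_ _. True"], erule (1) wins_det)
    fix s' assume "frame (For 12 Dim (Coin 3 (Var 12) (NConst 0))) s s'"
    then show "nval Dim s' = m"
      using inp_simps(2)[OF inp_frame[OF s]] by simp
  next
    fix j s' cs t
    assume j: "j < m" "get s' 12 = j"
      and c: "\<And>s''. get s'' 12 = j \<Longrightarrow> True \<Longrightarrow> frame (Coin 3 (Var 12) (NConst 0)) s' s'' \<Longrightarrow>
        wins t (cs, s'') G (V (Suc j) (put 12 (Suc j) s''))"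
    have "signs_of (Suc j) (put 12 (Suc j) (s'\<lparr>nats := upd 3 j 0 y (nats s')\<rparr>))
        = (signs_of j s')(j := (if y = 0 then - 1 else 1))" for y
      by (auto simp: signs_of_def fun_eq_iff less_Suc_eq upd_def)
    then have V: "V (Suc j) (put 12 (Suc j) (s'\<lparr>nats := upd 3 j 0 y (nats s')\<rparr>))
        = tail_avg (m - Suc j) (Suc j) H ((signs_of j s')(j := (if y = 0 then - 1 else 1)))" for y
      by (simp only: V_def)
    have w: "wins t (cs, s'\<lparr>nats := upd 3 (nval (Var 12) s') (nval (NConst 0) s') y (nats s')\<rparr>) G
        (tail_avg (m - Suc j) (Suc j) H ((signs_of j s')(j := (if y = 0 then - 1 else 1))))" for y
      using c[of "s'\<lparr>nats := upd 3 j 0 y (nats s')\<rparr>"] j(2) unfolding V by (simp add: upd_def frame_def)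
    have "m - j = Suc (m - Suc j)" using j(1) by simp
    then have Vj: "V j s' = (tail_avg (m - Suc j) (Suc j) H ((signs_of j s')(j := 1)) +
        tail_avg (m - Suc j) (Suc j) H ((signs_of j s')(j := - 1))) / 2"
      by (simp add: V_def)
    show "wins (1 + t) (Coin 3 (Var 12) (NConst 0) # cs, s') G (V j s')"
      unfolding Vj using wins_Coin[OF w[of 1] w[of 0]] tail_avg_nonneg[of H, OF H] by simp
  next
    fix s' assume "frame (For 12 Dim (Coin 3 (Var 12) (NConst 0))) s s'"
    then show "wins u (cs, s') G (V m s')" using cont[of s'] by (simp add: V_def coins_def)
  qed simp
  moreover have "V 0 (put 12 0 s) = avg m H"
    using avg_split[of m 0 H] by (simp add: V_def signs_of_def)
  ultimately show ?thesis by (simp add: coins_def)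
qed

definition trials_time :: nat where
  "trials_time = 32 * n * ((1 + (m * 4 + 3 + tm N round_com)) + 3) + 3 + 0"

abbreviation succeeds :: "real \<Rightarrow> nat \<Rightarrow> config \<Rightarrow> bool" where
  "succeeds K t p \<equiv> wins t p (\<lambda>s. best s \<and> accepts K s) (1 - (31 / 32) ^ (32 * n))"

lemma wins_trials:
  assumes s: "dist s" and b: "best s" and good: "accepts K s \<or> 1 / 32 \<le> avg m (\<lambda>g. of_bool (cut_row K g))"
  shows "succeeds K trials_time ([trials], s)"
proof -
  define G where "G = (\<lambda>s. best s \<and> accepts K s)"
  \<comment> \<open>The guaranteed probability before trial \<open>j\<close>: 1 once a cut has been
    accepted, otherwise what the remaining trials ensure.\<close>
  define V where "V j s' = (if accepts K s' then 1 else 1 - (31 / 32) ^ (32 * n - j) :: real)" for j s'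
  define T where "T = 1 + (m * 4 + 3 + tm N round_com)"
  \<comment> \<open>The first alternative covers runs in which a ball cut was accepted and nothing
    is known about \<open>cut_row\<close>.\<close>
  define I where "I s' \<longleftrightarrow> best s' \<and> (accepts K s' \<or> 1 / 32 \<le> avg m (\<lambda>g. of_bool (cut_row K g)))" for s'
  have "wins (32 * n * (T + 3) + 3 + 0) (For 18 (times 32 (Var 0)) (Seq coins round_com) # [], s) G (V 0 (put 18 0 s))"
  proof (rule For_rule[where \<Phi> = "\<lambda>t p. wins t p G" and I = "\<lambda>_. I"], erule (1) wins_det)
    fix s' assume "frame (For 18 (times 32 (Var 0)) (Seq coins round_com)) s s'"
    from dist_frame[OF s this] show "nval (times 32 (Var 0)) s' = 32 * n"
      using inp_simps(1)[of s'] by (simp add: dist_def)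
  next
    fix j s' cs t
    assume j: "j < 32 * n" "I s'" "get s' 18 = j" and f: "frame (For 18 (times 32 (Var 0)) (Seq coins round_com)) s s'"
      and cont: "\<And>s''. get s'' 18 = j \<Longrightarrow> I (put 18 (Suc j) s'') \<Longrightarrow> frame (Seq coins round_com) s' s'' \<Longrightarrow>
        wins t (cs, s'') G (V (Suc j) (put 18 (Suc j) s''))"
    have d': "dist s'" using dist_frame[OF s f] by simp
    define q where "q = 1 - (31 / 32 :: real) ^ (32 * n - Suc j)"
    have q: "0 \<le> q" "q \<le> 1" by (auto simp: q_def power_le_one)
    \<comment> \<open>The value of a trial as a function of its signs, with \<open>q\<close> the
      guarantee left after a failure. Its mean is at least \<open>q + (1 - q) / 32\<close>, which is
      the recursion of \<open>V\<close>.\<close>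
    define H where "H g = (if accepts K s' \<or> cut_row K g then 1 else q)" for g
    have "V j s' \<le> avg m H"
    proof (cases "accepts K s'")
      case False
      then have "1 / 32 \<le> avg m (\<lambda>g. of_bool (cut_row K g))" using j(2) by (simp add: I_def)
      then have "q + (1 - q) * (1 / 32) \<le> q + (1 - q) * avg m (\<lambda>g. of_bool (cut_row K g))"
        using q by (intro add_left_mono mult_left_mono) auto
      also have "\<dots> = avg m (\<lambda>g. q + (1 - q) * of_bool (cut_row K g))"
        by (simp only: avg_add avg_cmult avg_const)
      also have "(\<lambda>g. q + (1 - q) * of_bool (cut_row K g)) = H"
        using False by (auto simp: H_def)
      finally have "q + (1 - q) * (1 / 32) \<le> avg m H" .
      moreover have "32 * n - j = Suc (32 * n - Suc j)" using j(1) by simp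
      then have "V j s' = q + (1 - q) * (1 / 32)" using False by (simp add: V_def q_def)
      ultimately show ?thesis by simp
    next
      case True
      then have "H = (\<lambda>_. 1)" by (simp add: H_def fun_eq_iff)
      then show ?thesis using True by (simp add: V_def)
    qed
    moreover have "wins (m * 4 + 3 + (tm N round_com + t)) (coins # round_com # cs, s') G (avg m H)"
    proof (rule wins_coins)
      show "inp s'" using d' by (simp add: dist_def)
      show "0 \<le> H g" for g using q by (simp add: H_def)
      fix s1 assume f1: "frame coins s' s1"
      have d1: "dist s1" using dist_frame[OF d' f1] by simp
      have b1: "best s1" using best_frame[of s', OF _ f1] j(2) by (simp add: I_def)
      have a1: "accepts K s1 = accepts K s'" using accepts_frame[OF f1] by simp
      show "wins (tm N round_com + t) (round_com # cs, s1) G (H (signs_of m s1))"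
      proof (rule wins_wp[OF wp_round_com[OF d1 b1, of K]])
        fix s2 assume f2: "frame round_com s1 s2"
          and *: "best s2 \<and> (accepts K s1 \<or> cut_row K (signs_of m s1) \<longrightarrow> accepts K s2)"
        have "frame (Seq coins round_com) s' s2" using f1 f2 by (auto simp: frame_def)
        moreover have "get s2 18 = j" using frameD(1)[OF f1, of 18] frameD(1)[OF f2, of 18] j(3) by simp
        moreover have "I (put 18 (Suc j) s2)" using * a1 j(2) by (auto simp: I_def)
        ultimately have "wins t (cs, s2) G (V (Suc j) (put 18 (Suc j) s2))" by (intro cont)
        then show "wins t (cs, s2) G (H (signs_of m s1))"
          by (rule wins_mono) (use * a1 q in \<open>auto simp: H_def V_def q_def\<close>)
      qed
    qed
    ultimately have "wins (m * 4 + 3 + (tm N round_com + t)) (coins # round_com # cs, s') G (V j s')"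
      by (elim wins_mono) auto
    then have "wins (Suc (m * 4 + 3 + (tm N round_com + t))) (Seq coins round_com # cs, s') G (V j s')"
      by (intro wins_step) simp
    then show "wins (T + t) (Seq coins round_com # cs, s') G (V j s')"
      by (simp add: T_def add_ac)
  next
    fix s' assume "I s'"
    then show "wins 0 ([], s') G (V (32 * n) s')"
      by (auto simp: wins_def V_def G_def I_def)
  qed (use b good in \<open>simp add: I_def\<close>)
  then show ?thesis
    unfolding trials_def trials_time_def T_def G_def by (rule wins_mono) (auto simp: V_def)
qed

lemma wins_rounding:
  assumes "(\<exists>w<n. level_cut n m E x K {w}) \<or>
    1 / 32 \<le> avg m (\<lambda>g. of_bool (cut_row K g))"
  shows "\<exists>t. wins t ([rounding], encode n E m x) (\<lambda>s. best s \<and> accepts K s) (1 - (31 / 32) ^ (32 * n))"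
proof -
  define s where "s = encode n E m x"
  have i: "inp s" by (simp add: inp_def s_def)
  have z: "get s 23 = 0" by (simp add: s_def encode_def)
  have "succeeds K (tm N distances + (Suc (Suc (Suc (tm N balls + trials_time)))))
    (distances # [Seq (Set 22 (NConst 1)) (Seq balls trials)], s)"
  proof (rule wins_wp[OF wp_distances[OF i]])
    fix s1 assume f1: "frame distances s s1" and d1: "dist s1"
    define s2 where "s2 = put 22 (nval (NConst 1) s1) s1"
    have d2: "dist s2" using d1 by (auto simp: s2_def put_def dist_def inp_def upd_def)
    \<comment> \<open>Scalar \<open>23\<close> is 0 in the encoded input and untouched so far, so
      setting \<open>22\<close> to 1 creates the initial pair.\<close>
    have b2: "best s2" using frameD(1)[OF f1, of 23] z by (simp add: s2_def best_def)
    have "succeeds K (tm N balls + trials_time) (balls # [trials], s2)"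
    proof (rule wins_wp[OF wp_balls[OF d2 b2, of K]], rule wins_trials)
      fix s3 assume "frame balls s2 s3"
      then show "dist s3" by (rule dist_frame[OF d2]) simp_all
    qed (use assms in blast)+
    moreover have "step ([Seq (Set 22 (NConst 1)) (Seq balls trials)], s1) = return_pmf ([Set 22 (NConst 1), Seq balls trials], s1)"
      by simp
    moreover have "step ([Set 22 (NConst 1), Seq balls trials], s1) = return_pmf ([Seq balls trials], s2)"
      by (simp add: Set_def s2_def put_def)
    moreover have "step ([Seq balls trials], s2) = return_pmf ([balls, trials], s2)" by simp
    ultimately show "succeeds K (Suc (Suc (Suc (tm N balls + trials_time)))) ([Seq (Set 22 (NConst 1)) (Seq balls trials)], s1)"
      by (intro wins_det)
  qed
  moreover have "step ([rounding], s) = return_pmf (distances # [Seq (Set 22 (NConst 1)) (Seq balls trials)], s)"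
    by (simp add: rounding_def)
  ultimately have "succeeds K (Suc (tm N distances + (Suc (Suc (Suc (tm N balls + trials_time)))))) ([rounding], s)"
    by (intro wins_det)
  then show ?thesis unfolding s_def by blast
qed

end

section \<open>Choice of the constants and passage to the output distribution\<close>

theorem theorem3p3:
  "\<exists>c\<^sub>3 > 0. \<exists>\<epsilon>\<^sub>1 > 0. \<exists>C > 0. \<exists>P :: com. randomized_poly_time P \<and>
     (\<forall>(n::nat) (r::nat) (E :: (nat \<times> nat) set) (m::nat) (x :: nat \<Rightarrow> nat \<Rightarrow> real)
        (k::nat) (T :: nat \<Rightarrow> nat set).
        0 < n \<and> 0 < r \<and> regular_graph n r E \<and> arv_feasible n m x \<and> 2 \<le> k \<and>
        (\<forall>i \<in> {1..2 * k}. T i \<subseteq> {..<n} \<and> diam (sqdist m x) (T i) \<le> c\<^sub>3 / sqrt (ln (real k))) \<and>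
        real (card (\<Union>i \<in> {1..2 * k}. T i)) \<ge> (1 - \<epsilon>\<^sub>1) * real n
        \<longrightarrow>
        measure_pmf.prob (output_cut P n E m x)
          {S. S \<subseteq> {..<n} \<and> 0 < card S \<and> real (card S) \<le> real n / 2 \<and>
              expansion n r E S \<le> C * sqrt (ln (real k)) * arv_cost n r E m x}
        \<ge> 1 - 1 / real n)"
proof (rule exI[of _ "1 / 2 ^ 43"], rule conjI, simp, rule exI[of _ "1 / 2 ^ 17"], rule conjI, simp,
    rule exI[of _ "2 ^ 56"], rule conjI, simp, rule exI[of _ rounding], rule conjI,
    rule randomized_poly_time_rounding, intro allI impI, elim conjE)
  fix n r E m x k and T :: "nat \<Rightarrow> nat set"
  assume n: "0 < n" and r: "0 < r" and reg: "regular_graph n r E" and feas: "arv_feasible n m x" and k: "2 \<le> k"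
    and T: "\<forall>i \<in> {1..2 * k}. T i \<subseteq> {..<n} \<and> diam (sqdist m x) (T i) \<le> (1 / 2 ^ 43) / sqrt (ln (real k))"
    and cover: "(1 - 1 / 2 ^ 17) * real n \<le> real (card (\<Union>i \<in> {1..2 * k}. T i))"
  let ?X = "{S. S \<subseteq> {..<n} \<and> 0 < card S \<and> real (card S) \<le> real n / 2 \<and>
    expansion n r E S \<le> 2 ^ 56 * sqrt (ln (real k)) * arv_cost n r E m x}"
  interpret arv n r m E x by standard fact+
  define N where "N = 32 * (n + m)"
  interpret R: rounding_input n m E x N
    by standard (use E in \<open>auto simp: N_def\<close>)
  define q where "q = sqrt (ln (real k))"
  have q: "1 / 2 \<le> q" unfolding q_def by (rule sqrt_ln_ge_half[OF k])
  define \<Delta> where "\<Delta> = (1 / 2 ^ 42) / q"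
  have \<Delta>: "0 < \<Delta>" using q by (simp add: \<Delta>_def)
  \<comment> \<open>\<open>2 ^ 56\<close> is \<open>2 ^ 14\<close> from \<open>separated_cut\<close>
    times \<open>2 ^ 42\<close> from \<open>1 / \<Delta>\<close>. The factor \<open>r\<close>
    cancels against the one in the expansion.\<close>
  define K where "K = 2 ^ 56 * q * r * arv_cost n r E m x"
  have K1: "8 * r * arv_cost n r E m x \<le> K"
  proof -
    have "8 * real r \<le> (2 ^ 56 * q) * real r" using q by (intro mult_right_mono) auto
    from mult_right_mono[OF this cost_nonneg] show ?thesis by (simp add: K_def)
  qed
  have K2: "2 ^ 14 * r * arv_cost n r E m x / \<Delta> \<le> K"
    by (simp add: K_def \<Delta>_def)
  have "(\<exists>w<n. level_cut n m E x K {w}) \<or>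
    1 / 32 \<le> avg m (\<lambda>g. of_bool (R.cut_row K g))"
  proof (cases "\<exists>u<n. real n / 2 < (\<Sum>v<n. of_bool (d u v \<le> 1 / 4))")
    case True
    then show ?thesis using ball_cut[OF _ _ K1] by blast
  next
    case False
    then have "(\<Sum>v<n. of_bool (d u v \<le> 1 / 4)) \<le> real n / 2" if "u < n" for u
      using that False by (meson not_less)
    then have "1 / 32 \<le> avg m (\<lambda>g. of_bool (good n m x \<Delta> g))"
      unfolding \<Delta>_def q_def by (intro avg_good[OF n k tri bspec[OF T] cover])
    also have "\<dots> \<le> avg m (\<lambda>g. of_bool (R.cut_row K g))"
      using good_cut[OF _ \<Delta> K2] by (intro avg_mono) (auto simp: R.cut_row_def)
    finally show ?thesis by blast
  qed
  from R.wins_rounding[OF this] obtain t where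
    t: "wins t ([rounding], encode n E m x) (\<lambda>s. R.best s \<and> R.accepts K s) (1 - (31 / 32) ^ (32 * n))" by blast
  have halts: "halts_within rounding (encode n E m x) (tm N rounding)"
    using terminates_rounding[of n m] unfolding N_def
    by (intro halts_within_tm[where Q = "\<lambda>_. True"]) (auto simp: terminates_def encode_def)
  \<comment> \<open>Halting and success are known at different times; both persist up to the
    maximum.\<close>
  define t' where "t' = max t (tm N rounding)"
  have ht: "halts_within rounding (encode n E m x) t'"
    using halts by (rule halts_within_mono) (simp add: t'_def)
  have wt: "wins t' ([rounding], encode n E m x) (\<lambda>s. R.best s \<and> R.accepts K s) (1 - (31 / 32) ^ (32 * n))"
    using t by (rule wins_mono) (simp_all add: t'_def)
  have "1 / real n \<ge> (31 / 32) ^ (32 * n)"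
  proof -
    have "(31 / 32 :: real) \<le> exp (- (1 / 32))" using exp_ge_add_one_self[of "- (1 / 32)"] by simp
    then have "(31 / 32 :: real) ^ (32 * n) \<le> exp (- (1 / 32)) ^ (32 * n)" by (intro power_mono) auto
    also have "\<dots> = exp (- real n)" by (simp add: exp_of_nat_mult[symmetric])
    also have "\<dots> = 1 / exp (real n)" by (simp add: exp_minus field_simps)
    also have "\<dots> \<le> 1 / real n"
      using n order_trans[OF _ exp_ge_add_one_self[of "real n"], of "real n"] by (intro divide_left_mono) auto
    finally show ?thesis .
  qed
  then have "1 - 1 / real n \<le> 1 - (31 / 32) ^ (32 * n)" by simp
  also have "\<dots> \<le> measure_pmf.prob (run t' ([rounding], encode n E m x)) {(cs, s). cs = [] \<and> R.best s \<and> R.accepts K s}"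
    using wt by (simp add: wins_def measure_pmf.emeasure_eq_measure)
  also have "\<dots> \<le> measure_pmf.prob (run t' ([rounding], encode n E m x)) ((\<lambda>c. marked n (snd c)) -` ?X)"
  proof (rule measure_pmf.finite_measure_mono)
    show "{(cs, s). cs = [] \<and> R.best s \<and> R.accepts K s} \<subseteq> (\<lambda>c. marked n (snd c)) -` ?X"
    proof clarsimp
      fix s assume b: "R.best s" and a: "R.accepts K s"
      then obtain S where S: "R.bits s 2 S" "S \<noteq> {}" "2 * card S \<le> n" "get s 22 = cutsize n E S" "get s 23 = card S"
        by (auto simp: R.best_def R.accepts_def)
      have m: "marked n s = S" using S(1) by (auto simp: marked_def R.bits_def)
      have pos: "0 < card S" and le: "real (cutsize n E S) \<le> K * real (card S)"
        using a S(4,5) by (auto simp: R.accepts_def)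
      have "expansion n r E S \<le> 2 ^ 56 * q * arv_cost n r E m x"
        using le pos r by (simp add: expansion_def cutsize_def[symmetric] K_def field_simps)
      \<comment> \<open>The long numeral is \<open>2 ^ 56\<close>, evaluated by
        \<open>clarsimp\<close>.\<close>
      then show "marked n s \<subseteq> {..<n} \<and> 0 < card (marked n s) \<and> real (card (marked n s)) * 2 \<le> real n \<and>
        expansion n r E (marked n s) \<le> 72057594037927936 * sqrt (ln (real k)) * arv_cost n r E m x"
        using S(1,3) pos unfolding m by (auto simp: R.bits_def q_def)
    qed
  qed simp
  also have "\<dots> = measure_pmf.prob (output_cut rounding n E m x) ?X"
    by (simp add: output_cut_def final_store_eq[OF ht] pmf.map_comp measure_map_pmf o_def vimage_def)
  finally show "1 - 1 / real n \<le> measure_pmf.prob (output_cut rounding n E m x) ?X" .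
qed

end
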